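(* Let $n>1$, $R>0$, and let $\omega$ be a nontrivial ultrafilter on $\mathbf N$. For any factor state $\tau$ in $\mathcal S_R^n$ (equivalently, any extreme point of $\mathcal S_R^n$), $$\underline{\tilde\chi}_R(\tau)=\underline\chi_R(\tau),\qquad \tilde\chi_R^\omega(\tau)=\chi_R^\omega(\tau),\qquad \tilde\chi_R(\tau)=\chi_R(\tau).$$
   Context: Trace states. $\mathbf C\langle X_1,\dots,X_n\rangle$ is the unital $*$-algebra of noncommutative polynomials in self-adjoint indeterminates. $\mathcal S_R^n$ is the set of positive, tracial, $*$-linear maps $\tau:\mathbf C\langle X_1,\dots,X_n\rangle\to\mathbf C$ with $\tau(1)=1$ and $\tau(X_i^{2k})\le R^{2k}$ for all $i$ and all $k\ge0$; it is a compact convex set (weak$^*$ topology, as trace states of $*_{i=1}^nC([-R,R])$). For $n\ge2$ its extreme points are exactly the factor states (those whose GNS von Neumann algebra is a factor). $V_{\epsilon,K}(\tau)$ is the set of $\sigma\in\mathcal S_R^n$ such that $|\tau(m)-\sigma(m)|<\epsilon$ for all monomials $m$ of degree less than $K$. Matrices. $H_N^R$ is the set of Hermitian $N\times N$ matrices of operator norm at most $R$, with Lebesgue measure (for $\langle A,B\rangle=\mathrm{Tr}(AB)$). $\tau_{M_1,\dots,M_n}(P)=\frac1N\mathrm{Tr}(P(M_1,\dots,M_n))$; for a Borel probability measure $\mu$ on $(H_N^R)^n$, $\tau_\mu(P)=\int\frac1N\mathrm{Tr}(P(M_1,\dots,M_n))\,d\mu$. $\Gamma_R(\tau,\epsilon,K,N)$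 is the set of $(M_1,\dots,M_n)\in(H_N^R)^n$ with $\tau_{M_1,\dots,M_n}\in V_{\epsilon,K}(\tau)$. $\mathrm{Ent}(\mu)=-\int f\log f\,dx$ if $\mu=f\,dx$ with respect to Lebesgue measure and $\log f\in L^1(\mu)$, and $-\infty$ otherwise; suprema over empty sets and $\log0$ are $-\infty$. Entropies. $$\chi_R(\tau)=\lim_{K\to\infty,\epsilon\to0}\limsup_{N\to\infty}\Big(\tfrac1{N^2}\log\mathrm{Leb}(\Gamma_R(\tau,\epsilon,K,N))+\tfrac n2\log N\Big),$$ $$\tilde\chi_R(\tau)=\lim_{K\to\infty,\epsilon\to0}\limsup_{N\to\infty}\Big(\tfrac1{N^2}\sup_{\mu:\ \tau_\mu\in V_{\epsilon,K}(\tau)}\mathrm{Ent}(\mu)+\tfrac n2\log N\Big),$$ the supremum being over Borel probability measures on $(H_N^R)^n$; limits in $K,\epsilon$ are infima. $\underline\chi_R,\underline{\tilde\chi}_R$ are the same with $\liminf_{N\to\infty}$, and $\chi_R^\omega,\tilde\chi_R^\omega$ the same with $\lim_{N\to\omega}$, in place of $\limsup_{N\to\infty}$. *)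

theory Defs
  imports
    "HOL-Probability.Probability"
    "HOL-Library.Poly_Mapping"
    "Jordan_Normal_Form.Schur_Decomposition"
begin

section \<open>Noncommutative polynomials\<close>

text \<open>Lists form the free monoid, so the convolution product of \<open>Poly_Mapping\<close> turns the finitely
  supported functions on lists into the free unital algebra.  The list \<open>[i, j, ...]\<close> is the
  monomial \<open>X i * X j * ...\<close>.\<close>

instantiation list :: (type) monoid_add
begin
definition zero_list :: "'a list" where "zero_list = []"
definition plus_list :: "'a list \<Rightarrow> 'a list \<Rightarrow> 'a list" where "plus_list = (@)"
instance by standard (simp_all add: zero_list_def plus_list_def)
end

type_synonym 'n ncpoly = "'n list \<Rightarrow>\<^sub>0 complex"

abbreviation nc_const :: "complex \<Rightarrow> 'n ncpoly" where
  "nc_const c \<equiv> Poly_Mapping.single [] c"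

abbreviation nc_monom :: "'n list \<Rightarrow> 'n ncpoly" where
  "nc_monom w \<equiv> Poly_Mapping.single w 1"

abbreviation nc_var :: "'n \<Rightarrow> 'n ncpoly" where
  "nc_var i \<equiv> nc_monom [i]"

text \<open>The involution fixing the indeterminates.\<close>

lift_definition nc_star :: "'n ncpoly \<Rightarrow> 'n ncpoly" is "\<lambda>f w. cnj (f (rev w))"
proof -
  fix f :: "'n list \<Rightarrow> complex"
  assume "finite {w. f w \<noteq> 0}"
  then have "finite (rev ` {w. f w \<noteq> 0})" by simp
  moreover have "{w. cnj (f (rev w)) \<noteq> 0} \<subseteq> rev ` {w. f w \<noteq> 0}"
    by (auto intro: rev_image_eqI)
  ultimately show "finite {w. cnj (f (rev w)) \<noteq> 0}" by (rule finite_subset[rotated])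
qed


section \<open>Trace states\<close>

text \<open>Below \<open>\<le>\<close> is the order on the complex numbers of \<open>HOL-Library.Complex_Order\<close>, in which
  \<open>x \<le> y\<close> means that \<open>y - x\<close> is a nonnegative real number.\<close>

definition trace_states :: "real \<Rightarrow> ('n ncpoly \<Rightarrow> complex) set" where
  "trace_states R = {\<tau>.
     (\<forall>p q. \<tau> (p + q) = \<tau> p + \<tau> q) \<and>
     (\<forall>c p. \<tau> (nc_const c * p) = c * \<tau> p) \<and>
     (\<forall>p. \<tau> (nc_star p) = cnj (\<tau> p)) \<and>
     (\<forall>p. 0 \<le> \<tau> (nc_star p * p)) \<and>
     (\<forall>p q. \<tau> (p * q) = \<tau> (q * p)) \<and>
     \<tau> 1 = 1 \<and>
     (\<forall>i k. \<tau> (nc_var i ^ (2 * k)) \<le> complex_of_real (R ^ (2 * k)))}"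

definition state_nbhd ::
  "real \<Rightarrow> real \<Rightarrow> nat \<Rightarrow> ('n ncpoly \<Rightarrow> complex) \<Rightarrow> ('n ncpoly \<Rightarrow> complex) set" where
  "state_nbhd R \<epsilon> K \<tau> =
     {\<sigma> \<in> trace_states R. \<forall>w. length w < K \<longrightarrow> cmod (\<tau> (nc_monom w) - \<sigma> (nc_monom w)) < \<epsilon>}"

definition extreme_trace_state :: "real \<Rightarrow> ('n ncpoly \<Rightarrow> complex) \<Rightarrow> bool" where
  "extreme_trace_state R \<tau> \<longleftrightarrow> \<tau> \<in> trace_states R \<and>
     (\<forall>\<sigma>\<^sub>1 \<in> trace_states R. \<forall>\<sigma>\<^sub>2 \<in> trace_states R. \<forall>t::real. 0 < t \<and> t < 1 \<longrightarrow>
        \<tau> = (\<lambda>p. of_real t * \<sigma>\<^sub>1 p + of_real (1 - t) * \<sigma>\<^sub>2 p) \<longrightarrow> \<sigma>\<^sub>1 = \<sigma>\<^sub>2)"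


section \<open>The GNS representation and factor states\<close>

definition gns_seminorm :: "('n ncpoly \<Rightarrow> complex) \<Rightarrow> 'n ncpoly \<Rightarrow> real" where
  "gns_seminorm \<tau> p = sqrt (Re (\<tau> (nc_star p * p)))"

text \<open>The completion of the polynomials for the sesquilinear form \<open>\<langle>p, q\<rangle> = \<tau> (q\<^sup>* p)\<close>.
  The limit of a Cauchy sequence \<open>b\<close> is represented by the antilinear functional
  \<open>a \<mapsto> lim \<langle>b k, a\<rangle>\<close>; two Cauchy sequences give the same functional iff their difference
  tends to \<open>0\<close> in the seminorm.  Thus \<open>\<xi> a\<close> is the inner product of the vector \<open>\<xi>\<close> with the
  class of \<open>a\<close>, and the vector space operations are pointwise.\<close>

definition gns_space :: "('n ncpoly \<Rightarrow> complex) \<Rightarrow> ('n ncpoly \<Rightarrow> complex) set" where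
  "gns_space \<tau> = {\<xi>. \<exists>b :: nat \<Rightarrow> 'n ncpoly.
     (\<forall>e>0. \<exists>k\<^sub>0. \<forall>j\<ge>k\<^sub>0. \<forall>k\<ge>k\<^sub>0. gns_seminorm \<tau> (b j - b k) < e) \<and>
     (\<forall>a. (\<lambda>k. \<tau> (nc_star a * b k)) \<longlonglongrightarrow> \<xi> a)}"

text \<open>The Hilbert space norm, as the supremum of \<open>\<bar>\<langle>\<xi>, a\<rangle>\<bar>\<close> over the dense set of polynomials
  in the unit ball.\<close>

definition gns_norm :: "('n ncpoly \<Rightarrow> complex) \<Rightarrow> ('n ncpoly \<Rightarrow> complex) \<Rightarrow> real" where
  "gns_norm \<tau> \<xi> = (SUP a\<in>{a. gns_seminorm \<tau> a \<le> 1}. cmod (\<xi> a))"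

text \<open>Left multiplication by \<open>x\<close>: \<open>\<langle>x \<xi>, a\<rangle> = \<langle>\<xi>, x\<^sup>* a\<rangle>\<close>.\<close>

definition gns_rep :: "'n ncpoly \<Rightarrow> ('n ncpoly \<Rightarrow> complex) \<Rightarrow> ('n ncpoly \<Rightarrow> complex)" where
  "gns_rep x \<xi> = (\<lambda>a. \<xi> (nc_star x * a))"

text \<open>Bounded operators; only their values on \<open>gns_space \<tau>\<close> matter.\<close>

definition gns_bounded_ops ::
  "('n ncpoly \<Rightarrow> complex) \<Rightarrow> (('n ncpoly \<Rightarrow> complex) \<Rightarrow> ('n ncpoly \<Rightarrow> complex)) set" where
  "gns_bounded_ops \<tau> = {T.
     (\<forall>\<xi>\<in>gns_space \<tau>. T \<xi> \<in> gns_space \<tau>) \<and>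
     (\<forall>\<xi>\<in>gns_space \<tau>. \<forall>\<eta>\<in>gns_space \<tau>. T (\<lambda>a. \<xi> a + \<eta> a) = (\<lambda>a. T \<xi> a + T \<eta> a)) \<and>
     (\<forall>c. \<forall>\<xi>\<in>gns_space \<tau>. T (\<lambda>a. c * \<xi> a) = (\<lambda>a. c * T \<xi> a)) \<and>
     (\<exists>C. \<forall>\<xi>\<in>gns_space \<tau>. gns_norm \<tau> (T \<xi>) \<le> C * gns_norm \<tau> \<xi>)}"

definition gns_commutant ::
  "('n ncpoly \<Rightarrow> complex) \<Rightarrow> (('n ncpoly \<Rightarrow> complex) \<Rightarrow> ('n ncpoly \<Rightarrow> complex)) set
    \<Rightarrow> (('n ncpoly \<Rightarrow> complex) \<Rightarrow> ('n ncpoly \<Rightarrow> complex)) set" where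
  "gns_commutant \<tau> S =
     {T \<in> gns_bounded_ops \<tau>. \<forall>s\<in>S. \<forall>\<xi>\<in>gns_space \<tau>. T (s \<xi>) = s (T \<xi>)}"

definition gns_vonneumann_algebra ::
  "('n ncpoly \<Rightarrow> complex) \<Rightarrow> (('n ncpoly \<Rightarrow> complex) \<Rightarrow> ('n ncpoly \<Rightarrow> complex)) set" where
  "gns_vonneumann_algebra \<tau> = gns_commutant \<tau> (gns_commutant \<tau> (range gns_rep))"

definition factor_state :: "('n ncpoly \<Rightarrow> complex) \<Rightarrow> bool" where
  "factor_state \<tau> \<longleftrightarrow>
     (\<forall>T \<in> gns_vonneumann_algebra \<tau> \<inter> gns_commutant \<tau> (gns_vonneumann_algebra \<tau>).
        \<exists>c. \<forall>\<xi>\<in>gns_space \<tau>. T \<xi> = (\<lambda>a. c * \<xi> a))"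


section \<open>Hermitian matrices\<close>

definition herm :: "nat \<Rightarrow> complex mat set" where
  "herm N = {A \<in> carrier_mat N N. mat_adjoint A = A}"

definition vec_l2norm :: "complex vec \<Rightarrow> real" where
  "vec_l2norm v = sqrt (\<Sum>i<dim_vec v. (cmod (v $ i))\<^sup>2)"

definition op_norm :: "complex mat \<Rightarrow> real" where
  "op_norm A = (SUP v\<in>{v \<in> carrier_vec (dim_col A). vec_l2norm v \<le> 1}. vec_l2norm (A *\<^sub>v v))"

definition herm_ball :: "nat \<Rightarrow> real \<Rightarrow> complex mat set" where
  "herm_ball N R = {A \<in> herm N. op_norm A \<le> R}"

text \<open>The Borel \<open>\<sigma>\<close>-algebra on Hermitian matrices, generated by the matrix entries.\<close>

definition herm_borel :: "nat \<Rightarrow> complex mat measure" where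
  "herm_borel N =
     vimage_algebra (herm N) (\<lambda>A. \<lambda>ij\<in>{..<N} \<times> {..<N}. A $$ ij)
       (PiM ({..<N} \<times> {..<N}) (\<lambda>_. borel))"

text \<open>An isometry from Euclidean \<open>N\<^sup>2\<close>-space onto the Hermitian matrices with the inner product
  \<open>Tr (A B)\<close>; the factor \<open>1 / sqrt 2\<close> accounts for each off-diagonal entry occurring twice.\<close>

definition herm_of_coords :: "nat \<Rightarrow> (nat \<times> nat \<Rightarrow> real) \<Rightarrow> complex mat" where
  "herm_of_coords N x = mat N N (\<lambda>(i, j).
     if i = j then complex_of_real (x (i, i))
     else if i < j then Complex (x (i, j) / sqrt 2) (x (j, i) / sqrt 2)
     else Complex (x (j, i) / sqrt 2) (- x (i, j) / sqrt 2))"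

definition herm_lebesgue :: "nat \<Rightarrow> complex mat measure" where
  "herm_lebesgue N =
     distr (PiM ({..<N} \<times> {..<N}) (\<lambda>_. lborel)) (herm_borel N) (herm_of_coords N)"

text \<open>Lebesgue measure on the \<open>n\<close>-tuples of elements of \<open>herm_ball N R\<close>, where \<open>n = CARD('n)\<close>.\<close>

definition tuple_ball :: "nat \<Rightarrow> real \<Rightarrow> ('n \<Rightarrow> complex mat) set" where
  "tuple_ball N R = {M. \<forall>i. M i \<in> herm_ball N R}"

definition tuple_lebesgue :: "nat \<Rightarrow> real \<Rightarrow> ('n::finite \<Rightarrow> complex mat) measure" where
  "tuple_lebesgue N R = restrict_space (PiM UNIV (\<lambda>_. herm_lebesgue N)) (tuple_ball N R)"

definition word_eval :: "nat \<Rightarrow> ('n \<Rightarrow> complex mat) \<Rightarrow> 'n list \<Rightarrow> complex mat" where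
  "word_eval N M w = foldr (\<lambda>i A. M i * A) w (1\<^sub>m N)"

definition nc_eval :: "nat \<Rightarrow> ('n \<Rightarrow> complex mat) \<Rightarrow> 'n ncpoly \<Rightarrow> complex mat" where
  "nc_eval N M p = mat N N (\<lambda>ij.
     \<Sum>w\<in>Poly_Mapping.keys p. Poly_Mapping.lookup p w * word_eval N M w $$ ij)"

definition mat_trace :: "complex mat \<Rightarrow> complex" where
  "mat_trace A = (\<Sum>i<dim_row A. A $$ (i, i))"

definition matrix_state :: "nat \<Rightarrow> ('n \<Rightarrow> complex mat) \<Rightarrow> 'n ncpoly \<Rightarrow> complex" where
  "matrix_state N M p = mat_trace (nc_eval N M p) / of_nat N"

definition measure_state ::
  "nat \<Rightarrow> ('n \<Rightarrow> complex mat) measure \<Rightarrow> 'n ncpoly \<Rightarrow> complex" where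
  "measure_state N \<mu> p = (\<integral>M. matrix_state N M p \<partial>\<mu>)"

definition microstates ::
  "real \<Rightarrow> real \<Rightarrow> nat \<Rightarrow> nat \<Rightarrow> ('n ncpoly \<Rightarrow> complex) \<Rightarrow> ('n \<Rightarrow> complex mat) set" where
  "microstates R \<epsilon> K N \<tau> = {M \<in> tuple_ball N R. matrix_state N M \<in> state_nbhd R \<epsilon> K \<tau>}"


section \<open>Entropies\<close>

definition ennreal_log :: "ennreal \<Rightarrow> ereal" where
  "ennreal_log x = (if x = 0 then -\<infinity> else if x = \<infinity> then \<infinity> else ereal (ln (enn2real x)))"

text \<open>\<open>RN_deriv L \<mu>\<close> is a density of \<open>\<mu>\<close> with respect to \<open>L\<close> whenever there is one.\<close>

definition Ent :: "'a measure \<Rightarrow> 'a measure \<Rightarrow> ereal" where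
  "Ent L \<mu> =
     (let f = (\<lambda>x. enn2real (RN_deriv L \<mu> x)) in
      if (\<exists>g \<in> borel_measurable L. \<mu> = density L g) \<and> integrable \<mu> (\<lambda>x. ln (f x))
      then ereal (- (\<integral>x. f x * ln (f x) \<partial>L))
      else -\<infinity>)"

text \<open>In the next two definitions \<open>lm\<close> is the way of taking the limit in \<open>N\<close>.  The bounds
  decrease as \<open>K\<close> grows and \<open>\<epsilon>\<close> shrinks, so that the infima are the limits for
  \<open>K \<rightarrow> \<infinity>\<close>, \<open>\<epsilon> \<rightarrow> 0\<close>.\<close>

definition chi_with ::
  "((nat \<Rightarrow> ereal) \<Rightarrow> ereal) \<Rightarrow> real \<Rightarrow> ('n::finite ncpoly \<Rightarrow> complex) \<Rightarrow> ereal" where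
  "chi_with lm R \<tau> = (INF K. INF \<epsilon>\<in>{0<..}. lm (\<lambda>N.
     ereal (1 / real N ^ 2) *
       ennreal_log (emeasure (tuple_lebesgue N R) (microstates R \<epsilon> K N \<tau>))
     + ereal (real CARD('n) / 2 * ln (real N))))"

definition chi_tilde_with ::
  "((nat \<Rightarrow> ereal) \<Rightarrow> ereal) \<Rightarrow> real \<Rightarrow> ('n::finite ncpoly \<Rightarrow> complex) \<Rightarrow> ereal" where
  "chi_tilde_with lm R \<tau> = (INF K. INF \<epsilon>\<in>{0<..}. lm (\<lambda>N.
     ereal (1 / real N ^ 2) *
       (SUP \<mu>\<in>{\<mu>. sets \<mu> = sets (tuple_lebesgue N R) \<and> prob_space \<mu> \<and>
                   measure_state N \<mu> \<in> state_nbhd R \<epsilon> K \<tau>}. Ent (tuple_lebesgue N R) \<mu>)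
     + ereal (real CARD('n) / 2 * ln (real N))))"

definition chi :: "real \<Rightarrow> ('n::finite ncpoly \<Rightarrow> complex) \<Rightarrow> ereal" where
  "chi = chi_with limsup"

definition chi_lower :: "real \<Rightarrow> ('n::finite ncpoly \<Rightarrow> complex) \<Rightarrow> ereal" where
  "chi_lower = chi_with liminf"

definition chi_ultra :: "nat filter \<Rightarrow> real \<Rightarrow> ('n::finite ncpoly \<Rightarrow> complex) \<Rightarrow> ereal" where
  "chi_ultra \<omega> = chi_with (Lim \<omega>)"

definition chi_tilde :: "real \<Rightarrow> ('n::finite ncpoly \<Rightarrow> complex) \<Rightarrow> ereal" where
  "chi_tilde = chi_tilde_with limsup"

definition chi_tilde_lower :: "real \<Rightarrow> ('n::finite ncpoly \<Rightarrow> complex) \<Rightarrow> ereal" where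
  "chi_tilde_lower = chi_tilde_with liminf"

definition chi_tilde_ultra :: "nat filter \<Rightarrow> real \<Rightarrow> ('n::finite ncpoly \<Rightarrow> complex) \<Rightarrow> ereal" where
  "chi_tilde_ultra \<omega> = chi_tilde_with (Lim \<omega>)"

definition nontrivial_ultrafilter :: "nat filter \<Rightarrow> bool" where
  "nontrivial_ultrafilter \<omega> \<longleftrightarrow> \<omega> \<noteq> bot \<and>
     (\<forall>P. eventually P \<omega> \<or> eventually (\<lambda>N. \<not> P N) \<omega>) \<and> (\<forall>N. \<omega> \<noteq> principal {N})"

end

theory Submission
  imports Defs "HOL-Real_Asymp.Real_Asymp"
begin

text \<open>A factor state is extreme: if \<open>t \<sigma> \<le> \<tau>\<close>, the sesquilinear form \<open>t \<sigma> (a\<^sup>* b)\<close> is given by a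
  bounded operator on the GNS space, and traciality puts it into the centre of the von Neumann
  algebra, so \<open>\<sigma>\<close> is proportional to \<open>\<tau>\<close>.

  If \<open>\<tau>\<close> is extreme and \<open>\<tau>\<^sub>\<mu>\<close> is close to \<open>\<tau>\<close>, then by compactness \<open>\<mu>\<close> gives mass at least \<open>1 - \<delta>\<close> to
  the microstates \<open>\<Gamma>\<close> of \<open>\<tau>\<close>.  Gibbs' inequality then yields
  \<open>Ent \<mu> \<le> ln 2 + (1 - \<delta>) ln (Leb \<Gamma>) + \<delta> ln b\<close>, where \<open>b\<close> is a Gaussian bound for the volume of the
  whole ball, and \<open>ln b / N\<^sup>2 + n / 2 ln N\<close> does not depend on \<open>N\<close>.  Now let \<open>\<delta>\<close> tend to \<open>0\<close>.\<close>

subsection \<open>The star algebra of noncommutative polynomials\<close>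

text \<open>Closeness of the averaged state of \<open>\<mu>\<close> to \<open>\<tau>\<close> does
  not by itself control individual matrix tuples: a mixture of two very different families of tuples
  may average to \<open>\<tau>\<close>. Extremality forbids this, but it is a property of the limit
  object, while the entropy bound is needed for every N. The mass estimate must therefore be uniform
  in N and \<open>\<mu>\<close>; compactness provides this, provided that the weight of the
  split-off part is bounded below independently of N and \<open>\<mu>\<close>. The mass
  \<open>\<delta>\<close> off the microstates still costs entropy, at most
  \<open>\<delta> ln b\<close>. This is harmless after division by N^2 because the Gaussian is taken
  with variance 1/N, so that its normalising factor cancels the term n/2 ln N. Both alternatives of
  the hypothesis enter through extremality. The ultrafilter has two roles: a mode of taking the
  limit in N, and the source of limit points in the compactness argument.\<close>

lemma ncpoly_mult_single:
  "Poly_Mapping.single u a * Poly_Mapping.single v b = (Poly_Mapping.single (u @ v) (a * b) :: 'n ncpoly)"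
  by (simp add: mult_single plus_list_def)

lemma ncpoly_one: "(1 :: 'n ncpoly) = nc_monom []"
  by (metis single_one zero_list_def)

text \<open>A polynomial is a finite sum of scaled words, so additive statements are checked on
  those; bilinear identities come from nesting two such inductions.\<close>

lemma ncpoly_induct [case_names single add]:
  fixes p :: "'n ncpoly"
  assumes single: "\<And>w c. P (Poly_Mapping.single w c)"
    and add: "\<And>p q. P p \<Longrightarrow> P q \<Longrightarrow> P (p + q)"
  shows "P p"
proof (induction p rule: Poly_Mapping.update_induct)
  case const
  show ?case using single[of "[]" 0] by simp
next
  case (update f a b)
  have "Poly_Mapping.update a b f = f + Poly_Mapping.single a b"
    using update(1) by (intro poly_mapping_eqI)
      (auto simp: lookup_update lookup_add lookup_single when_def in_keys_iff)
  then show ?case using update(3) single add by metis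
qed

lemma lookup_nc_star: "Poly_Mapping.lookup (nc_star p) w = cnj (Poly_Mapping.lookup p (rev w))"
  by transfer simp

lemma nc_star_add: "nc_star (p + q) = nc_star p + nc_star q"
  by (rule poly_mapping_eqI) (simp add: lookup_nc_star lookup_add)

lemma nc_star_diff: "nc_star (p - q) = nc_star p - nc_star q"
  by (rule poly_mapping_eqI) (simp add: lookup_nc_star lookup_minus)

lemma nc_star_single: "nc_star (Poly_Mapping.single w c) = Poly_Mapping.single (rev w) (cnj c)"
  by (rule poly_mapping_eqI) (auto simp: lookup_nc_star lookup_single when_def)

lemma nc_star_star [simp]: "nc_star (nc_star p) = p"
  by (rule poly_mapping_eqI) (simp add: lookup_nc_star)

lemma nc_star_one [simp]: "nc_star 1 = 1"
  by (simp add: ncpoly_one nc_star_single)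

lemma nc_star_mult: "nc_star (p * q) = nc_star q * nc_star p"
proof (induction p rule: ncpoly_induct)
  case (single w c)
  show ?case
    by (induction q rule: ncpoly_induct)
      (simp_all add: ncpoly_mult_single nc_star_single nc_star_add algebra_simps)
qed (simp add: nc_star_add algebra_simps)

lemma nc_const_commute: "nc_const c * p = p * nc_const c"
  by (induction p rule: ncpoly_induct) (simp_all add: ncpoly_mult_single algebra_simps)

lemma nc_const_mult_monom: "nc_const c * nc_monom w = Poly_Mapping.single w c"
  by (simp add: ncpoly_mult_single)

text \<open>A common shape for a state, which is determined by its values on words, and for a single
  entry of \<open>nc_eval\<close>; additivity is then proved once for both.\<close>

definition lin_ext :: "('n list \<Rightarrow> complex) \<Rightarrow> 'n ncpoly \<Rightarrow> complex" where
  "lin_ext f p = (\<Sum>w\<in>Poly_Mapping.keys p. Poly_Mapping.lookup p w * f w)"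

lemma lin_ext_add: "lin_ext f (p + q) = lin_ext f p + lin_ext f q"
  unfolding lin_ext_def
  by (rule setsum_keys_plus_distrib[where f = "\<lambda>k x. x * f k"]) (simp_all add: algebra_simps)

lemma lin_ext_single: "lin_ext f (Poly_Mapping.single w c) = c * f w"
  by (simp add: lin_ext_def)

lemma nc_var_power: "nc_var i ^ k = (nc_monom (replicate k i) :: 'n ncpoly)"
  by (induction k) (simp_all add: ncpoly_one ncpoly_mult_single)


subsection \<open>Trace states and their GNS seminorm\<close>

locale trace_state =
  fixes R :: real and \<tau> :: "'n ncpoly \<Rightarrow> complex"
  assumes state: "\<tau> \<in> trace_states R" and R_pos: "R > 0"
begin

abbreviation nrm :: "'n ncpoly \<Rightarrow> real" where "nrm \<equiv> gns_seminorm \<tau>"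

lemma add: "\<tau> (p + q) = \<tau> p + \<tau> q"
  and scale: "\<tau> (nc_const c * p) = c * \<tau> p"
  and star: "\<tau> (nc_star p) = cnj (\<tau> p)"
  and pos: "0 \<le> \<tau> (nc_star p * p)"
  and trace: "\<tau> (p * q) = \<tau> (q * p)"
  and one: "\<tau> 1 = 1"
  and var_bound: "\<tau> (nc_var i ^ (2 * k)) \<le> complex_of_real (R ^ (2 * k))"
  using state unfolding trace_states_def by blast+

lemma zero [simp]: "\<tau> 0 = 0"
  using add[of 0 0] by simp

lemma diff: "\<tau> (p - q) = \<tau> p - \<tau> q"
  using add[of "p - q" q] by simp

lemma scale_right: "\<tau> (p * (nc_const c * q)) = c * \<tau> (p * q)"
  by (metis mult.assoc nc_const_commute scale)

lemma scale_left: "\<tau> ((nc_const c * p) * q) = c * \<tau> (p * q)"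
  by (simp add: mult.assoc scale)

lemma star_const: "nc_star (nc_const c * p) = nc_const (cnj c) * nc_star p"
  by (simp add: nc_star_mult nc_star_single nc_const_commute)

lemma nrm_nonneg [simp]: "nrm p \<ge> 0"
  using pos[of p] by (simp add: gns_seminorm_def less_eq_complex_def)

lemma nrm_sq: "(nrm p)\<^sup>2 = Re (\<tau> (nc_star p * p))"
  using pos[of p] by (simp add: gns_seminorm_def less_eq_complex_def)

lemma nrm_sq_complex: "\<tau> (nc_star p * p) = complex_of_real ((nrm p)\<^sup>2)"
  using pos[of p] by (simp add: nrm_sq less_eq_complex_def complex_eq_iff)

lemma nrm_star [simp]: "nrm (nc_star p) = nrm p"
  using trace[of p "nc_star p"] by (simp add: gns_seminorm_def)

text \<open>The quadratic in \<open>z\<close> behind two later arguments: its nonnegativity gives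
  Cauchy--Schwarz, and inside a minimisation problem it identifies the limit of a minimising
  sequence.\<close>

lemma nrm_add_scale_sq:
  "(nrm (a + nc_const z * b))\<^sup>2
    = (nrm a)\<^sup>2 + 2 * Re (cnj z * \<tau> (nc_star b * a)) + (cmod z)\<^sup>2 * (nrm b)\<^sup>2"
proof -
  have s: "\<tau> (nc_star a * b) = cnj (\<tau> (nc_star b * a))"
    using star[of "nc_star b * a"] by (simp add: nc_star_mult)
  have "\<tau> (nc_star (a + nc_const z * b) * (a + nc_const z * b))
     = \<tau> (nc_star a * a) + z * \<tau> (nc_star a * b) + cnj z * \<tau> (nc_star b * a)
       + cnj z * z * \<tau> (nc_star b * b)"
    by (simp add: nc_star_add star_const distrib_left distrib_right add scale_right scale_left)
  then have "complex_of_real ((nrm (a + nc_const z * b))\<^sup>2)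
     = of_real ((nrm a)\<^sup>2) + z * cnj (\<tau> (nc_star b * a)) + cnj z * \<tau> (nc_star b * a)
       + cnj z * z * of_real ((nrm b)\<^sup>2)"
    by (simp only: nrm_sq_complex s)
  moreover have "cnj z * z = complex_of_real ((cmod z)\<^sup>2)"
    by (metis complex_norm_square mult.commute)
  moreover have re: "Re (z * cnj (\<tau> (nc_star b * a))) = Re (cnj z * \<tau> (nc_star b * a))"
    by simp
  ultimately have "complex_of_real ((nrm (a + nc_const z * b))\<^sup>2)
     = of_real ((nrm a)\<^sup>2 + (cmod z)\<^sup>2 * (nrm b)\<^sup>2)
       + z * cnj (\<tau> (nc_star b * a)) + cnj z * \<tau> (nc_star b * a)"
    by (simp only: of_real_mult of_real_add add_ac)
  from arg_cong[OF this, of Re] show ?thesis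
    by (simp only: plus_complex.sel Re_complex_of_real re mult_2 ac_simps)
qed

text \<open>The seminorm of \<open>b - s g a\<close> is nonnegative for every real \<open>s\<close>,
  and \<open>s = 1 / (nrm a)\<^sup>2\<close> is the best choice. The form may be degenerate: if
  \<open>nrm a = 0\<close>, the inequality is affine in \<open>s\<close>, and a large
  \<open>s\<close> forces \<open>g = 0\<close>.\<close>

lemma Cauchy_Schwarz: "cmod (\<tau> (nc_star a * b)) \<le> nrm a * nrm b"
proof -
  define g where "g = \<tau> (nc_star a * b)"
  have ineq: "0 \<le> (nrm b)\<^sup>2 - 2 * s * (cmod g)\<^sup>2 + s\<^sup>2 * (cmod g)\<^sup>2 * (nrm a)\<^sup>2" for s :: real
  proof -
    have "0 \<le> (nrm (b + nc_const (- of_real s * g) * a))\<^sup>2" by simp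
    also have "\<dots> = (nrm b)\<^sup>2 - 2 * s * (cmod g)\<^sup>2 + s\<^sup>2 * (cmod g)\<^sup>2 * (nrm a)\<^sup>2"
    proof -
      have "cnj (- of_real s * g) * g = of_real (- s * (cmod g)\<^sup>2)"
        unfolding of_real_mult complex_norm_square by simp
      then have "Re (cnj (- of_real s * g) * g) = - s * (cmod g)\<^sup>2"
        by (metis Re_complex_of_real)
      then show ?thesis
        unfolding nrm_add_scale_sq g_def[symmetric]
        by (simp add: norm_mult power_mult_distrib)
    qed
    finally show ?thesis .
  qed
  have "(cmod g)\<^sup>2 \<le> (nrm a)\<^sup>2 * (nrm b)\<^sup>2"
  proof (cases "nrm a = 0")
    case True
    have "cmod g = 0"
    proof (rule ccontr)
      assume "cmod g \<noteq> 0"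
      then show False
        using ineq[of "((nrm b)\<^sup>2 + 1) / (cmod g)\<^sup>2"] True zero_le_power2[of "nrm b"]
          by (simp del: zero_le_power2)
    qed
    then show ?thesis by simp
  next
    case False
    then show ?thesis
      using ineq[of "1 / (nrm a)\<^sup>2"] zero_less_power2[of "nrm a"]
      by (simp add: power2_eq_square divide_simps) (simp add: ac_simps)
  qed
  then show ?thesis
    unfolding g_def by (metis mult_nonneg_nonneg nrm_nonneg power2_le_imp_le power_mult_distrib)
qed

lemma nrm_scale: "nrm (nc_const c * p) = cmod c * nrm p"
proof -
  have "(nrm (nc_const c * p))\<^sup>2 = (cmod c * nrm p)\<^sup>2"
    using nrm_add_scale_sq[of 0 c p] by (simp add: power_mult_distrib gns_seminorm_def)
  then show ?thesis by simp
qed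

lemma nrm_zero [simp]: "nrm 0 = 0"
  by (simp add: gns_seminorm_def)

lemma nrm_triangle: "nrm (a + b) \<le> nrm a + nrm b"
proof -
  have "(nrm (a + b))\<^sup>2 = (nrm a)\<^sup>2 + 2 * Re (\<tau> (nc_star b * a)) + (nrm b)\<^sup>2"
    using nrm_add_scale_sq[of a 1 b] by (simp flip: ncpoly_one)
  also have "\<dots> \<le> (nrm a)\<^sup>2 + 2 * (nrm b * nrm a) + (nrm b)\<^sup>2"
    using Cauchy_Schwarz[of b a] complex_Re_le_cmod[of "\<tau> (nc_star b * a)"] by linarith
  also have "\<dots> = (nrm a + nrm b)\<^sup>2"
    by (simp add: power2_eq_square algebra_simps)
  finally show ?thesis by (rule power2_le_imp_le) simp
qed

lemma nrm_parallelogram: "(nrm (a - b))\<^sup>2 + (nrm (a + b))\<^sup>2 = 2 * (nrm a)\<^sup>2 + 2 * (nrm b)\<^sup>2"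
  unfolding nrm_sq
  by (simp add: nc_star_add nc_star_diff add diff distrib_left distrib_right
      left_diff_distrib right_diff_distrib)

section \<open>Multiplication operators are bounded for the seminorm\<close>

lemma nc_star_var_power: "nc_star (nc_var i ^ k) = nc_var i ^ k"
  by (simp add: nc_var_power nc_star_single)

lemma nrm_var_power_mult_sq:
  "complex_of_real ((nrm (nc_var i ^ k * a))\<^sup>2) = \<tau> (nc_star a * (nc_var i ^ (2 * k) * a))"
  unfolding nrm_sq_complex[symmetric]
  by (simp add: nc_star_mult nc_star_var_power mult.assoc mult_2 power_add)

text \<open>The squared seminorm of a power is an even moment; this is where the bound
  \<open>R\<close> in the definition of trace states enters.\<close>

lemma nrm_var_power_le: "nrm (nc_var i ^ k) \<le> R ^ k"
proof -
  have "complex_of_real ((nrm (nc_var i ^ k))\<^sup>2) = \<tau> (nc_var i ^ (2 * k))"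
    using nrm_var_power_mult_sq[of i k 1] unfolding nc_star_one mult_1_left mult_1_right .
  then have "complex_of_real ((nrm (nc_var i ^ k))\<^sup>2) \<le> complex_of_real (R ^ (2 * k))"
    using var_bound[of i k] by metis
  then have "(nrm (nc_var i ^ k))\<^sup>2 \<le> R ^ (2 * k)"
    unfolding less_eq_complex_def Re_complex_of_real by (rule conjunct1)
  then have "(nrm (nc_var i ^ k))\<^sup>2 \<le> (R ^ k)\<^sup>2"
    by (metis power_even_eq)
  then show ?thesis
    by (rule power2_le_imp_le) (use R_pos in simp)
qed

text \<open>Cauchy--Schwarz gives \<open>q m ^ 2 \<le> q 0 * q (2 m)\<close> for \<open>q m = \<parallel>X\<^sup>m a\<parallel>\<^sup>2\<close>, while \<open>q m\<close> is
  bounded by a multiple of \<open>R ^ (2 m)\<close> by the trace property; iterate along powers of two.\<close>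

lemma nrm_var_mult_le: "nrm (nc_var i * a) \<le> R * nrm a"
proof (cases "nrm (nc_var i * a) = 0")
  case True
  then show ?thesis using R_pos by simp
next
  case False
  define q where "q k = (nrm (nc_var i ^ k * a))\<^sup>2" for k
  have q_nn: "q k \<ge> 0" for k by (simp add: q_def)
  have q_eq: "complex_of_real (q k) = \<tau> (nc_star a * (nc_var i ^ (2 * k) * a))" for k
    unfolding q_def by (rule nrm_var_power_mult_sq)
  have q_double: "(q k)\<^sup>2 \<le> q 0 * q (2 * k)" for k
  proof -
    have "q k \<le> nrm a * nrm (nc_var i ^ (2 * k) * a)"
      using Cauchy_Schwarz[of a "nc_var i ^ (2 * k) * a"] q_nn[of k] unfolding q_eq[symmetric] by simp
    then have "(q k)\<^sup>2 \<le> (nrm a * nrm (nc_var i ^ (2 * k) * a))\<^sup>2"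
      by (rule power_mono) (rule q_nn)
    then show ?thesis by (simp add: q_def power_mult_distrib)
  qed
  define D where "D = nrm (a * nc_star a)"
  have q_le: "q k \<le> D * (R\<^sup>2) ^ k" for k
  proof -
    have "complex_of_real (q k) = \<tau> (nc_var i ^ (2 * k) * (a * nc_star a))"
      using trace[of "nc_star a" "nc_var i ^ (2 * k) * a"] by (simp only: q_eq mult.assoc)
    also have "cmod \<dots> \<le> nrm (nc_var i ^ (2 * k)) * D"
      using Cauchy_Schwarz[of "nc_var i ^ (2 * k)" "a * nc_star a"]
      by (simp add: nc_star_var_power D_def)
    also have "\<dots> \<le> R ^ (2 * k) * D"
      by (intro mult_right_mono nrm_var_power_le) (simp add: D_def)
    finally show ?thesis
      using q_nn[of k] by (simp add: power_mult[of R 2] mult.commute[of D])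
  qed
  have q1: "q 1 > 0" using False q_nn[of 1] by (simp add: q_def)
  have q0: "q 0 > 0"
    using q_double[of 1] q1 q_nn[of 0] by (cases "q 0 = 0") auto
  have iter: "(q 1 / q 0) ^ (2 ^ k) \<le> q (2 ^ k) / q 0" for k
  proof (induction k)
    case (Suc k)
    have "(q 1 / q 0) ^ (2 ^ Suc k) = ((q 1 / q 0) ^ (2 ^ k))\<^sup>2"
      by (simp add: power_mult[symmetric] mult.commute)
    also have "\<dots> \<le> (q (2 ^ k) / q 0)\<^sup>2"
      by (rule power_mono[OF Suc]) (simp add: q_nn)
    also have "\<dots> \<le> q (2 ^ Suc k) / q 0"
      using q_double[of "2 ^ k"] q0 by (simp add: power2_eq_square field_simps)
    finally show ?case .
  qed simp
  have "q 1 / (q 0 * R\<^sup>2) \<le> 1"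
  proof (rule ccontr)
    assume "\<not> ?thesis"
    then have r: "q 1 / (q 0 * R\<^sup>2) > 1" by simp
    \<comment> \<open>If this ratio exceeded 1, its powers would be unbounded. The estimate is
      available at exponents \<open>2 ^ m\<close>, which suffices because
      \<open>r ^ m \<le> r ^ (2 ^ m)\<close>.\<close>
    define r where "r = q 1 / (q 0 * R\<^sup>2)"
    obtain m where m: "D / q 0 < r ^ m"
      using r real_arch_pow[of r "D / q 0"] unfolding r_def by auto
    also have "r ^ m \<le> r ^ (2 ^ m)"
      using r by (intro power_increasing) (auto simp: r_def)
    also have "\<dots> = (q 1 / q 0) ^ (2 ^ m) / (R\<^sup>2) ^ (2 ^ m)"
      by (simp add: r_def power_divide power_mult_distrib)
    also have "\<dots> \<le> (q (2 ^ m) / q 0) / (R\<^sup>2) ^ (2 ^ m)"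
      by (rule divide_right_mono[OF iter]) simp
    also have "\<dots> \<le> (D * (R\<^sup>2) ^ (2 ^ m) / q 0) / (R\<^sup>2) ^ (2 ^ m)"
      using q_le[of "2 ^ m"] q0 by (intro divide_right_mono) auto
    also have "\<dots> = D / q 0" using R_pos by simp
    finally show False by simp
  qed
  then have "q 1 \<le> R\<^sup>2 * q 0"
    using q0 R_pos by (simp add: field_simps)
  then have "(nrm (nc_var i * a))\<^sup>2 \<le> (R * nrm a)\<^sup>2"
    by (simp add: q_def power_mult_distrib)
  then show ?thesis
    by (rule power2_le_imp_le) (use R_pos in simp)
qed

lemma nrm_monom_mult_le: "nrm (nc_monom w * a) \<le> R ^ length w * nrm a"
proof (induction w)
  case Nil
  then show ?case by (simp flip: ncpoly_one)
next
  case (Cons i w)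
  have "nrm (nc_monom (i # w) * a) = nrm (nc_var i * (nc_monom w * a))"
    by (simp add: mult.assoc[symmetric] ncpoly_mult_single)
  also have "\<dots> \<le> R * nrm (nc_monom w * a)" by (rule nrm_var_mult_le)
  also have "\<dots> \<le> R * (R ^ length w * nrm a)"
    using Cons R_pos by simp
  finally show ?case by simp
qed

lemma nrm_one [simp]: "nrm 1 = 1"
  by (simp only: gns_seminorm_def one nc_star_one mult_1_left) simp

lemma cmod_monom_le: "cmod (\<tau> (nc_monom w)) \<le> R ^ length w"
proof -
  have "cmod (\<tau> (nc_star 1 * nc_monom w)) \<le> nrm 1 * nrm (nc_monom w)"
    by (rule Cauchy_Schwarz)
  also have "\<dots> \<le> R ^ length w"
    using nrm_monom_mult_le[of w 1] by (simp only: mult_1_right mult_1_left nrm_one)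
  finally show ?thesis by (simp only: nc_star_one mult_1_left)
qed

text \<open>This makes left multiplication act on the completion: it sends Cauchy sequences to
  Cauchy sequences.\<close>

lemma left_mult_bounded: "\<exists>C\<ge>0. \<forall>a. nrm (x * a) \<le> C * nrm a"
proof (induction x rule: ncpoly_induct)
  case (single w c)
  have "nrm (Poly_Mapping.single w c * a) \<le> (cmod c * R ^ length w) * nrm a" for a
  proof -
    have "nrm (Poly_Mapping.single w c * a) = cmod c * nrm (nc_monom w * a)"
      using nrm_scale[of c "nc_monom w * a"] by (simp only: mult.assoc[symmetric] nc_const_mult_monom)
    then show ?thesis
      using mult_left_mono[OF nrm_monom_mult_le[of w a], of "cmod c"] by (simp add: mult.assoc)
  qed
  moreover have "cmod c * R ^ length w \<ge> 0" using R_pos by simp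
  ultimately show ?case by blast
next
  case (add p q)
  then obtain C D where "C \<ge> 0" "D \<ge> 0"
    and C: "\<And>a. nrm (p * a) \<le> C * nrm a" and D: "\<And>a. nrm (q * a) \<le> D * nrm a" by blast
  have "nrm ((p + q) * a) \<le> (C + D) * nrm a" for a
    using nrm_triangle[of "p * a" "q * a"] C[of a] D[of a] by (simp add: distrib_right)
  then show ?case using \<open>C \<ge> 0\<close> \<open>D \<ge> 0\<close> by (intro exI[of _ "C + D"]) simp
qed

text \<open>The involution is isometric because \<open>\<tau>\<close> is tracial, and it turns right
  multiplication by \<open>x\<close> into left multiplication by \<open>nc_star x\<close>.\<close>

lemma right_mult_bounded: "\<exists>C\<ge>0. \<forall>a. nrm (a * x) \<le> C * nrm a"
proof -
  obtain C where "C \<ge> 0" and C: "\<And>a. nrm (nc_star x * a) \<le> C * nrm a"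
    using left_mult_bounded[of "nc_star x"] by blast
  have "nrm (a * x) \<le> C * nrm a" for a
    using C[of "nc_star a"] nrm_star[of "a * x"] by (simp only: nc_star_mult nrm_star)
  then show ?thesis using \<open>C \<ge> 0\<close> by blast
qed

lemma eq_scaleD:
  assumes "\<And>a. \<sigma> a = c * \<tau> a" "\<sigma> 1 = 1"
  shows "\<sigma> = \<tau>"
  using assms(1)[of 1] assms by (simp add: one fun_eq_iff)

end

context trace_state
begin

subsection \<open>The GNS space\<close>

text \<open>Vectors of the completion are functionals; this relation keeps a representing Cauchy
  sequence at hand, since operators and estimates are set up on sequences and then passed to the
  limit.\<close>

definition gns_limit :: "(nat \<Rightarrow> 'n ncpoly) \<Rightarrow> ('n ncpoly \<Rightarrow> complex) \<Rightarrow> bool" where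
  "gns_limit b \<xi> \<longleftrightarrow> (\<forall>e>0. \<exists>k\<^sub>0. \<forall>j\<ge>k\<^sub>0. \<forall>k\<ge>k\<^sub>0. nrm (b j - b k) < e) \<and>
     (\<forall>a. (\<lambda>k. \<tau> (nc_star a * b k)) \<longlonglongrightarrow> \<xi> a)"

lemma gns_space_iff: "\<xi> \<in> gns_space \<tau> \<longleftrightarrow> (\<exists>b. gns_limit b \<xi>)"
  by (simp add: gns_space_def gns_limit_def)

lemma gns_limitI:
  assumes "\<And>e. e > 0 \<Longrightarrow> \<exists>k\<^sub>0. \<forall>j\<ge>k\<^sub>0. \<forall>k\<ge>k\<^sub>0. nrm (b j - b k) < e"
    and "\<And>a. (\<lambda>k. \<tau> (nc_star a * b k)) \<longlonglongrightarrow> \<xi> a"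
  shows "gns_limit b \<xi>"
  using assms unfolding gns_limit_def by blast

lemma gns_limit_Cauchy:
  "gns_limit b \<xi> \<Longrightarrow> e > 0 \<Longrightarrow> \<exists>k\<^sub>0. \<forall>j\<ge>k\<^sub>0. \<forall>k\<ge>k\<^sub>0. nrm (b j - b k) < e"
  unfolding gns_limit_def by blast

lemma gns_limit_tendsto: "gns_limit b \<xi> \<Longrightarrow> (\<lambda>k. \<tau> (nc_star a * b k)) \<longlonglongrightarrow> \<xi> a"
  unfolding gns_limit_def by blast

lemma gns_limit_add:
  assumes "gns_limit b \<xi>" "gns_limit c \<eta>"
  shows "gns_limit (\<lambda>k. b k + c k) (\<lambda>a. \<xi> a + \<eta> a)"
proof (rule gns_limitI)
  fix e :: real assume "e > 0"
  then obtain k1 k2 where k1: "\<And>j k. j \<ge> k1 \<Longrightarrow> k \<ge> k1 \<Longrightarrow> nrm (b j - b k) < e / 2"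
    and k2: "\<And>j k. j \<ge> k2 \<Longrightarrow> k \<ge> k2 \<Longrightarrow> nrm (c j - c k) < e / 2"
    using gns_limit_Cauchy[OF assms(1), of "e / 2"] gns_limit_Cauchy[OF assms(2), of "e / 2"]
    by (metis half_gt_zero)
  have "nrm ((b j + c j) - (b k + c k)) < e" if "j \<ge> max k1 k2" "k \<ge> max k1 k2" for j k
    using nrm_triangle[of "b j - b k" "c j - c k"] k1[of j k] k2[of j k] that
    by (simp add: add_diff_add)
  then show "\<exists>k\<^sub>0. \<forall>j\<ge>k\<^sub>0. \<forall>k\<ge>k\<^sub>0. nrm ((b j + c j) - (b k + c k)) < e" by blast
next
  fix a show "(\<lambda>k. \<tau> (nc_star a * (b k + c k))) \<longlonglongrightarrow> \<xi> a + \<eta> a"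
    unfolding distrib_left add
    by (intro tendsto_add gns_limit_tendsto assms)
qed

lemma gns_limit_left_mult:
  assumes "gns_limit b \<xi>"
  shows "gns_limit (\<lambda>k. x * b k) (gns_rep x \<xi>)"
proof (rule gns_limitI)
  fix e :: real assume "e > 0"
  obtain C where "C \<ge> 0" and C: "\<And>a. nrm (x * a) \<le> C * nrm a"
    using left_mult_bounded[of x] by blast
  have "e / (C + 1) > 0" using \<open>e > 0\<close> \<open>C \<ge> 0\<close> by simp
  then obtain k0 where k0: "\<And>j k. j \<ge> k0 \<Longrightarrow> k \<ge> k0 \<Longrightarrow> nrm (b j - b k) < e / (C + 1)"
    using gns_limit_Cauchy[OF assms] by blast
  have "nrm (x * b j - x * b k) < e" if "j \<ge> k0" "k \<ge> k0" for j k
  proof -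
    have "nrm (x * b j - x * b k) \<le> C * nrm (b j - b k)"
      using C[of "b j - b k"] by (simp only: right_diff_distrib)
    also have "\<dots> \<le> (C + 1) * nrm (b j - b k)"
      by (rule mult_right_mono) auto
    also have "\<dots> < (C + 1) * (e / (C + 1))"
      using k0[OF that] \<open>C \<ge> 0\<close> by (intro mult_strict_left_mono) auto
    finally show ?thesis using \<open>C \<ge> 0\<close> by simp
  qed
  then show "\<exists>k\<^sub>0. \<forall>j\<ge>k\<^sub>0. \<forall>k\<ge>k\<^sub>0. nrm (x * b j - x * b k) < e" by blast
next
  fix a show "(\<lambda>k. \<tau> (nc_star a * (x * b k))) \<longlonglongrightarrow> gns_rep x \<xi> a"
    using gns_limit_tendsto[OF assms, of "nc_star x * a"]
    by (simp add: gns_rep_def nc_star_mult mult.assoc)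
qed

lemma gns_limit_scale:
  assumes "gns_limit b \<xi>"
  shows "gns_limit (\<lambda>k. nc_const c * b k) (\<lambda>a. c * \<xi> a)"
proof -
  have "gns_rep (nc_const c) \<xi> = (\<lambda>a. c * \<xi> a)"
  proof
    fix a
    have "(\<lambda>k. \<tau> (nc_star a * (nc_const c * b k))) \<longlonglongrightarrow> c * \<xi> a"
      unfolding scale_right by (intro tendsto_mult_left gns_limit_tendsto assms)
    then show "gns_rep (nc_const c) \<xi> a = c * \<xi> a"
      using gns_limit_tendsto[OF gns_limit_left_mult[OF assms, of "nc_const c"], of a]
      by (rule LIMSEQ_unique[rotated])
  qed
  with gns_limit_left_mult[OF assms, of "nc_const c"] show ?thesis by simp
qed

lemma gns_limit_const: "gns_limit (\<lambda>_. p) (\<lambda>a. \<tau> (nc_star a * p))"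
  by (rule gns_limitI) auto

lemma gns_limit_diff:
  assumes "gns_limit b \<xi>" "gns_limit c \<eta>"
  shows "gns_limit (\<lambda>k. b k - c k) (\<lambda>a. \<xi> a - \<eta> a)"
proof -
  have "nc_const (-1) * p = - p" for p :: "'n ncpoly"
    by (metis mult_minus_left mult_1_left ncpoly_one single_uminus)
  then show ?thesis
    using gns_limit_add[OF assms(1) gns_limit_scale[OF assms(2), of "-1"]] by simp
qed

lemma gns_limit_bounded:
  assumes "gns_limit b \<xi>"
  shows "\<exists>B>0. \<forall>k. nrm (b k) \<le> B"
proof -
  obtain k0 where k0: "\<And>j k. j \<ge> k0 \<Longrightarrow> k \<ge> k0 \<Longrightarrow> nrm (b j - b k) < 1"
    using gns_limit_Cauchy[OF assms, of "1 :: real"] by auto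
  define B where "B = (\<Sum>k\<le>k0. nrm (b k)) + 1"
  have le: "nrm (b k) \<le> (\<Sum>k\<le>k0. nrm (b k))" if "k \<le> k0" for k
    using that by (intro member_le_sum) auto
  have "nrm (b k) \<le> B" for k
  proof (cases "k \<le> k0")
    case True
    then show ?thesis using le[of k] by (simp add: B_def)
  next
    case False
    then show ?thesis
      using nrm_triangle[of "b k - b k0" "b k0"] k0[of k k0] le[of k0] by (simp add: B_def)
  qed
  moreover have "B > 0"
    unfolding B_def by (rule add_nonneg_pos) (auto intro: sum_nonneg)
  ultimately show ?thesis by blast
qed

lemma gns_limit_functional_le:
  assumes "gns_limit b \<xi>" "\<And>k. k \<ge> k0 \<Longrightarrow> nrm (b k) \<le> B"
  shows "cmod (\<xi> a) \<le> B * nrm a"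
proof (rule tendsto_upperbound)
  show "(\<lambda>k. cmod (\<tau> (nc_star a * b k))) \<longlonglongrightarrow> cmod (\<xi> a)"
    by (intro tendsto_norm gns_limit_tendsto assms)
  have "cmod (\<tau> (nc_star a * b k)) \<le> B * nrm a" if "k \<ge> k0" for k
    using Cauchy_Schwarz[of a "b k"] mult_left_mono[OF assms(2)[OF that], of "nrm a"]
    by (simp add: mult.commute)
  then show "\<forall>\<^sub>F k in sequentially. cmod (\<tau> (nc_star a * b k)) \<le> B * nrm a"
    unfolding eventually_sequentially by blast
qed simp

lemma gns_space_bounded:
  assumes "\<xi> \<in> gns_space \<tau>"
  obtains C where "C \<ge> 0" "\<And>a. cmod (\<xi> a) \<le> C * nrm a"
proof -
  obtain b where b: "gns_limit b \<xi>" using assms gns_space_iff by blast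
  obtain B where B: "B > 0" "\<And>k. nrm (b k) \<le> B"
    using gns_limit_bounded[OF b] by blast
  show ?thesis
  proof (rule that)
    show "0 \<le> B" using B(1) by simp
    show "cmod (\<xi> a) \<le> B * nrm a" for a
      using gns_limit_functional_le[OF b] B(2) by blast
  qed
qed

lemma gns_norm_le:
  assumes "\<And>a. cmod (\<xi> a) \<le> C * nrm a" "C \<ge> 0"
  shows "gns_norm \<tau> \<xi> \<le> C"
  unfolding gns_norm_def
proof (rule cSUP_least)
  show "{a. nrm a \<le> 1} \<noteq> {}" using nrm_zero by (auto intro: exI[of _ 0])
  fix a assume "a \<in> {a. nrm a \<le> 1}"
  then show "cmod (\<xi> a) \<le> C"
    using assms(1)[of a] mult_left_mono[of "nrm a" 1 C] assms(2) by simp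
qed

lemma gns_functional_scale:
  assumes "\<xi> \<in> gns_space \<tau>"
  shows "\<xi> (nc_const c * a) = cnj c * \<xi> a"
proof -
  obtain b where b: "gns_limit b \<xi>" using assms gns_space_iff by blast
  have "(\<lambda>k. \<tau> (nc_star (nc_const c * a) * b k)) \<longlonglongrightarrow> cnj c * \<xi> a"
    unfolding star_const scale_left by (intro tendsto_mult_left gns_limit_tendsto b)
  then show ?thesis
    using gns_limit_tendsto[OF b, of "nc_const c * a"] LIMSEQ_unique by blast
qed

text \<open>The supremum in \<open>gns_norm\<close> is taken in the reals, so boundedness is
  established first, from \<open>gns_space_bounded\<close>. Polynomials of seminorm 0 cannot be
  normalised, but \<open>\<xi>\<close> vanishes on them.\<close>

lemma gns_norm_bound:
  assumes "\<xi> \<in> gns_space \<tau>"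
  shows "cmod (\<xi> a) \<le> gns_norm \<tau> \<xi> * nrm a"
proof -
  obtain C where C: "C \<ge> 0" "\<And>a. cmod (\<xi> a) \<le> C * nrm a"
    using gns_space_bounded[OF assms] by blast
  show ?thesis
  proof (cases "nrm a = 0")
    case True
    then show ?thesis using C(2)[of a] by simp
  next
    case False
    then have pos: "nrm a > 0" using nrm_nonneg[of a] by linarith
    define a' where "a' = nc_const (of_real (1 / nrm a)) * a"
    have "nrm a' \<le> 1" using pos by (simp add: a'_def nrm_scale norm_divide)
    moreover have "bdd_above ((\<lambda>a. cmod (\<xi> a)) ` {a. nrm a \<le> 1})"
    proof (rule bdd_aboveI2)
      fix a assume "a \<in> {a. nrm a \<le> 1}"
      then show "cmod (\<xi> a) \<le> C"
        using C(2)[of a] mult_left_mono[of "nrm a" 1 C] C(1) by simp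
    qed
    ultimately have "cmod (\<xi> a') \<le> gns_norm \<tau> \<xi>"
      unfolding gns_norm_def by (intro cSUP_upper) auto
    then show ?thesis
      using pos by (simp add: a'_def gns_functional_scale[OF assms] norm_mult norm_divide field_simps)
  qed
qed

lemma gns_norm_nonneg: "\<xi> \<in> gns_space \<tau> \<Longrightarrow> gns_norm \<tau> \<xi> \<ge> 0"
  using order_trans[OF norm_ge_zero gns_norm_bound[of \<xi> 1]] by simp

text \<open>For late \<open>k\<close> the vector \<open>b k - \<xi>\<close> has norm at most
  \<open>e\<close>; evaluating it at \<open>b k\<close> itself compares the square of
  \<open>nrm (b k)\<close> with \<open>\<xi> (b k)\<close>. In particular, a sequence that
  represents the zero vector has seminorms tending to 0.\<close>

lemma gns_limit_nrm_le:
  assumes "gns_limit b \<xi>" "e > 0"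
  shows "\<exists>k0. \<forall>k\<ge>k0. nrm (b k) \<le> gns_norm \<tau> \<xi> + e"
proof -
  have \<xi>: "\<xi> \<in> gns_space \<tau>" using assms gns_space_iff by blast
  obtain k0 where k0: "\<And>j k. j \<ge> k0 \<Longrightarrow> k \<ge> k0 \<Longrightarrow> nrm (b j - b k) < e"
    using gns_limit_Cauchy[OF assms] by blast
  have "nrm (b k) \<le> gns_norm \<tau> \<xi> + e" if k: "k \<ge> k0" for k
  proof (cases "nrm (b k) = 0")
    case True
    then show ?thesis using gns_norm_nonneg[OF \<xi>] assms(2) by simp
  next
    case False
    have lim: "gns_limit (\<lambda>j. b k - b j) (\<lambda>a. \<tau> (nc_star a * b k) - \<xi> a)"
      by (rule gns_limit_diff[OF gns_limit_const assms(1)])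
    have "cmod (\<tau> (nc_star (b k) * b k) - \<xi> (b k)) \<le> e * nrm (b k)"
      by (rule gns_limit_functional_le[OF lim, of k0])
        (use k0[OF k] in \<open>simp add: less_imp_le\<close>)
    moreover have "cmod (\<tau> (nc_star (b k) * b k)) \<le>
        cmod (\<tau> (nc_star (b k) * b k) - \<xi> (b k)) + cmod (\<xi> (b k))"
      by norm
    moreover have "cmod (\<tau> (nc_star (b k) * b k)) = nrm (b k) * nrm (b k)"
      unfolding nrm_sq_complex norm_of_real by (simp add: power2_eq_square)
    ultimately have "nrm (b k) * nrm (b k) \<le> (gns_norm \<tau> \<xi> + e) * nrm (b k)"
      using gns_norm_bound[OF \<xi>, of "b k"] by (simp add: distrib_right)
    then show ?thesis using False nrm_nonneg[of "b k"] by simp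
  qed
  then show ?thesis by blast
qed

text \<open>Riesz: minimise \<open>\<parallel>h\<parallel>\<^sup>2 - 2 Re (\<phi> h)\<close> over the polynomials; the parallelogram law makes a
  minimising sequence Cauchy, and comparing with \<open>h + z a\<close> identifies its limit.\<close>

lemma gns_space_Riesz:
  assumes \<phi>_add: "\<And>a b. \<phi> (a + b) = \<phi> a + \<phi> b"
    and \<phi>_scale: "\<And>c a. \<phi> (nc_const c * a) = cnj c * \<phi> a"
    and \<phi>_bound: "\<And>a. cmod (\<phi> a) \<le> C * nrm a"
  shows "\<phi> \<in> gns_space \<tau>"
proof -
  define J where "J h = (nrm h)\<^sup>2 - 2 * Re (\<phi> h)" for h
  have J_ge: "J h \<ge> - C\<^sup>2" for h
  proof -
    have "Re (\<phi> h) \<le> C * nrm h"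
      using complex_Re_le_cmod[of "\<phi> h"] \<phi>_bound[of h] by linarith
    moreover have "(nrm h - C)\<^sup>2 = (nrm h)\<^sup>2 + C\<^sup>2 - 2 * (C * nrm h)"
      by (simp add: power2_diff)
    ultimately show ?thesis
      using zero_le_power2[of "nrm h - C"] unfolding J_def by linarith
  qed
  define m where "m = (INF h. J h)"
  have bdd: "bdd_below (range J)" using J_ge by (intro bdd_belowI2[of _ "- C\<^sup>2"])
  have m_le: "m \<le> J h" for h
    unfolding m_def by (rule cINF_lower[OF bdd]) simp
  have "\<exists>h. J h < m + 1 / real (Suc k)" for k
  proof -
    have "m < m + 1 / real (Suc k)" by simp
    then show ?thesis
      unfolding m_def using cINF_less_iff[OF _ bdd] by (metis (no_types, lifting) UNIV_not_empty)
  qed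
  then obtain h where h: "\<And>k. J (h k) < m + 1 / real (Suc k)" by metis
  have "gns_limit h \<phi>"
  proof (rule gns_limitI)
    fix e :: real assume "e > 0"
    then have "e\<^sup>2 / 4 > 0" by simp
    then obtain k0 where "inverse (real (Suc k0)) < e\<^sup>2 / 4"
      using reals_Archimedean by blast
    then have k0: "1 / real (Suc k0) < e\<^sup>2 / 4" by (simp add: inverse_eq_divide)
    have "nrm (h j - h k) < e" if "j \<ge> k0" "k \<ge> k0" for j k
    proof -
      define s where "s = h j + h k"
      \<comment> \<open>The midpoint of \<open>h j\<close> and \<open>h k\<close>. Since
        \<open>J u\<close> is at least the infimum \<open>m\<close>, the parallelogram law bounds
        the distance between two near-minimisers.\<close>
      define u where "u = nc_const (of_real (1 / 2)) * s"
      have "(nrm u)\<^sup>2 = (nrm s)\<^sup>2 / 4"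
        by (simp add: u_def nrm_scale power_mult_distrib power_divide norm_divide)
      moreover have "Re (\<phi> u) = (Re (\<phi> (h j)) + Re (\<phi> (h k))) / 2"
        by (simp add: u_def s_def \<phi>_scale \<phi>_add)
      ultimately have "4 * J u = (nrm s)\<^sup>2 - 4 * Re (\<phi> (h j)) - 4 * Re (\<phi> (h k))"
        by (simp add: J_def)
      then have "(nrm (h j - h k))\<^sup>2 = 2 * J (h j) + 2 * J (h k) - 4 * J u"
        using nrm_parallelogram[of "h j" "h k"] by (simp add: J_def s_def)
      also have "\<dots> < 2 / real (Suc j) + 2 / real (Suc k)"
        using h[of j] h[of k] m_le[of u] by simp
      also have "\<dots> \<le> 2 / real (Suc k0) + 2 / real (Suc k0)"
        using that by (intro add_mono divide_left_mono) auto
      also have "\<dots> < e\<^sup>2" using k0 by simp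
      finally show ?thesis using \<open>e > 0\<close> by (simp add: power_less_imp_less_base)
    qed
    then show "\<exists>k\<^sub>0. \<forall>j\<ge>k\<^sub>0. \<forall>k\<ge>k\<^sub>0. nrm (h j - h k) < e" by blast
  next
    fix a
    have sq: "(cmod (\<tau> (nc_star a * h k) - \<phi> a))\<^sup>2 \<le> (1 + (nrm a)\<^sup>2) * (1 / real (Suc k))" for k
    proof -
      define g where "g = \<tau> (nc_star a * h k) - \<phi> a"
      \<comment> \<open>The optimal step would be the inverse of \<open>(nrm a)\<^sup>2\<close>;
        adding 1 covers seminorm 0 and keeps \<open>s * (nrm a)\<^sup>2 \<le> 1\<close>, which is
        all that is used.\<close>
      define s where "s = 1 / (1 + (nrm a)\<^sup>2)"
      have s: "s > 0" "s * (nrm a)\<^sup>2 \<le> 1"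
        using zero_le_power2[of "nrm a"] by (simp_all add: s_def add_pos_nonneg)
      define z where "z = - of_real s * g"
      have "J (h k + nc_const z * a) = J (h k) + 2 * Re (cnj z * g) + (cmod z)\<^sup>2 * (nrm a)\<^sup>2"
        unfolding J_def nrm_add_scale_sq \<phi>_add \<phi>_scale g_def
        by (simp add: right_diff_distrib)
      moreover have "Re (cnj z * g) = - s * (cmod g)\<^sup>2"
      proof -
        have "cnj z * g = of_real (- s * (cmod g)\<^sup>2)"
          unfolding of_real_mult complex_norm_square z_def by simp
        then show ?thesis by (metis Re_complex_of_real)
      qed
      moreover have "(cmod z)\<^sup>2 * (nrm a)\<^sup>2 \<le> s * (cmod g)\<^sup>2"
      proof -
        have "(cmod z)\<^sup>2 * (nrm a)\<^sup>2 = s * (cmod g)\<^sup>2 * (s * (nrm a)\<^sup>2)"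
          by (simp add: z_def norm_mult power_mult_distrib power2_eq_square)
        also have "\<dots> \<le> s * (cmod g)\<^sup>2 * 1"
          using s by (intro mult_left_mono) auto
        finally show ?thesis by simp
      qed
      ultimately have "s * (cmod g)\<^sup>2 \<le> 1 / real (Suc k)"
        using m_le[of "h k + nc_const z * a"] h[of k] by simp
      then show ?thesis
        using zero_le_power2[of "nrm a"] by (simp add: s_def g_def[symmetric] field_simps)
    qed
    have "(\<lambda>k. (1 + (nrm a)\<^sup>2) * (1 / real (Suc k))) \<longlonglongrightarrow> 0"
      by (intro tendsto_mult_right_zero lim_1_over_n[THEN LIMSEQ_Suc])
    then have "(\<lambda>k. (cmod (\<tau> (nc_star a * h k) - \<phi> a))\<^sup>2) \<longlonglongrightarrow> 0"
      by (rule tendsto_sandwich[rotated 3]) (use sq in auto)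
    then have "(\<lambda>k. cmod (\<tau> (nc_star a * h k) - \<phi> a)) \<longlonglongrightarrow> 0"
      using tendsto_real_sqrt by fastforce
    then show "(\<lambda>k. \<tau> (nc_star a * h k)) \<longlonglongrightarrow> \<phi> a"
      using Lim_null tendsto_norm_zero_iff by blast
  qed
  then show ?thesis using gns_space_iff by blast
qed

end

lemma gns_commutantD:
  "T \<in> gns_commutant \<tau> S \<Longrightarrow> T \<in> gns_bounded_ops \<tau>"
  "T \<in> gns_commutant \<tau> S \<Longrightarrow> s \<in> S \<Longrightarrow> \<xi> \<in> gns_space \<tau> \<Longrightarrow> T (s \<xi>) = s (T \<xi>)"
  by (auto simp: gns_commutant_def)

subsection \<open>Factor states are extreme\<close>

text \<open>The order relation \<open>t \<sigma> \<le> \<tau>\<close> between positive functionals,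
  tested on squares. Each component of a convex decomposition of \<open>\<tau>\<close> satisfies it
  with its weight as \<open>t\<close>.\<close>

locale dominated_state = trace_state R \<tau>
  for R :: real and \<tau> :: "'n ncpoly \<Rightarrow> complex" +
  fixes \<sigma> :: "'n ncpoly \<Rightarrow> complex" and t :: real
  assumes \<sigma>_state: "\<sigma> \<in> trace_states R" and t_pos: "t > 0"
    and dominated: "t * Re (\<sigma> (nc_star p * p)) \<le> Re (\<tau> (nc_star p * p))"
begin

sublocale \<sigma>: trace_state R \<sigma>
  by unfold_locales (rule \<sigma>_state, rule R_pos)

definition form :: "'n ncpoly \<Rightarrow> 'n ncpoly \<Rightarrow> complex" where
  "form a b = of_real t * \<sigma> (nc_star a * b)"

lemma form_bound: "cmod (form a b) \<le> nrm a * nrm b"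
proof -
  have le: "sqrt t * \<sigma>.nrm p \<le> nrm p" for p
    using real_sqrt_le_mono[OF dominated[of p]] by (simp add: gns_seminorm_def real_sqrt_mult)
  have "cmod (form a b) \<le> t * (\<sigma>.nrm a * \<sigma>.nrm b)"
    using \<sigma>.Cauchy_Schwarz[of a b] t_pos by (simp add: form_def norm_mult)
  also have "\<dots> = (sqrt t * \<sigma>.nrm a) * (sqrt t * \<sigma>.nrm b)"
    using t_pos by simp
  also have "\<dots> \<le> nrm a * nrm b"
    using t_pos by (intro mult_mono le) auto
  finally show ?thesis .
qed

lemma form_diff_right: "form a (b - c) = form a b - form a c"
  by (simp add: form_def right_diff_distrib \<sigma>.diff)

text \<open>The Radon--Nikodym derivative of \<open>t \<sigma>\<close> with respect to
  \<open>\<tau>\<close>, as an operator. An arbitrary representing sequence is chosen;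
  \<open>density_op_tendsto\<close> shows that every other one gives the same value.\<close>

definition density_op :: "('n ncpoly \<Rightarrow> complex) \<Rightarrow> ('n ncpoly \<Rightarrow> complex)" where
  "density_op \<xi> = (\<lambda>a. lim (\<lambda>k. form a ((SOME b. gns_limit b \<xi>) k)))"

lemma form_convergent:
  assumes "gns_limit b \<xi>"
  shows "convergent (\<lambda>k. form a (b k))"
proof (rule Cauchy_convergent, rule CauchyI)
  fix e :: real assume "e > 0"
  then have "e / (nrm a + 1) > 0" using nrm_nonneg[of a] by (simp add: add_nonneg_pos)
  then obtain k0 where k0: "\<And>j k. j \<ge> k0 \<Longrightarrow> k \<ge> k0 \<Longrightarrow> nrm (b j - b k) < e / (nrm a + 1)"
    using gns_limit_Cauchy[OF assms] by blast
  have "cmod (form a (b j) - form a (b k)) < e" if "j \<ge> k0" "k \<ge> k0" for j k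
  proof -
    have "cmod (form a (b j) - form a (b k)) \<le> nrm a * nrm (b j - b k)"
      using form_bound[of a "b j - b k"] by (simp add: form_diff_right)
    also have "\<dots> \<le> (nrm a + 1) * nrm (b j - b k)"
      by (rule mult_right_mono) auto
    also have "\<dots> < (nrm a + 1) * (e / (nrm a + 1))"
      by (rule mult_strict_left_mono[OF k0[OF that]]) (simp add: add_nonneg_pos)
    finally show ?thesis using nrm_nonneg[of a] by (simp add: add_nonneg_eq_0_iff)
  qed
  then show "\<exists>k0. \<forall>m\<ge>k0. \<forall>n\<ge>k0. cmod (form a (b m) - form a (b n)) < e" by blast
qed

text \<open>The difference of two sequences representing \<open>\<xi>\<close> represents the zero
  vector, so its seminorms tend to 0 by \<open>gns_limit_nrm_le\<close>, and \<open>form\<close> is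
  bounded by seminorms.\<close>

lemma density_op_tendsto:
  assumes "gns_limit b \<xi>"
  shows "(\<lambda>k. form a (b k)) \<longlonglongrightarrow> density_op \<xi> a"
proof -
  define c where "c = (SOME b. gns_limit b \<xi>)"
  have c: "gns_limit c \<xi>" unfolding c_def by (rule someI[of "\<lambda>b. gns_limit b \<xi>", OF assms])
  have lim: "(\<lambda>k. form a (c k)) \<longlonglongrightarrow> density_op \<xi> a"
    using form_convergent[OF c, of a] unfolding density_op_def c_def convergent_LIMSEQ_iff .
  have d: "gns_limit (\<lambda>k. b k - c k) (\<lambda>_. 0)"
    using gns_limit_diff[OF assms c] by simp
  have "(\<lambda>k. form a (b k) - form a (c k)) \<longlonglongrightarrow> 0"
  proof (rule LIMSEQ_I)
    fix e :: real assume e: "e > 0"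
    then have e': "e / (2 * (nrm a + 1)) > 0" using nrm_nonneg[of a] by (simp add: add_nonneg_pos)
    have "gns_norm \<tau> (\<lambda>_. 0) \<le> 0" by (rule gns_norm_le) auto
    then obtain k0 where k0: "\<And>k. k \<ge> k0 \<Longrightarrow> nrm (b k - c k) \<le> e / (2 * (nrm a + 1))"
      using gns_limit_nrm_le[OF d e'] by fastforce
    have "cmod (form a (b k) - form a (c k) - 0) < e" if "k \<ge> k0" for k
    proof -
      have "cmod (form a (b k) - form a (c k)) \<le> nrm a * nrm (b k - c k)"
        using form_bound[of a "b k - c k"] by (simp add: form_diff_right)
      also have "\<dots> \<le> (nrm a + 1) * (e / (2 * (nrm a + 1)))"
        by (intro mult_mono k0 that) auto
      also have "\<dots> = e / 2"
        using nrm_nonneg[of a] add_pos_nonneg[of 1 "nrm a"] by (simp add: field_simps)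
      finally show ?thesis using e by simp
    qed
    then show "\<exists>k0. \<forall>k\<ge>k0. cmod (form a (b k) - form a (c k) - 0) < e" by blast
  qed
  from tendsto_add[OF this lim] show ?thesis by simp
qed

text \<open>Domination makes the operator a contraction. The slack \<open>e\<close> left by
  \<open>gns_limit_nrm_le\<close> is arbitrary and disappears at the end.\<close>

lemma density_op_bound:
  assumes "\<xi> \<in> gns_space \<tau>"
  shows "cmod (density_op \<xi> a) \<le> gns_norm \<tau> \<xi> * nrm a"
proof -
  obtain b where b: "gns_limit b \<xi>" using assms gns_space_iff by blast
  have "cmod (density_op \<xi> a) \<le> (gns_norm \<tau> \<xi> + e) * nrm a" if e: "e > 0" for e
  proof -
    obtain k0 where k0: "\<And>k. k \<ge> k0 \<Longrightarrow> nrm (b k) \<le> gns_norm \<tau> \<xi> + e"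
      using gns_limit_nrm_le[OF b e] by blast
    have "cmod (form a (b k)) \<le> (gns_norm \<tau> \<xi> + e) * nrm a" if "k \<ge> k0" for k
      using form_bound[of a "b k"] mult_left_mono[OF k0[OF that], of "nrm a"]
      by (simp add: mult.commute)
    then show ?thesis
      by (intro tendsto_upperbound[OF tendsto_norm[OF density_op_tendsto[OF b]]])
        (auto simp: eventually_sequentially)
  qed
  then have "cmod (density_op \<xi> a) - gns_norm \<tau> \<xi> * nrm a \<le> e * nrm a" if "e > 0" for e
    using that by (fastforce simp: distrib_right)
  then have le: "cmod (density_op \<xi> a) - gns_norm \<tau> \<xi> * nrm a \<le> e" if "e > 0" for e
  proof (cases "nrm a = 0")
    case False
    then have "nrm a > 0" using nrm_nonneg[of a] by linarith
    then show ?thesis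
      using \<open>\<And>e. e > 0 \<Longrightarrow> _ \<le> e * nrm a\<close>[of "e / nrm a"] that by simp
  next
    case True
    then show ?thesis using \<open>\<And>e. e > 0 \<Longrightarrow> _ \<le> e * nrm a\<close>[of 1] that by simp
  qed
  show ?thesis
    using field_le_epsilon[of "cmod (density_op \<xi> a)" "gns_norm \<tau> \<xi> * nrm a"] le by (simp add: diff_le_eq add.commute)
qed

lemma density_op_add:
  assumes "\<xi> \<in> gns_space \<tau>" "\<eta> \<in> gns_space \<tau>"
  shows "density_op (\<lambda>a. \<xi> a + \<eta> a) = (\<lambda>a. density_op \<xi> a + density_op \<eta> a)"
proof
  fix a
  obtain b c where b: "gns_limit b \<xi>" and c: "gns_limit c \<eta>"
    using assms gns_space_iff by blast
  have "(\<lambda>k. form a (b k + c k)) \<longlonglongrightarrow> density_op \<xi> a + density_op \<eta> a"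
    using tendsto_add[OF density_op_tendsto[OF b] density_op_tendsto[OF c]]
    by (simp add: form_def distrib_left \<sigma>.add)
  then show "density_op (\<lambda>a. \<xi> a + \<eta> a) a = density_op \<xi> a + density_op \<eta> a"
    by (rule LIMSEQ_unique[OF density_op_tendsto[OF gns_limit_add[OF b c]]])
qed

text \<open>Inside \<open>form\<close>, a left factor \<open>x\<close> of the second argument moves
  to the first as \<open>nc_star x\<close>. With \<open>x\<close> a constant this also yields the
  homogeneity of \<open>density_op\<close>.\<close>

lemma density_op_gns_rep:
  assumes "\<xi> \<in> gns_space \<tau>"
  shows "density_op (gns_rep x \<xi>) = gns_rep x (density_op \<xi>)"
proof
  fix a
  obtain b where b: "gns_limit b \<xi>" using assms gns_space_iff by blast
  have "(\<lambda>k. form a (x * b k)) \<longlonglongrightarrow> density_op \<xi> (nc_star x * a)"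
    using density_op_tendsto[OF b, of "nc_star x * a"] by (simp add: form_def nc_star_mult mult.assoc)
  then show "density_op (gns_rep x \<xi>) a = gns_rep x (density_op \<xi>) a"
    unfolding gns_rep_def[of x "density_op \<xi>"]
    by (rule LIMSEQ_unique[OF density_op_tendsto[OF gns_limit_left_mult[OF b]]])
qed

lemma gns_rep_const: "\<xi> \<in> gns_space \<tau> \<Longrightarrow> gns_rep (nc_const c) \<xi> = (\<lambda>a. c * \<xi> a)"
  by (simp add: gns_rep_def nc_star_single gns_functional_scale)

lemma density_op_in_space:
  assumes "\<xi> \<in> gns_space \<tau>"
  shows "density_op \<xi> \<in> gns_space \<tau>"
proof (rule gns_space_Riesz)
  obtain b where b: "gns_limit b \<xi>" using assms gns_space_iff by blast
  show "density_op \<xi> (a + c) = density_op \<xi> a + density_op \<xi> c" for a c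
  proof (rule LIMSEQ_unique[OF density_op_tendsto[OF b]])
    show "(\<lambda>k. form (a + c) (b k)) \<longlonglongrightarrow> density_op \<xi> a + density_op \<xi> c"
      using tendsto_add[OF density_op_tendsto[OF b, of a] density_op_tendsto[OF b, of c]]
      by (simp add: form_def nc_star_add distrib_right distrib_left \<sigma>.add)
  qed
  show "density_op \<xi> (nc_const c * a) = cnj c * density_op \<xi> a" for c a
  proof (rule LIMSEQ_unique[OF density_op_tendsto[OF b]])
    show "(\<lambda>k. form (nc_const c * a) (b k)) \<longlonglongrightarrow> cnj c * density_op \<xi> a"
      using tendsto_mult_left[OF density_op_tendsto[OF b, of a], of "cnj c"]
      by (simp add: form_def star_const \<sigma>.scale_left mult.left_commute)
  qed
  show "cmod (density_op \<xi> a) \<le> gns_norm \<tau> \<xi> * nrm a" for a by (rule density_op_bound[OF assms])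
qed

lemma density_op_bounded_op: "density_op \<in> gns_bounded_ops \<tau>"
proof -
  have "gns_norm \<tau> (density_op \<xi>) \<le> 1 * gns_norm \<tau> \<xi>" if "\<xi> \<in> gns_space \<tau>" for \<xi>
    using gns_norm_le[OF density_op_bound[OF that] gns_norm_nonneg[OF that]] by simp
  moreover have "density_op (\<lambda>a. c * \<xi> a) = (\<lambda>a. c * density_op \<xi> a)" if "\<xi> \<in> gns_space \<tau>" for c \<xi>
    using density_op_gns_rep[OF that, of "nc_const c"] that density_op_in_space[OF that]
    by (simp add: gns_rep_const)
  ultimately show ?thesis
    unfolding gns_bounded_ops_def using density_op_in_space density_op_add by blast
qed

text \<open>The cyclic vector, that is, the class of 1; correspondingly \<open>gns_rep x vac\<close>
  is the class of \<open>x\<close>.\<close>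

abbreviation vac :: "'n ncpoly \<Rightarrow> complex" where
  "vac \<equiv> (\<lambda>a. \<tau> (nc_star a))"

lemma vac_limit: "gns_limit (\<lambda>_. 1) vac"
  using gns_limit_const[of 1] by simp

lemma gns_rep_vac_limit: "gns_limit (\<lambda>_. x) (gns_rep x vac)"
  using gns_limit_left_mult[OF vac_limit, of x] by simp

lemma density_op_vac: "density_op vac a = of_real t * \<sigma> (nc_star a)"
  using LIMSEQ_unique[OF density_op_tendsto[OF vac_limit, of a]] by (simp add: form_def)

text \<open>The classes of polynomials are dense, so a bounded operator is determined by its values
  on the vectors \<open>gns_rep x vac\<close>. This reduces operator identities to the cyclic
  vector.\<close>

lemma bounded_op_tendsto:
  assumes U: "U \<in> gns_bounded_ops \<tau>" and b: "gns_limit b \<xi>"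
  shows "(\<lambda>k. U (gns_rep (b k) vac) a) \<longlonglongrightarrow> U \<xi> a"
proof -
  obtain C where C: "\<And>\<xi>. \<xi> \<in> gns_space \<tau> \<Longrightarrow> gns_norm \<tau> (U \<xi>) \<le> C * gns_norm \<tau> \<xi>"
    and sp: "\<And>\<xi>. \<xi> \<in> gns_space \<tau> \<Longrightarrow> U \<xi> \<in> gns_space \<tau>"
    and Uadd: "\<And>\<xi> \<eta>. \<xi> \<in> gns_space \<tau> \<Longrightarrow> \<eta> \<in> gns_space \<tau> \<Longrightarrow> U (\<lambda>a. \<xi> a + \<eta> a) = (\<lambda>a. U \<xi> a + U \<eta> a)"
    using U unfolding gns_bounded_ops_def by blast
  have \<xi>: "\<xi> \<in> gns_space \<tau>" using b gns_space_iff by blast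
  \<comment> \<open>The constant \<open>C\<close> may be negative, hence the absolute value;
    \<open>D\<close> may be 0, hence the denominators \<open>D + 1\<close> below.\<close>
  define D where "D = \<bar>C\<bar> * nrm a"
  have D: "D \<ge> 0" by (simp add: D_def)
  have "(\<lambda>k. U (gns_rep (b k) vac) a - U \<xi> a) \<longlonglongrightarrow> 0"
  proof (rule LIMSEQ_I)
    fix e :: real assume e: "e > 0"
    then have e': "e / (D + 1) > 0" using D by simp
    obtain k0 where k0: "\<And>j k. j \<ge> k0 \<Longrightarrow> k \<ge> k0 \<Longrightarrow> nrm (b j - b k) < e / (D + 1)"
      using gns_limit_Cauchy[OF b e'] by blast
    have "cmod (U (gns_rep (b k) vac) a - U \<xi> a - 0) < e" if k: "k \<ge> k0" for k
    proof -
      define \<delta> where "\<delta> = (\<lambda>a. gns_rep (b k) vac a - \<xi> a)"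
      have lim: "gns_limit (\<lambda>j. b k - b j) \<delta>"
        unfolding \<delta>_def by (rule gns_limit_diff[OF gns_rep_vac_limit b])
      then have \<delta>: "\<delta> \<in> gns_space \<tau>" using gns_space_iff by blast
      have nd: "gns_norm \<tau> \<delta> \<le> e / (D + 1)"
      proof (rule gns_norm_le)
        show "cmod (\<delta> a) \<le> e / (D + 1) * nrm a" for a
          by (rule gns_limit_functional_le[OF lim, of k0]) (use k0[OF k] in \<open>simp add: less_imp_le\<close>)
      qed (use e' in simp)
      have "U (gns_rep (b k) vac) = U (\<lambda>a. \<xi> a + \<delta> a)" by (simp add: \<delta>_def)
      then have "U (gns_rep (b k) vac) a - U \<xi> a = U \<delta> a"
        using Uadd[OF \<xi> \<delta>] by simp
      moreover have "cmod (U \<delta> a) \<le> gns_norm \<tau> (U \<delta>) * nrm a"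
        by (rule gns_norm_bound[OF sp[OF \<delta>]])
      moreover have "gns_norm \<tau> (U \<delta>) * nrm a \<le> (\<bar>C\<bar> * gns_norm \<tau> \<delta>) * nrm a"
      proof (rule mult_right_mono)
        have "C * gns_norm \<tau> \<delta> \<le> \<bar>C\<bar> * gns_norm \<tau> \<delta>"
          by (rule mult_right_mono) (use gns_norm_nonneg[OF \<delta>] in auto)
        then show "gns_norm \<tau> (U \<delta>) \<le> \<bar>C\<bar> * gns_norm \<tau> \<delta>" using C[OF \<delta>] by linarith
      qed simp
      moreover have "(\<bar>C\<bar> * gns_norm \<tau> \<delta>) * nrm a = D * gns_norm \<tau> \<delta>" by (simp add: D_def)
      moreover have "D * gns_norm \<tau> \<delta> \<le> D * (e / (D + 1))"
        by (rule mult_left_mono[OF nd D])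
      moreover have "D * (e / (D + 1)) < e" using D e by (simp add: field_simps)
      ultimately show ?thesis by simp
    qed
    then show "\<exists>k0. \<forall>k\<ge>k0. cmod (U (gns_rep (b k) vac) a - U \<xi> a - 0) < e" by blast
  qed
  then show ?thesis using Lim_null by blast
qed

text \<open>Both sides are iterated limits of \<open>\<tau> (a\<^sup>* h\<^sub>j s\<^sub>k)\<close>, where \<open>h\<^sub>j\<close> tends to \<open>density_op vac\<close> and
  \<open>s\<^sub>k\<close> to \<open>U vac\<close>; the trace property makes the limit in \<open>j\<close> uniform in \<open>k\<close>.\<close>

lemma density_op_commute_vac:
  assumes U: "U \<in> gns_commutant \<tau> (range gns_rep)"
  shows "density_op (U vac) = U (density_op vac)"
proof
  fix a
  have Ub: "U \<in> gns_bounded_ops \<tau>" by (rule gns_commutantD(1)[OF U])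
  have vac: "vac \<in> gns_space \<tau>" using vac_limit gns_space_iff by blast
  have Uvac: "U vac \<in> gns_space \<tau>" using Ub vac unfolding gns_bounded_ops_def by blast
  obtain s where s: "gns_limit s (U vac)" using Uvac gns_space_iff by blast
  obtain h where h: "gns_limit h (density_op vac)" using density_op_in_space[OF vac] gns_space_iff by blast
  define E where "E k = form a (s k)" for k
  define F where "F j = U vac (nc_star (h j) * a)" for j
  define D where "D j k = \<tau> (nc_star a * (h j * s k))" for j k
  have E: "E \<longlonglongrightarrow> density_op (U vac) a" unfolding E_def by (rule density_op_tendsto[OF s])
  \<comment> \<open>Both traces are used: that of \<open>\<tau>\<close> moves \<open>s k\<close> to
    the other side, so that the limit in \<open>j\<close> is the functional
    \<open>density_op vac\<close> at a fixed polynomial, and that of \<open>\<sigma>\<close> moves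
    it back and identifies the value.\<close>
  have DE: "(\<lambda>j. D j k) \<longlonglongrightarrow> E k" for k
  proof -
    have "(\<lambda>j. \<tau> (nc_star (a * nc_star (s k)) * h j)) \<longlonglongrightarrow> density_op vac (a * nc_star (s k))"
      by (rule gns_limit_tendsto[OF h])
    moreover have "\<tau> (nc_star (a * nc_star (s k)) * h j) = D j k" for j
      using trace[of "s k" "nc_star a * h j"] by (simp add: D_def nc_star_mult mult.assoc)
    moreover have "density_op vac (a * nc_star (s k)) = E k"
      using \<sigma>.trace[of "s k" "nc_star a"] by (simp add: density_op_vac E_def form_def nc_star_mult)
    ultimately show ?thesis by simp
  qed
  have DF: "(\<lambda>k. D j k) \<longlonglongrightarrow> F j" for j
    using gns_limit_tendsto[OF s, of "nc_star (h j) * a"]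
    by (simp add: D_def F_def nc_star_mult mult.assoc)
  have F: "F \<longlonglongrightarrow> U (density_op vac) a"
  proof -
    have "U (gns_rep (h j) vac) a = F j" for j
      using gns_commutantD(2)[OF U _ vac, of "gns_rep (h j)"] by (simp add: F_def gns_rep_def)
    then show ?thesis using bounded_op_tendsto[OF Ub h, of a] by simp
  qed
  obtain B where B: "B > 0" "\<And>k. nrm (s k) \<le> B" using gns_limit_bounded[OF s] by blast
  obtain C where C: "C \<ge> 0" "\<And>x. nrm (x * nc_star a) \<le> C * nrm x"
    using right_mult_bounded[of "nc_star a"] by blast
  have D_diff: "cmod (D j k - D j' k) \<le> C * B * nrm (h j - h j')" for j j' k
  proof -
    have "D j k - D j' k = \<tau> (nc_star a * ((h j - h j') * s k))"
      by (simp add: D_def left_diff_distrib right_diff_distrib diff)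
    also have "\<dots> = \<tau> ((h j - h j') * (s k * nc_star a))"
      using trace[of "nc_star a" "(h j - h j') * s k"] by (simp add: mult.assoc)
    also have "cmod \<dots> \<le> nrm (h j - h j') * nrm (s k * nc_star a)"
      using Cauchy_Schwarz[of "nc_star (h j - h j')" "s k * nc_star a"] by simp
    also have "\<dots> \<le> nrm (h j - h j') * (C * B)"
      using C(2)[of "s k"] mult_left_mono[OF B(2)[of k] C(1)] by (intro mult_left_mono) auto
    finally show ?thesis by (simp add: mult.commute)
  qed
  have CB: "C * B \<ge> 0" using B(1) C(1) by simp
  have "(\<lambda>j. F j - density_op (U vac) a) \<longlonglongrightarrow> 0"
  proof (rule LIMSEQ_I)
    fix e :: real assume e: "e > 0"
    then have "e / (C * B + 1) > 0" using CB by simp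
    then obtain j0 where j0: "\<And>j k. j \<ge> j0 \<Longrightarrow> k \<ge> j0 \<Longrightarrow> nrm (h j - h k) < e / (C * B + 1)"
      using gns_limit_Cauchy[OF h] by blast
    have "cmod (F j - density_op (U vac) a - 0) < e" if j: "j \<ge> j0" for j
    proof -
      have "cmod (D j k - D j' k) \<le> C * B * (e / (C * B + 1))" if "j' \<ge> j0" for j' k
        using D_diff[of j k j'] mult_left_mono[OF less_imp_le[OF j0[OF j that]] CB] by linarith
      then have DE_le: "cmod (D j k - E k) \<le> C * B * (e / (C * B + 1))" for k
        by (intro tendsto_upperbound[OF tendsto_norm[OF tendsto_diff[OF tendsto_const DE]]])
          (auto simp: eventually_sequentially)
      have "cmod (F j - density_op (U vac) a) \<le> C * B * (e / (C * B + 1))"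
        by (rule tendsto_upperbound[OF tendsto_norm[OF tendsto_diff[OF DF E]]])
          (use DE_le in auto)
      also have "\<dots> < e" using CB e by (simp add: field_simps)
      finally show ?thesis by simp
    qed
    then show "\<exists>j0. \<forall>j\<ge>j0. cmod (F j - density_op (U vac) a - 0) < e" by blast
  qed
  then have "F \<longlonglongrightarrow> density_op (U vac) a" using Lim_null by blast
  then show "density_op (U vac) a = U (density_op vac) a" using F LIMSEQ_unique by blast
qed

lemma density_op_commutant: "density_op \<in> gns_commutant \<tau> (range gns_rep)"
  unfolding gns_commutant_def using density_op_bounded_op density_op_gns_rep by blast

text \<open>\<open>U\<close> and \<open>density_op\<close> both commute with left multiplications,
  so commutation at \<open>vac\<close> carries over to every \<open>gns_rep x vac\<close>. Both
  compositions are bounded operators, and density gives all vectors.\<close>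

lemma density_op_vonneumann: "density_op \<in> gns_vonneumann_algebra \<tau>"
proof -
  have "density_op (U \<xi>) = U (density_op \<xi>)"
    if U: "U \<in> gns_commutant \<tau> (range gns_rep)" and \<xi>: "\<xi> \<in> gns_space \<tau>" for U \<xi>
  proof
    fix a
    have Ub: "U \<in> gns_bounded_ops \<tau>" by (rule gns_commutantD(1)[OF U])
    have USp: "\<And>\<xi>. \<xi> \<in> gns_space \<tau> \<Longrightarrow> U \<xi> \<in> gns_space \<tau>"
      using Ub unfolding gns_bounded_ops_def by blast
    have vac: "vac \<in> gns_space \<tau>" using vac_limit gns_space_iff by blast
    obtain b where b: "gns_limit b \<xi>" using \<xi> gns_space_iff by blast
    have comp: "(\<lambda>\<xi>. V (W \<xi>)) \<in> gns_bounded_ops \<tau>"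
      if V: "V \<in> gns_bounded_ops \<tau>" and W: "W \<in> gns_bounded_ops \<tau>" for V W
    proof -
      obtain CV where CV: "\<And>\<xi>. \<xi> \<in> gns_space \<tau> \<Longrightarrow> gns_norm \<tau> (V \<xi>) \<le> CV * gns_norm \<tau> \<xi>"
        using V unfolding gns_bounded_ops_def by blast
      obtain CW where CW: "\<And>\<xi>. \<xi> \<in> gns_space \<tau> \<Longrightarrow> gns_norm \<tau> (W \<xi>) \<le> CW * gns_norm \<tau> \<xi>"
        using W unfolding gns_bounded_ops_def by blast
      have Wsp: "\<And>\<xi>. \<xi> \<in> gns_space \<tau> \<Longrightarrow> W \<xi> \<in> gns_space \<tau>"
        using W unfolding gns_bounded_ops_def by blast
      have "gns_norm \<tau> (V (W \<xi>)) \<le> (\<bar>CV\<bar> * \<bar>CW\<bar>) * gns_norm \<tau> \<xi>" if \<xi>: "\<xi> \<in> gns_space \<tau>" for \<xi>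
      proof -
        have "gns_norm \<tau> (V (W \<xi>)) \<le> \<bar>CV\<bar> * gns_norm \<tau> (W \<xi>)"
          using CV[OF Wsp[OF \<xi>]] mult_right_mono[OF abs_ge_self[of CV] gns_norm_nonneg[OF Wsp[OF \<xi>]]]
          by linarith
        also have "\<dots> \<le> \<bar>CV\<bar> * (\<bar>CW\<bar> * gns_norm \<tau> \<xi>)"
          using CW[OF \<xi>] mult_right_mono[OF abs_ge_self[of CW] gns_norm_nonneg[OF \<xi>]]
          by (intro mult_left_mono) linarith+
        finally show ?thesis by (simp add: mult.assoc)
      qed
      then show ?thesis using V W unfolding gns_bounded_ops_def by auto
    qed
    have "density_op (U (gns_rep x vac)) = U (density_op (gns_rep x vac))" for x
    proof -
      have "density_op (U (gns_rep x vac)) = gns_rep x (density_op (U vac))"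
        using gns_commutantD(2)[OF U _ vac, of "gns_rep x"] density_op_gns_rep[OF USp[OF vac]] by simp
      also have "\<dots> = U (density_op (gns_rep x vac))"
        using gns_commutantD(2)[OF U _ density_op_in_space[OF vac], of "gns_rep x"]
          density_op_gns_rep[OF vac] density_op_commute_vac[OF U] by simp
      finally show ?thesis .
    qed
    then show "density_op (U \<xi>) a = U (density_op \<xi>) a"
      using bounded_op_tendsto[OF comp[OF density_op_bounded_op Ub] b, of a]
        bounded_op_tendsto[OF comp[OF Ub density_op_bounded_op] b, of a] LIMSEQ_unique by auto
  qed
  then show ?thesis
    unfolding gns_vonneumann_algebra_def gns_commutant_def[of _ "gns_commutant _ _"]
    using density_op_bounded_op by blast
qed

text \<open>\<open>density_op\<close> lies in the commutant of the left multiplications, hence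
  commutes with their bicommutant, and it lies in that bicommutant too. So it is central, therefore
  scalar; normalisation at 1 fixes the scalar.\<close>

lemma factor_state_dominated:
  assumes "factor_state \<tau>"
  shows "\<sigma> = \<tau>"
proof -
  have "density_op \<in> gns_commutant \<tau> (gns_vonneumann_algebra \<tau>)"
    unfolding gns_commutant_def[of _ "gns_vonneumann_algebra \<tau>"]
    using density_op_bounded_op gns_commutantD(2)[OF _ density_op_commutant]
    unfolding gns_vonneumann_algebra_def by fastforce
  with density_op_vonneumann assms obtain c where c: "\<And>\<xi>. \<xi> \<in> gns_space \<tau> \<Longrightarrow> density_op \<xi> = (\<lambda>a. c * \<xi> a)"
    unfolding factor_state_def by blast
  have "vac \<in> gns_space \<tau>" using vac_limit gns_space_iff by blast
  then have "of_real t * \<sigma> (nc_star a) = c * \<tau> (nc_star a)" for a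
    using c density_op_vac[of a] by metis
  from this[of "nc_star _"] have "of_real t * \<sigma> a = c * \<tau> a" for a by simp
  then have "\<sigma> a = (c / of_real t) * \<tau> a" for a
    using t_pos by (simp add: field_simps)
  then show ?thesis by (rule eq_scaleD) (rule \<sigma>.one)
qed

end

lemma factor_state_imp_extreme:
  assumes "R > 0" "\<tau> \<in> trace_states R" "factor_state \<tau>"
  shows "extreme_trace_state R \<tau>"
  unfolding extreme_trace_state_def
proof (intro conjI ballI allI impI)
  fix \<sigma>1 \<sigma>2 and t :: real
  assume \<sigma>: "\<sigma>1 \<in> trace_states R" "\<sigma>2 \<in> trace_states R" and t: "0 < t \<and> t < 1"
    and \<tau>: "\<tau> = (\<lambda>p. of_real t * \<sigma>1 p + of_real (1 - t) * \<sigma>2 p)"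
  interpret s1: trace_state R \<sigma>1 by unfold_locales (use assms \<sigma> in auto)
  interpret s2: trace_state R \<sigma>2 by unfold_locales (use assms \<sigma> in auto)
  have Re_\<tau>: "Re (\<tau> (nc_star p * p)) = t * Re (\<sigma>1 (nc_star p * p)) + (1 - t) * Re (\<sigma>2 (nc_star p * p))"
    for p by (simp add: \<tau>)
  have nn: "Re (\<sigma>1 (nc_star p * p)) \<ge> 0" "Re (\<sigma>2 (nc_star p * p)) \<ge> 0" for p
    using s1.pos[of p] s2.pos[of p] by (simp_all add: less_eq_complex_def)
  have "dominated_state R \<tau> \<sigma>1 t"
    by unfold_locales (use assms \<sigma> t nn(2) in \<open>auto simp: Re_\<tau>\<close>)
  moreover have "dominated_state R \<tau> \<sigma>2 (1 - t)"
    by unfold_locales (use assms \<sigma> t nn(1) in \<open>auto simp: Re_\<tau>\<close>)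
  ultimately show "\<sigma>1 = \<sigma>2"
    using dominated_state.factor_state_dominated assms(3) by metis
qed (rule assms)

subsection \<open>Matrices\<close>

lemma mat_adjoint_index:
  assumes "A \<in> carrier_mat N N" "i < N" "j < N"
  shows "mat_adjoint A $$ (i, j) = cnj (A $$ (j, i))"
  using assms by (simp add: mat_adjoint_def mat_of_rows_index)

lemma hermD:
  assumes "A \<in> herm N"
  shows "A \<in> carrier_mat N N" "i < N \<Longrightarrow> j < N \<Longrightarrow> cnj (A $$ (i, j)) = A $$ (j, i)"
proof -
  have A: "A \<in> carrier_mat N N" "mat_adjoint A = A" using assms by (auto simp: herm_def)
  show "A \<in> carrier_mat N N" by (rule A)
  show "cnj (A $$ (i, j)) = A $$ (j, i)" if "i < N" "j < N"
    using mat_adjoint_index[OF A(1) that(2,1)] A(2) by simp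
qed

lemma hermI:
  assumes "A \<in> carrier_mat N N" "\<And>i j. i < N \<Longrightarrow> j < N \<Longrightarrow> A $$ (j, i) = cnj (A $$ (i, j))"
  shows "A \<in> herm N"
proof -
  have "mat_adjoint A = A"
  proof (rule eq_matI)
    show "dim_row (mat_adjoint A) = dim_row A" "dim_col (mat_adjoint A) = dim_col A"
      using assms(1) by (auto simp: mat_adjoint_def)
    show "mat_adjoint A $$ (i, j) = A $$ (i, j)" if "i < dim_row A" "j < dim_col A" for i j
      using that assms(1) mat_adjoint_index[OF assms(1), of i j] assms(2)[of j i] by auto
  qed
  then show ?thesis using assms by (simp add: herm_def)
qed

lemma mult_mat_index:
  assumes "A \<in> carrier_mat N N" "B \<in> carrier_mat N N" "i < N" "j < N"
  shows "(A * B) $$ (i, j) = (\<Sum>k<N. A $$ (i, k) * B $$ (k, j))"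
  using assms by (simp add: scalar_prod_def lessThan_atLeast0)

lemma word_eval_Nil [simp]: "word_eval N M [] = 1\<^sub>m N"
  and word_eval_Cons [simp]: "word_eval N M (i # w) = M i * word_eval N M w"
  by (simp_all add: word_eval_def)

lemma tuple_ballD: "M \<in> tuple_ball N R \<Longrightarrow> M i \<in> herm N"
  by (simp add: tuple_ball_def herm_ball_def)

context
  fixes N :: nat and M :: "'n \<Rightarrow> complex mat"
  assumes M_herm: "\<And>i. M i \<in> herm N"
begin

lemma M_carrier [simp]: "M i \<in> carrier_mat N N"
  using hermD(1)[OF M_herm] .

lemma word_eval_carrier [simp]: "word_eval N M w \<in> carrier_mat N N"
  by (induction w) (auto intro: mult_carrier_mat M_carrier)

lemma word_eval_append: "word_eval N M (u @ v) = word_eval N M u * word_eval N M v"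
proof (induction u)
  case Nil
  show ?case using left_mult_one_mat[OF word_eval_carrier] by simp
next
  case (Cons i u)
  then show ?case
    using assoc_mult_mat[OF M_carrier word_eval_carrier word_eval_carrier] by simp
qed

lemma word_eval_rev_index:
  "i < N \<Longrightarrow> j < N \<Longrightarrow> word_eval N M (rev w) $$ (i, j) = cnj (word_eval N M w $$ (j, i))"
proof (induction w arbitrary: i j)
  case Nil
  then show ?case by simp
next
  case (Cons x w)
  have "word_eval N M (rev w @ [x]) $$ (i, j) = (\<Sum>k<N. word_eval N M (rev w) $$ (i, k) * M x $$ (k, j))"
    using Cons.prems
    by (simp add: word_eval_append right_mult_one_mat[OF M_carrier] mult_mat_index[of _ N])
  also have "\<dots> = (\<Sum>k<N. cnj (M x $$ (j, k) * word_eval N M w $$ (k, i)))"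
    using Cons by (intro sum.cong) (auto simp: hermD(2)[OF M_herm])
  also have "\<dots> = cnj (word_eval N M (x # w) $$ (j, i))"
    using Cons.prems by (simp add: mult_mat_index[of _ N] del: index_mult_mat)
  finally show ?case by simp
qed

lemma nc_eval_index:
  "i < N \<Longrightarrow> j < N \<Longrightarrow> nc_eval N M p $$ (i, j) = lin_ext (\<lambda>w. word_eval N M w $$ (i, j)) p"
  by (simp add: nc_eval_def lin_ext_def)

lemma nc_eval_mult_index:
  assumes "i < N" "j < N"
  shows "nc_eval N M (p * q) $$ (i, j) = (\<Sum>k<N. nc_eval N M p $$ (i, k) * nc_eval N M q $$ (k, j))"
proof (induction p rule: ncpoly_induct)
  case (single w c)
  show ?case
  proof (induction q rule: ncpoly_induct)
    case (single v d)
    show ?case using assms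
      by (simp add: nc_eval_index ncpoly_mult_single lin_ext_single word_eval_append
          mult_mat_index[of _ N] sum_distrib_left ac_simps del: index_mult_mat)
  next
    case (add p q)
    then show ?case using assms
      by (simp add: nc_eval_index distrib_left lin_ext_add sum.distrib)
  qed
next
  case (add p q)
  then show ?case using assms
    by (simp add: nc_eval_index distrib_right lin_ext_add sum.distrib)
qed

lemma nc_eval_star_index:
  assumes "i < N" "j < N"
  shows "nc_eval N M (nc_star p) $$ (i, j) = cnj (nc_eval N M p $$ (j, i))"
  by (induction p rule: ncpoly_induct)
    (use assms in \<open>simp_all add: nc_eval_index nc_star_single lin_ext_single word_eval_rev_index
      nc_star_add lin_ext_add\<close>)

lemma matrix_state_eq: "matrix_state N M p = (\<Sum>i<N. nc_eval N M p $$ (i, i)) / of_nat N"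
  by (simp add: matrix_state_def mat_trace_def nc_eval_def)

lemma matrix_state_add: "matrix_state N M (p + q) = matrix_state N M p + matrix_state N M q"
  by (simp add: matrix_state_eq nc_eval_index lin_ext_add sum.distrib add_divide_distrib)

lemma matrix_state_scale: "matrix_state N M (nc_const c * p) = c * matrix_state N M p"
proof -
  have "nc_eval N M (nc_const c * p) $$ (i, i) = c * nc_eval N M p $$ (i, i)" if "i < N" for i
    by (induction p rule: ncpoly_induct)
      (use that in \<open>simp_all add: nc_eval_index ncpoly_mult_single lin_ext_single
        distrib_left lin_ext_add\<close>)
  then show ?thesis by (simp add: matrix_state_eq sum_distrib_left)
qed

lemma matrix_state_star: "matrix_state N M (nc_star p) = cnj (matrix_state N M p)"
  by (simp add: matrix_state_eq nc_eval_star_index)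

lemma matrix_state_trace: "matrix_state N M (p * q) = matrix_state N M (q * p)"
proof -
  have "(\<Sum>i<N. nc_eval N M (p * q) $$ (i, i))
      = (\<Sum>i<N. \<Sum>k<N. nc_eval N M p $$ (i, k) * nc_eval N M q $$ (k, i))"
    by (simp add: nc_eval_mult_index)
  also have "\<dots> = (\<Sum>i<N. \<Sum>k<N. nc_eval N M q $$ (i, k) * nc_eval N M p $$ (k, i))"
    by (subst sum.swap) (simp add: mult.commute)
  also have "\<dots> = (\<Sum>i<N. nc_eval N M (q * p) $$ (i, i))"
    by (simp add: nc_eval_mult_index)
  finally show ?thesis by (simp add: matrix_state_eq)
qed

text \<open>The squared Hilbert--Schmidt norm divided by \<open>N\<close>: positivity is then
  evident, and for \<open>p\<close> a power of a variable, even moments reduce to norms of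
  columns.\<close>

lemma matrix_state_star_mult:
  "matrix_state N M (nc_star p * p)
    = of_real ((\<Sum>i<N. \<Sum>k<N. (cmod (nc_eval N M p $$ (k, i)))\<^sup>2) / real N)"
proof -
  have "cnj z * z = of_real ((cmod z)\<^sup>2)" for z :: complex
    by (metis complex_norm_square mult.commute)
  then show ?thesis
    by (simp add: matrix_state_eq nc_eval_mult_index nc_eval_star_index)
qed

lemma matrix_state_one: "N > 0 \<Longrightarrow> matrix_state N M 1 = 1"
proof -
  assume N: "N > 0"
  have "nc_eval N M 1 $$ (i, i) = 1" if "i < N" for i
    using that unfolding nc_eval_index[OF that that] ncpoly_one lin_ext_single by simp
  then show ?thesis using N by (simp add: matrix_state_eq)
qed

end

section \<open>Euclidean norms, the operator norm and the norm ball\<close>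

lemma vec_l2norm_nonneg [simp]: "vec_l2norm v \<ge> 0"
  by (simp add: vec_l2norm_def sum_nonneg)

lemma vec_l2norm_sq: "(vec_l2norm v)\<^sup>2 = (\<Sum>i<dim_vec v. (cmod (v $ i))\<^sup>2)"
  by (simp add: vec_l2norm_def sum_nonneg)

lemma vec_l2norm_component_le: "i < dim_vec v \<Longrightarrow> cmod (v $ i) \<le> vec_l2norm v"
  by (rule power2_le_imp_le) (auto simp: vec_l2norm_sq intro: member_le_sum)

lemma vec_l2norm_smult: "vec_l2norm (c \<cdot>\<^sub>v v) = cmod c * vec_l2norm v"
  by (simp add: vec_l2norm_def norm_mult power_mult_distrib sum_distrib_left[symmetric] real_sqrt_mult)

lemma vec_l2norm_L2_set: "vec_l2norm v = L2_set (\<lambda>i. cmod (v $ i)) {..<dim_vec v}"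
  by (simp add: vec_l2norm_def L2_set_def)

lemma vec_l2norm_le_sum: "vec_l2norm v \<le> (\<Sum>i<dim_vec v. cmod (v $ i))"
  unfolding vec_l2norm_L2_set by (rule L2_set_le_sum) simp

text \<open>The crude bound by the sum of all entries only serves to show that the supremum defining
  \<open>op_norm\<close> is finite; scaling to the unit ball does the rest.\<close>

lemma op_norm_bound:
  assumes "A \<in> carrier_mat N N" "v \<in> carrier_vec N"
  shows "vec_l2norm (A *\<^sub>v v) \<le> op_norm A * vec_l2norm v"
proof (cases "vec_l2norm v = 0")
  case True
  have "cmod (v $ i) \<le> 0" if "i < N" for i
    using vec_l2norm_component_le[of i v] True that assms(2) by simp
  then have "v = 0\<^sub>v N" using assms(2) by (intro eq_vecI) auto
  then have "A *\<^sub>v v = 0\<^sub>v N" using assms(1) by (intro eq_vecI) auto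
  then show ?thesis using True by (simp add: vec_l2norm_def)
next
  case False
  then have pos: "vec_l2norm v > 0" using vec_l2norm_nonneg[of v] by linarith
  define u where "u = complex_of_real (1 / vec_l2norm v) \<cdot>\<^sub>v v"
  have u: "u \<in> carrier_vec N" "vec_l2norm u \<le> 1"
    using assms pos by (simp_all add: u_def vec_l2norm_smult norm_divide)
  have bound: "vec_l2norm (A *\<^sub>v w) \<le> (\<Sum>i<N. \<Sum>j<N. cmod (A $$ (i, j)))"
    if w: "w \<in> carrier_vec N" "vec_l2norm w \<le> 1" for w
  proof -
    have "vec_l2norm (A *\<^sub>v w) \<le> (\<Sum>i<N. cmod ((A *\<^sub>v w) $ i))"
      using vec_l2norm_le_sum[of "A *\<^sub>v w"] assms(1) by simp
    also have "\<dots> \<le> (\<Sum>i<N. \<Sum>j<N. cmod (A $$ (i, j)))"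
    proof (rule sum_mono)
      fix i assume i: "i \<in> {..<N}"
      have "(A *\<^sub>v w) $ i = (\<Sum>j<N. A $$ (i, j) * w $ j)"
        using i assms(1) w by (simp add: scalar_prod_def lessThan_atLeast0)
      also have "cmod \<dots> \<le> (\<Sum>j<N. cmod (A $$ (i, j)))"
      proof (rule order_trans[OF norm_sum], rule sum_mono)
        fix j assume "j \<in> {..<N}"
        then have "cmod (w $ j) \<le> 1"
          using vec_l2norm_component_le[of j w] w by simp
        then show "cmod (A $$ (i, j) * w $ j) \<le> cmod (A $$ (i, j))"
          by (simp add: norm_mult mult_left_le)
      qed
      finally show "cmod ((A *\<^sub>v w) $ i) \<le> (\<Sum>j<N. cmod (A $$ (i, j)))" .
    qed
    finally show ?thesis .
  qed
  have "vec_l2norm (A *\<^sub>v u) \<le> op_norm A"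
    unfolding op_norm_def
    by (rule cSUP_upper) (use u assms bound in \<open>auto intro!: bdd_aboveI2\<close>)
  moreover have "A *\<^sub>v u = complex_of_real (1 / vec_l2norm v) \<cdot>\<^sub>v (A *\<^sub>v v)"
    unfolding u_def using assms by (intro mult_mat_vec) auto
  ultimately have "(1 / vec_l2norm v) * vec_l2norm (A *\<^sub>v v) \<le> op_norm A"
    by (simp add: vec_l2norm_smult norm_divide)
  then show ?thesis using pos by (simp add: field_simps)
qed

lemma herm_ball_iff:
  assumes "R \<ge> 0"
  shows "A \<in> herm_ball N R \<longleftrightarrow>
    A \<in> herm N \<and> (\<forall>v\<in>carrier_vec N. vec_l2norm (A *\<^sub>v v) \<le> R * vec_l2norm v)"
proof (cases "A \<in> herm N")
  case True
  then have A: "A \<in> carrier_mat N N" by (rule hermD(1))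
  have "op_norm A \<le> R \<longleftrightarrow> (\<forall>v\<in>carrier_vec N. vec_l2norm (A *\<^sub>v v) \<le> R * vec_l2norm v)"
  proof
    assume "op_norm A \<le> R"
    then have "op_norm A * vec_l2norm v \<le> R * vec_l2norm v" for v
      by (rule mult_right_mono) simp
    then show "\<forall>v\<in>carrier_vec N. vec_l2norm (A *\<^sub>v v) \<le> R * vec_l2norm v"
      using op_norm_bound[OF A] order_trans by blast
  next
    assume *: "\<forall>v\<in>carrier_vec N. vec_l2norm (A *\<^sub>v v) \<le> R * vec_l2norm v"
    show "op_norm A \<le> R"
      unfolding op_norm_def
    proof (rule cSUP_least)
      have "0\<^sub>v N \<in> {v \<in> carrier_vec (dim_col A). vec_l2norm v \<le> 1}"
        using A by (simp add: vec_l2norm_def)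
      then show "{v \<in> carrier_vec (dim_col A). vec_l2norm v \<le> 1} \<noteq> {}" by blast
      fix v assume "v \<in> {v \<in> carrier_vec (dim_col A). vec_l2norm v \<le> 1}"
      then have "vec_l2norm (A *\<^sub>v v) \<le> R * vec_l2norm v" "vec_l2norm v \<le> 1"
        using * A by auto
      then show "vec_l2norm (A *\<^sub>v v) \<le> R"
        using mult_left_mono[of "vec_l2norm v" 1 R] assms by simp
    qed
  qed
  with True show ?thesis by (simp add: herm_ball_def)
qed (simp add: herm_ball_def)

lemma herm_ball_bound:
  "A \<in> herm_ball N R \<Longrightarrow> R \<ge> 0 \<Longrightarrow> v \<in> carrier_vec N \<Longrightarrow> vec_l2norm (A *\<^sub>v v) \<le> R * vec_l2norm v"
  using herm_ball_iff by blast

lemma vec_l2norm_unit_vec: "i < N \<Longrightarrow> vec_l2norm (unit_vec N i) = 1"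
proof -
  assume "i < N"
  have "(vec_l2norm (unit_vec N i))\<^sup>2 = (\<Sum>j<N. if j = i then 1 else 0)"
    unfolding vec_l2norm_sq using \<open>i < N\<close> by (auto intro!: sum.cong simp del: sum.delta)
  also have "\<dots> = 1\<^sup>2" using \<open>i < N\<close> by simp
  finally show ?thesis using power2_eq_imp_eq[of "vec_l2norm (unit_vec N i)" 1] by simp
qed

lemma column_sum_sq:
  assumes "A \<in> carrier_mat N N" "i < N"
  shows "(\<Sum>k<N. (cmod (A $$ (k, i)))\<^sup>2) = (vec_l2norm (A *\<^sub>v unit_vec N i))\<^sup>2"
  unfolding vec_l2norm_sq using assms by (intro sum.cong) auto

lemma word_eval_power_bound:
  assumes M: "M \<in> tuple_ball N R" and "R \<ge> 0" and v: "v \<in> carrier_vec N"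
  shows "vec_l2norm (word_eval N M (replicate k i) *\<^sub>v v) \<le> R ^ k * vec_l2norm v"
proof (induction k)
  case 0
  then show ?case using v by simp
next
  case (Suc k)
  have c: "M i \<in> carrier_mat N N" "word_eval N M (replicate k i) \<in> carrier_mat N N"
    using tuple_ballD[OF M] hermD(1) word_eval_carrier by blast+
  have "word_eval N M (replicate (Suc k) i) *\<^sub>v v = M i *\<^sub>v (word_eval N M (replicate k i) *\<^sub>v v)"
    using assoc_mult_mat_vec[OF c v] by simp
  then have "vec_l2norm (word_eval N M (replicate (Suc k) i) *\<^sub>v v)
      \<le> R * vec_l2norm (word_eval N M (replicate k i) *\<^sub>v v)"
    using herm_ball_bound[of "M i" N R "word_eval N M (replicate k i) *\<^sub>v v"] M assms(2) c v
    by (simp add: tuple_ball_def)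
  also have "\<dots> \<le> R * (R ^ k * vec_l2norm v)"
    using Suc assms(2) by (rule mult_left_mono)
  finally show ?case by (simp add: mult.assoc)
qed

lemma matrix_state_trace_state:
  assumes M: "M \<in> tuple_ball N R" and "N > 0" "R > 0"
  shows "matrix_state N M \<in> trace_states R"
proof -
  have h: "\<And>i. M i \<in> herm N" using tuple_ballD[OF M] .
  have pow: "matrix_state N M (nc_var i ^ (2 * k)) \<le> complex_of_real (R ^ (2 * k))" for i k
  proof -
    \<comment> \<open>An even moment is the state at \<open>nc_star p * p\<close>, hence a mean over
      the columns of the power; each column is the image of a unit vector and has norm at most
      \<open>R ^ k\<close>.\<close>
    define p :: "'a ncpoly" where "p = nc_var i ^ k"
    have "nc_star p = p" by (simp add: p_def nc_var_power nc_star_single)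
    then have "nc_star p * p = nc_var i ^ (2 * k)" by (simp add: p_def mult_2 power_add)
    moreover have "nc_eval N M p $$ (a, b) = word_eval N M (replicate k i) $$ (a, b)"
      if "a < N" "b < N" for a b
      using nc_eval_index[where M = M and p = p, OF h that] by (simp add: p_def nc_var_power lin_ext_single)
    ultimately have "matrix_state N M (nc_var i ^ (2 * k))
       = of_real ((\<Sum>b<N. \<Sum>a<N. (cmod (word_eval N M (replicate k i) $$ (a, b)))\<^sup>2) / real N)"
      using matrix_state_star_mult[where M = M and N = N and p = p, OF h] by simp
    also have "(\<Sum>b<N. \<Sum>a<N. (cmod (word_eval N M (replicate k i) $$ (a, b)))\<^sup>2)
        \<le> (\<Sum>b<N. (R ^ k)\<^sup>2)"
    proof (rule sum_mono)
      fix b assume b: "b \<in> {..<N}"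
      have "(\<Sum>a<N. (cmod (word_eval N M (replicate k i) $$ (a, b)))\<^sup>2)
          = (vec_l2norm (word_eval N M (replicate k i) *\<^sub>v unit_vec N b))\<^sup>2"
        by (rule column_sum_sq) (use b h in auto)
      also have "\<dots> \<le> (R ^ k * vec_l2norm (unit_vec N b))\<^sup>2"
        by (intro power_mono word_eval_power_bound[OF M]) (use assms in auto)
      finally show "(\<Sum>a<N. (cmod (word_eval N M (replicate k i) $$ (a, b)))\<^sup>2) \<le> (R ^ k)\<^sup>2"
        using b by (simp add: vec_l2norm_unit_vec)
    qed
    then have "(\<Sum>b<N. \<Sum>a<N. (cmod (word_eval N M (replicate k i) $$ (a, b)))\<^sup>2) / real N \<le> R ^ (2 * k)"
      using \<open>N > 0\<close> by (simp add: divide_le_eq power_even_eq mult.commute[of "real N"])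
    then show ?thesis
      unfolding \<open>matrix_state N M (nc_var i ^ (2 * k)) = _\<close> by (simp add: less_eq_complex_def)
  qed
  have "0 \<le> matrix_state N M (nc_star p * p)" for p
    unfolding matrix_state_star_mult[where M = M and N = N, OF h] less_eq_complex_def
    by (simp add: sum_nonneg)
  then show ?thesis
    unfolding trace_states_def
    using matrix_state_add[where M = M, OF h] matrix_state_scale[where M = M, OF h]
      matrix_state_star[where M = M, OF h] matrix_state_trace[where M = M, OF h]
      matrix_state_one[where M = M, OF h \<open>N > 0\<close>] pow by blast
qed

lemma herm_ball_frobenius:
  assumes "A \<in> herm_ball N R" "R \<ge> 0"
  shows "(\<Sum>i<N. \<Sum>j<N. (cmod (A $$ (i, j)))\<^sup>2) \<le> real N * R\<^sup>2"
proof -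
  have A: "A \<in> carrier_mat N N" using assms(1) hermD(1) by (auto simp: herm_ball_def)
  have "(\<Sum>j<N. \<Sum>i<N. (cmod (A $$ (i, j)))\<^sup>2) \<le> (\<Sum>j<N. R\<^sup>2)"
  proof (rule sum_mono)
    fix j assume j: "j \<in> {..<N}"
    have "(\<Sum>i<N. (cmod (A $$ (i, j)))\<^sup>2) = (vec_l2norm (A *\<^sub>v unit_vec N j))\<^sup>2"
      by (rule column_sum_sq) (use A j in auto)
    also have "\<dots> \<le> (R * vec_l2norm (unit_vec N j))\<^sup>2"
      by (intro power_mono herm_ball_bound[OF assms]) auto
    finally show "(\<Sum>i<N. (cmod (A $$ (i, j)))\<^sup>2) \<le> R\<^sup>2"
      using j by (simp add: vec_l2norm_unit_vec)
  qed
  then show ?thesis by (subst sum.swap) simp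
qed

text \<open>This is what makes the ball measurable: by continuity it is enough to test vectors with
  coordinates in a dense set, and for countable \<open>D\<close> these are countably many conditions
  on the entries.\<close>

lemma herm_ball_iff_countable:
  assumes "R \<ge> 0" and D: "\<And>X :: complex set. open X \<Longrightarrow> X \<noteq> {} \<Longrightarrow> \<exists>d\<in>D. d \<in> X"
  shows "A \<in> herm_ball N R \<longleftrightarrow> A \<in> herm N \<and>
    (\<forall>q\<in>{..<N} \<rightarrow>\<^sub>E D. (\<Sum>i<N. (cmod (\<Sum>j<N. A $$ (i, j) * q j))\<^sup>2) \<le> R\<^sup>2 * (\<Sum>j<N. (cmod (q j))\<^sup>2))"
  (is "_ \<longleftrightarrow> _ \<and> (\<forall>q\<in>_. ?P q)")
proof (cases "A \<in> herm N")
  case True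
  then have A: "A \<in> carrier_mat N N" by (rule hermD(1))
  have P_vec: "vec_l2norm (A *\<^sub>v v) \<le> R * vec_l2norm v \<longleftrightarrow> ?P (\<lambda>j. v $ j)"
    if v: "v \<in> carrier_vec N" for v
  proof -
    have "(vec_l2norm (A *\<^sub>v v))\<^sup>2 = (\<Sum>i<N. (cmod (\<Sum>j<N. A $$ (i, j) * v $ j))\<^sup>2)"
      unfolding vec_l2norm_sq using A v
      by (auto intro!: sum.cong simp: scalar_prod_def lessThan_atLeast0)
    moreover have "(R * vec_l2norm v)\<^sup>2 = R\<^sup>2 * (\<Sum>j<N. (cmod (v $ j))\<^sup>2)"
      using v by (simp add: power_mult_distrib vec_l2norm_sq)
    moreover have "vec_l2norm (A *\<^sub>v v) \<le> R * vec_l2norm v \<longleftrightarrow>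
        (vec_l2norm (A *\<^sub>v v))\<^sup>2 \<le> (R * vec_l2norm v)\<^sup>2"
      using assms(1) by (metis abs_le_square_iff abs_of_nonneg mult_nonneg_nonneg vec_l2norm_nonneg)
    ultimately show ?thesis by simp
  qed
  have "(\<forall>v\<in>carrier_vec N. vec_l2norm (A *\<^sub>v v) \<le> R * vec_l2norm v) \<longleftrightarrow> (\<forall>q\<in>{..<N} \<rightarrow>\<^sub>E D. ?P q)"
  proof (intro iffI ballI)
    fix q assume *: "\<forall>v\<in>carrier_vec N. vec_l2norm (A *\<^sub>v v) \<le> R * vec_l2norm v"
    have "?P (\<lambda>j. vec N q $ j)" using * P_vec[of "vec N q"] by simp
    then show "?P q" by simp
  next
    fix v :: "complex vec"
    assume *: "\<forall>q\<in>{..<N} \<rightarrow>\<^sub>E D. ?P q" and v: "v \<in> carrier_vec N"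
    have "\<exists>d\<in>D. dist d (v $ j) < 1 / real (Suc n)" for n j
      using D[of "ball (v $ j) (1 / real (Suc n))"] by (auto simp: dist_commute)
    then have ex: "\<exists>d. d \<in> D \<and> dist d (v $ j) < 1 / real (Suc n)" for n j
      by blast
    define d where "d n j = (SOME d. d \<in> D \<and> dist d (v $ j) < 1 / real (Suc n))" for n j
    have d: "d n j \<in> D" "dist (d n j) (v $ j) < 1 / real (Suc n)" for n j
      using someI_ex[OF ex[of j n]] unfolding d_def[symmetric] by blast+
    have lim: "(\<lambda>n. d n j) \<longlonglongrightarrow> v $ j" for j
    proof (rule metric_LIMSEQ_I)
      fix e :: real assume "e > 0"
      then obtain n0 where "inverse (real (Suc n0)) < e" using reals_Archimedean by blast
      then have "dist (d n j) (v $ j) < e" if "n \<ge> n0" for n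
      proof -
        have "1 / real (Suc n) \<le> inverse (real (Suc n0))"
          using that by (simp add: field_simps)
        then show ?thesis using d(2)[of n j] \<open>inverse (real (Suc n0)) < e\<close> by linarith
      qed
      then show "\<exists>n0. \<forall>n\<ge>n0. dist (d n j) (v $ j) < e" by blast
    qed
    have "?P (d n)" for n
    proof -
      have "restrict (d n) {..<N} \<in> {..<N} \<rightarrow>\<^sub>E D"
        using d(1) by (simp add: PiE_def)
      with * have "?P (restrict (d n) {..<N})" by blast
      then show ?thesis by simp
    qed
    moreover have "(\<lambda>n. \<Sum>i<N. (cmod (\<Sum>j<N. A $$ (i, j) * d n j))\<^sup>2)
        \<longlonglongrightarrow> (\<Sum>i<N. (cmod (\<Sum>j<N. A $$ (i, j) * v $ j))\<^sup>2)"
      by (intro tendsto_intros lim)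
    moreover have "(\<lambda>n. R\<^sup>2 * (\<Sum>j<N. (cmod (d n j))\<^sup>2)) \<longlonglongrightarrow> R\<^sup>2 * (\<Sum>j<N. (cmod (v $ j))\<^sup>2)"
      by (intro tendsto_intros lim)
    ultimately have "?P (\<lambda>j. v $ j)" by (intro LIMSEQ_le) auto
    then show "vec_l2norm (A *\<^sub>v v) \<le> R * vec_l2norm v" using P_vec[OF v] by simp
  qed
  then show ?thesis using True herm_ball_iff[OF assms(1)] by blast
qed (simp add: herm_ball_def)

subsection \<open>Lebesgue measure on Hermitian matrices\<close>

lemma space_herm_borel [simp]: "space (herm_borel N) = herm N"
  and space_herm_lebesgue [simp]: "space (herm_lebesgue N) = herm N"
  and sets_herm_lebesgue: "sets (herm_lebesgue N) = sets (herm_borel N)"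
  by (simp_all add: herm_borel_def herm_lebesgue_def)

lemma herm_borel_entry:
  assumes "i < N" "j < N"
  shows "(\<lambda>A. A $$ (i, j)) \<in> borel_measurable (herm_borel N)"
proof -
  have "(\<lambda>A. \<lambda>ij\<in>{..<N} \<times> {..<N}. A $$ ij)
      \<in> measurable (herm_borel N) (PiM ({..<N} \<times> {..<N}) (\<lambda>_. borel))"
    unfolding herm_borel_def by (rule measurable_vimage_algebra1) (auto simp: space_PiM)
  from measurable_compose[OF this measurable_component_singleton[of "(i, j)"]] assms
  show ?thesis by simp
qed

lemma herm_of_coords_herm: "herm_of_coords N x \<in> herm N"
  by (rule hermI) (auto simp: herm_of_coords_def complex_eq_iff)

lemma herm_of_coords_norm:
  assumes "i < N" "j < N"
  shows "(cmod (herm_of_coords N x $$ (i, j)))\<^sup>2 = ((x (i, j))\<^sup>2 + (x (j, i))\<^sup>2) / 2"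
  using assms by (auto simp: herm_of_coords_def cmod_power2 power_divide field_simps)

text \<open>The coordinates are isometric for the Hilbert--Schmidt norm, so a bound on that norm
  becomes a bound on a sum of squares, to which a product Gaussian can be compared.\<close>

lemma herm_of_coords_frobenius:
  "(\<Sum>i<N. \<Sum>j<N. (cmod (herm_of_coords N x $$ (i, j)))\<^sup>2) = (\<Sum>ij\<in>{..<N} \<times> {..<N}. (x ij)\<^sup>2)"
proof -
  have "(\<Sum>i<N. \<Sum>j<N. (cmod (herm_of_coords N x $$ (i, j)))\<^sup>2)
      = ((\<Sum>i<N. \<Sum>j<N. (x (i, j))\<^sup>2) + (\<Sum>i<N. \<Sum>j<N. (x (j, i))\<^sup>2)) / 2"
    by (simp add: herm_of_coords_norm sum.distrib sum_divide_distrib[symmetric])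
  also have "(\<Sum>i<N. \<Sum>j<N. (x (j, i))\<^sup>2) = (\<Sum>i<N. \<Sum>j<N. (x (i, j))\<^sup>2)"
    by (rule sum.swap)
  finally show ?thesis by (simp add: sum.cartesian_product)
qed

lemma herm_of_coords_measurable:
  "herm_of_coords N \<in> measurable (PiM ({..<N} \<times> {..<N}) (\<lambda>_. lborel)) (herm_borel N)"
  unfolding herm_borel_def
proof (rule measurable_vimage_algebra2)
  show "herm_of_coords N \<in> space (PiM ({..<N} \<times> {..<N}) (\<lambda>_. lborel)) \<rightarrow> herm N"
    using herm_of_coords_herm by blast
  show "(\<lambda>x. \<lambda>ij\<in>{..<N} \<times> {..<N}. herm_of_coords N x $$ ij)
      \<in> measurable (PiM ({..<N} \<times> {..<N}) (\<lambda>_. lborel)) (PiM ({..<N} \<times> {..<N}) (\<lambda>_. borel))"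
  proof (rule measurable_restrict)
    fix ij assume "ij \<in> {..<N} \<times> {..<N}"
    then obtain i j where ij: "ij = (i, j)" "i < N" "j < N" by auto
    have [measurable]: "(\<lambda>x. x (a, b)) \<in> borel_measurable (PiM ({..<N} \<times> {..<N}) (\<lambda>_. lborel))"
      if "a < N" "b < N" for a b
      using measurable_component_singleton[of "(a, b)" "{..<N} \<times> {..<N}" "\<lambda>_. lborel"] that
      by simp
    have m: "(\<lambda>x. Complex (f x) (g x)) \<in> borel_measurable M"
      if "f \<in> borel_measurable M" "g \<in> borel_measurable M" for f g :: "_ \<Rightarrow> real" and M
      unfolding Complex_eq using that by measurable
    show "(\<lambda>x. herm_of_coords N x $$ ij) \<in> borel_measurable (PiM ({..<N} \<times> {..<N}) (\<lambda>_. lborel))"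
      using ij by (cases i j rule: linorder_cases) (auto simp: herm_of_coords_def intro!: m)
  qed
qed

lemma herm_ball_sets:
  assumes "R \<ge> 0"
  shows "herm_ball N R \<in> sets (herm_borel N)"
proof -
  obtain D :: "complex set" where D: "countable D" "\<And>X. open X \<Longrightarrow> X \<noteq> {} \<Longrightarrow> \<exists>d\<in>D. d \<in> X"
    using countable_dense_exists by blast
  let ?P = "\<lambda>A q. (\<Sum>i<N. (cmod (\<Sum>j<N. A $$ (i, j) * q j))\<^sup>2) \<le> R\<^sup>2 * (\<Sum>j<N. (cmod (q j))\<^sup>2)"
  have c: "countable ({..<N} \<rightarrow>\<^sub>E D)" by (rule countable_PiE) (use D in auto)
  have "{A \<in> space (herm_borel N). ?P A q} \<in> sets (herm_borel N)" for q
  proof -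
    have "(\<lambda>A. \<Sum>i<N. (cmod (\<Sum>j<N. A $$ (i, j) * q j))\<^sup>2) \<in> borel_measurable (herm_borel N)"
      by (intro borel_measurable_sum borel_measurable_power measurable_compose[OF _ borel_measurable_norm]
          borel_measurable_times herm_borel_entry borel_measurable_const) auto
    then show ?thesis by measurable
  qed
  then have "{A \<in> space (herm_borel N). \<forall>q\<in>{..<N} \<rightarrow>\<^sub>E D. ?P A q} \<in> sets (herm_borel N)"
    by (intro sets.sets_Collect_countable_All' c)
  also have "{A \<in> space (herm_borel N). \<forall>q\<in>{..<N} \<rightarrow>\<^sub>E D. ?P A q} = herm_ball N R"
    using herm_ball_iff_countable[OF assms D(2)] by auto
  finally show ?thesis .
qed

lemma nn_integral_gaussian:
  assumes "s > 0"
  shows "(\<integral>\<^sup>+ x. ennreal (exp (- s * x\<^sup>2)) \<partial>lborel) = ennreal (sqrt (pi / s))"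
proof -
  define \<sigma> where "\<sigma> = 1 / sqrt (2 * s)"
  have \<sigma>: "\<sigma> > 0" "\<sigma>\<^sup>2 = 1 / (2 * s)"
    using assms by (simp_all add: \<sigma>_def power_divide)
  have eq: "exp (- s * x\<^sup>2) = sqrt (pi / s) * normal_density 0 \<sigma> x" for x
    using assms unfolding normal_density_def \<sigma>(2) by (simp add: real_sqrt_divide field_simps)
  have "(\<integral>\<^sup>+ x. ennreal (normal_density 0 \<sigma> x) \<partial>lborel) = 1"
    using prob_space.emeasure_space_1[OF prob_space_normal_density[OF \<sigma>(1), of 0]]
    by (simp add: emeasure_density)
  then show ?thesis
    unfolding eq using assms by (simp add: ennreal_mult nn_integral_cmult)
qed

text \<open>On the ball the Hilbert--Schmidt norm is at most \<open>sqrt N * R\<close>, so its indicator is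
  dominated there by a Gaussian.\<close>

lemma herm_ball_volume:
  assumes "R \<ge> 0" "s > 0"
  shows "emeasure (herm_lebesgue N) (herm_ball N R)
    \<le> ennreal (exp (s * (real N * R\<^sup>2)) * sqrt (pi / s) ^ (N * N))"
proof -
  let ?I = "{..<N} \<times> {..<N}"
  let ?L = "PiM ?I (\<lambda>_. lborel :: real measure)"
  interpret product_sigma_finite "\<lambda>_ :: nat \<times> nat. lborel :: real measure"
    by unfold_locales
  have "emeasure (herm_lebesgue N) (herm_ball N R)
      = emeasure ?L (herm_of_coords N -` herm_ball N R \<inter> space ?L)"
    unfolding herm_lebesgue_def
    by (rule emeasure_distr[OF herm_of_coords_measurable herm_ball_sets[OF assms(1)]])
  also have "\<dots> = (\<integral>\<^sup>+ x. indicator (herm_of_coords N -` herm_ball N R \<inter> space ?L) x \<partial>?L)"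
    using measurable_sets[OF herm_of_coords_measurable herm_ball_sets[OF assms(1)]] by simp
  also have "\<dots> \<le> (\<integral>\<^sup>+ x. ennreal (exp (s * (real N * R\<^sup>2))) * (\<Prod>ij\<in>?I. ennreal (exp (- s * (x ij)\<^sup>2))) \<partial>?L)"
  proof (rule nn_integral_mono)
    fix x
    show "indicator (herm_of_coords N -` herm_ball N R \<inter> space ?L) x
        \<le> ennreal (exp (s * (real N * R\<^sup>2))) * (\<Prod>ij\<in>?I. ennreal (exp (- s * (x ij)\<^sup>2)))"
    proof (cases "herm_of_coords N x \<in> herm_ball N R")
      case True
      have "(\<Sum>ij\<in>?I. (x ij)\<^sup>2) \<le> real N * R\<^sup>2"
        using herm_ball_frobenius[OF True assms(1)] by (simp add: herm_of_coords_frobenius)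
      then have "s * (\<Sum>ij\<in>?I. (x ij)\<^sup>2) \<le> s * (real N * R\<^sup>2)"
        using assms(2) by (intro mult_left_mono) auto
      then have "1 \<le> exp (s * (real N * R\<^sup>2) - s * (\<Sum>ij\<in>?I. (x ij)\<^sup>2))" by simp
      also have "\<dots> = exp (s * (real N * R\<^sup>2)) * (\<Prod>ij\<in>?I. exp (- s * (x ij)\<^sup>2))"
        by (simp add: exp_sum[symmetric] exp_add[symmetric] sum_distrib_left sum_negf)
      finally have "ennreal 1 \<le> ennreal \<dots>" by (rule ennreal_leI)
      then have "1 \<le> ennreal (exp (s * (real N * R\<^sup>2))) * (\<Prod>ij\<in>?I. ennreal (exp (- s * (x ij)\<^sup>2)))"
        by (simp add: ennreal_mult prod_nonneg prod_ennreal)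
      then show ?thesis by (auto simp: indicator_def)
    qed auto
  qed
  also have "\<dots> = ennreal (exp (s * (real N * R\<^sup>2))) *
      (\<integral>\<^sup>+ x. (\<Prod>ij\<in>?I. ennreal (exp (- s * (x ij)\<^sup>2))) \<partial>?L)"
    by (rule nn_integral_cmult) measurable
  also have "(\<integral>\<^sup>+ x. (\<Prod>ij\<in>?I. ennreal (exp (- s * (x ij)\<^sup>2))) \<partial>?L)
      = (\<Prod>ij\<in>?I. \<integral>\<^sup>+ y. ennreal (exp (- s * y\<^sup>2)) \<partial>lborel)"
    by (rule product_nn_integral_prod) auto
  also have "\<dots> = ennreal (sqrt (pi / s) ^ (N * N))"
    unfolding nn_integral_gaussian[OF assms(2)] using assms(2)
    by (simp add: ennreal_power)
  finally show ?thesis using assms(2) by (simp add: ennreal_mult)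
qed

text \<open>Balls of integer radius exhaust the space and have finite volume by the Gaussian bound;
  the product measure over the variables relies on this.\<close>

lemma sigma_finite_herm_lebesgue: "sigma_finite_measure (herm_lebesgue N)"
proof
  have "\<Union> (range (\<lambda>k. herm_ball N (real k))) = herm N"
    using real_arch_simple by (fastforce simp: herm_ball_def)
  moreover have "emeasure (herm_lebesgue N) (herm_ball N (real k)) \<noteq> \<infinity>" for k
    using herm_ball_volume[of "real k" 1 N] by (auto simp: top_unique)
  ultimately show "\<exists>A. countable A \<and> A \<subseteq> sets (herm_lebesgue N) \<and> \<Union> A = space (herm_lebesgue N)
      \<and> (\<forall>a\<in>A. emeasure (herm_lebesgue N) a \<noteq> \<infinity>)"
    by (intro exI[of _ "range (\<lambda>k. herm_ball N (real k))"])
      (auto simp: sets_herm_lebesgue herm_ball_sets)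
qed

lemma tuple_ball_PiE: "tuple_ball N R = Pi\<^sub>E UNIV (\<lambda>_. herm_ball N R)"
  by (auto simp: tuple_ball_def)

lemma tuple_ball_sets:
  assumes "R \<ge> 0"
  shows "(tuple_ball N R :: ('n::finite \<Rightarrow> complex mat) set) \<in> sets (PiM UNIV (\<lambda>_. herm_lebesgue N))"
  unfolding tuple_ball_PiE
  by (rule sets_PiM_I_finite) (use herm_ball_sets[OF assms] in \<open>auto simp: sets_herm_lebesgue\<close>)

lemma space_tuple_lebesgue [simp]:
  "space (tuple_lebesgue N R :: ('n::finite \<Rightarrow> complex mat) measure) = tuple_ball N R"
  by (auto simp: tuple_lebesgue_def space_restrict_space space_PiM tuple_ball_def herm_ball_def)

lemma tuple_lebesgue_volume:
  assumes "R \<ge> 0" "s > 0"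
  shows "emeasure (tuple_lebesgue N R :: ('n::finite \<Rightarrow> complex mat) measure) (tuple_ball N R)
    \<le> ennreal ((exp (s * (real N * R\<^sup>2)) * sqrt (pi / s) ^ (N * N)) ^ CARD('n))"
proof -
  interpret product_sigma_finite "\<lambda>_ :: 'n. herm_lebesgue N"
    by (intro product_sigma_finite.intro sigma_finite_herm_lebesgue)
  have "emeasure (tuple_lebesgue N R :: ('n::finite \<Rightarrow> complex mat) measure) (tuple_ball N R)
      = emeasure (PiM UNIV (\<lambda>_ :: 'n. herm_lebesgue N)) (tuple_ball N R)"
    unfolding tuple_lebesgue_def
    by (rule emeasure_restrict_space) (use tuple_ball_sets[OF assms(1)] in auto)
  also have "\<dots> = emeasure (herm_lebesgue N) (herm_ball N R) ^ CARD('n)"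
    unfolding tuple_ball_PiE
    by (subst emeasure_PiM) (use herm_ball_sets[OF assms(1)] in \<open>auto simp: sets_herm_lebesgue\<close>)
  also have "\<dots> \<le> ennreal (exp (s * (real N * R\<^sup>2)) * sqrt (pi / s) ^ (N * N)) ^ CARD('n)"
    by (rule power_mono[OF herm_ball_volume[OF assms]]) simp
  finally show ?thesis using assms(2) by (simp add: ennreal_power)
qed

lemma finite_measure_tuple_lebesgue:
  assumes "R \<ge> 0"
  shows "finite_measure (tuple_lebesgue N R :: ('n::finite \<Rightarrow> complex mat) measure)"
  by standard (use tuple_lebesgue_volume[OF assms, of 1 N, where 'n = 'n] in \<open>auto simp: top_unique\<close>)

subsection \<open>States of random matrices\<close>

lemma tuple_entry_measurable:
  assumes "i < N" "j < N"
  shows "(\<lambda>M. M x $$ (i, j)) \<in> borel_measurable (tuple_lebesgue N R :: ('n::finite \<Rightarrow> complex mat) measure)"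
proof -
  have "(\<lambda>A. A $$ (i, j)) \<in> borel_measurable (herm_lebesgue N)"
    using herm_borel_entry[OF assms] measurable_cong_sets[OF sets_herm_lebesgue refl] by blast
  from measurable_compose[OF measurable_component_singleton[of x UNIV "\<lambda>_. herm_lebesgue N"] this]
  show ?thesis unfolding tuple_lebesgue_def by (intro measurable_restrict_space1) simp
qed

lemma word_eval_measurable:
  assumes "i < N" "j < N"
  shows "(\<lambda>M. word_eval N M w $$ (i, j))
    \<in> borel_measurable (tuple_lebesgue N R :: ('n::finite \<Rightarrow> complex mat) measure)"
  using assms(1)
proof (induction w arbitrary: i)
  case (Cons x w)
  have "(\<lambda>M. \<Sum>k<N. M x $$ (i, k) * word_eval N M w $$ (k, j))
      \<in> borel_measurable (tuple_lebesgue N R :: ('n::finite \<Rightarrow> complex mat) measure)"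
    using Cons assms(2) by (intro borel_measurable_sum borel_measurable_times tuple_entry_measurable) auto
  moreover have "(\<Sum>k<N. M x $$ (i, k) * word_eval N M w $$ (k, j)) = word_eval N M (x # w) $$ (i, j)"
    if "M \<in> space (tuple_lebesgue N R)" for M :: "'n \<Rightarrow> complex mat"
  proof -
    have h: "\<And>i. M i \<in> herm N" using that tuple_ballD by auto
    show ?thesis
      unfolding word_eval_Cons
      by (rule mult_mat_index[symmetric])
        (use h Cons.prems assms(2) hermD(1) word_eval_carrier[where M = M] in auto)
  qed
  ultimately show ?case by (subst measurable_cong[symmetric]) auto
qed simp

lemma matrix_state_measurable:
  "(\<lambda>M. matrix_state N M p) \<in> borel_measurable (tuple_lebesgue N R :: ('n::finite \<Rightarrow> complex mat) measure)"
proof -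
  have "matrix_state N M p = (\<Sum>i<N. \<Sum>w\<in>Poly_Mapping.keys p.
      Poly_Mapping.lookup p w * word_eval N M w $$ (i, i)) / of_nat N" for M :: "'n \<Rightarrow> complex mat"
    by (simp add: matrix_state_def mat_trace_def nc_eval_def)
  then show ?thesis
    by (simp only:) (intro borel_measurable_divide borel_measurable_sum borel_measurable_times
        borel_measurable_const word_eval_measurable; simp)
qed

context trace_state
begin

lemma eq_lin_ext: "\<tau> p = lin_ext (\<lambda>w. \<tau> (nc_monom w)) p"
proof (induction p rule: ncpoly_induct)
  case (single w c)
  show ?case using scale[of c "nc_monom w"] by (simp only: nc_const_mult_monom lin_ext_single)
qed (simp add: add lin_ext_add)

text \<open>The bound depends on \<open>p\<close> and \<open>R\<close> but not on the state. It
  yields integrability of matrix states and, later, the existence of limits along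
  \<open>\<omega>\<close>.\<close>

lemma cmod_le: "cmod (\<tau> p) \<le> (\<Sum>w\<in>Poly_Mapping.keys p. cmod (Poly_Mapping.lookup p w) * R ^ length w)"
  unfolding eq_lin_ext[of p] lin_ext_def
  by (rule order_trans[OF norm_sum], rule sum_mono)
    (simp add: norm_mult mult_left_mono cmod_monom_le)

end

lemma matrix_state_integrable:
  fixes \<nu> :: "('n::finite \<Rightarrow> complex mat) measure"
  assumes "finite_measure \<nu>" "sets \<nu> = sets (tuple_lebesgue N R)" "N > 0" "R > 0"
  shows "integrable \<nu> (\<lambda>M. matrix_state N M p)"
proof -
  interpret finite_measure \<nu> by fact
  show ?thesis
  proof (rule integrable_const_bound)
    show "AE M in \<nu>. cmod (matrix_state N M p)
        \<le> (\<Sum>w\<in>Poly_Mapping.keys p. cmod (Poly_Mapping.lookup p w) * R ^ length w)"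
    proof (rule AE_I2)
      fix M assume "M \<in> space \<nu>"
      then have "M \<in> tuple_ball N R" using sets_eq_imp_space_eq[OF assms(2)] by simp
      then interpret trace_state R "matrix_state N M"
        using matrix_state_trace_state assms by unfold_locales auto
      show "cmod (matrix_state N M p)
        \<le> (\<Sum>w\<in>Poly_Mapping.keys p. cmod (Poly_Mapping.lookup p w) * R ^ length w)"
        by (rule cmod_le)
    qed
    show "(\<lambda>M. matrix_state N M p) \<in> borel_measurable \<nu>"
      using matrix_state_measurable measurable_cong_sets[OF assms(2) refl] by blast
  qed
qed

text \<open>In the order on complex numbers, \<open>f x \<le> c\<close> forces the imaginary part of
  \<open>f x\<close> to be that of \<open>c\<close>; only the real part needs monotonicity.\<close>

lemma integral_complex_mono:
  fixes f :: "'a \<Rightarrow> complex"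
  assumes "prob_space \<nu>" "integrable \<nu> f" "\<And>x. x \<in> space \<nu> \<Longrightarrow> f x \<le> c"
  shows "(\<integral>x. f x \<partial>\<nu>) \<le> c"
proof -
  interpret prob_space \<nu> by fact
  have i: "integrable \<nu> (\<lambda>x. Re (f x))" using assms(2) by simp
  have "(\<integral>x. Re (f x) \<partial>\<nu>) \<le> (\<integral>x. Re c \<partial>\<nu>)"
    by (rule integral_mono[OF i]) (use assms(3) in \<open>auto simp: less_eq_complex_def\<close>)
  moreover have "(\<integral>x. Im (f x) \<partial>\<nu>) = (\<integral>x. Im c \<partial>\<nu>)"
    by (rule Bochner_Integration.integral_cong) (use assms(3) in \<open>auto simp: less_eq_complex_def\<close>)
  ultimately show ?thesis
    using assms(2) by (simp add: less_eq_complex_def prob_space)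
qed

text \<open>Each condition on a trace state is an affine equation or inequality in its values, so it
  survives averaging over \<open>\<nu>\<close>.\<close>

lemma measure_state_trace_state:
  fixes \<nu> :: "('n::finite \<Rightarrow> complex mat) measure"
  assumes \<nu>: "prob_space \<nu>" "sets \<nu> = sets (tuple_lebesgue N R)" and "N > 0" "R > 0"
  shows "measure_state N \<nu> \<in> trace_states R"
proof -
  interpret prob_space \<nu> by fact
  have int: "integrable \<nu> (\<lambda>M. matrix_state N M p)" for p
    by (rule matrix_state_integrable) (use assms finite_measure_axioms in auto)
  have st: "matrix_state N M \<in> trace_states R" if "M \<in> space \<nu>" for M
    using that sets_eq_imp_space_eq[OF \<nu>(2)] matrix_state_trace_state assms by auto
  have h: "M i \<in> herm N" if "M \<in> space \<nu>" for M i
    using that sets_eq_imp_space_eq[OF \<nu>(2)] tuple_ballD by auto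
  have "measure_state N \<nu> (p + q) = measure_state N \<nu> p + measure_state N \<nu> q" for p q
    unfolding measure_state_def Bochner_Integration.integral_add[OF int int, symmetric]
    by (rule Bochner_Integration.integral_cong) (auto intro!: matrix_state_add h)
  moreover have "measure_state N \<nu> (nc_const c * p) = c * measure_state N \<nu> p" for c p
    unfolding measure_state_def integral_mult_right_zero[symmetric]
    by (rule Bochner_Integration.integral_cong) (auto intro!: matrix_state_scale h)
  moreover have "measure_state N \<nu> (nc_star p) = cnj (measure_state N \<nu> p)" for p
    unfolding measure_state_def Bochner_Integration.integral_cnj[symmetric]
    by (rule Bochner_Integration.integral_cong) (auto intro!: matrix_state_star h)
  moreover have "measure_state N \<nu> (p * q) = measure_state N \<nu> (q * p)" for p q
    unfolding measure_state_def
    by (rule Bochner_Integration.integral_cong) (auto intro!: matrix_state_trace h)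
  moreover have "0 \<le> measure_state N \<nu> (nc_star p * p)" for p
  proof -
    have nn: "0 \<le> matrix_state N M (nc_star p * p)" if "M \<in> space \<nu>" for M
      using st[OF that] unfolding trace_states_def by blast
    have "(\<integral>M. - matrix_state N M (nc_star p * p) \<partial>\<nu>) \<le> 0"
      by (rule integral_complex_mono[OF \<nu>(1) integrable_minus[OF int]])
        (use nn in \<open>simp only: neg_le_0_iff_le\<close>)
    then show ?thesis by (simp add: measure_state_def)
  qed
  moreover have "measure_state N \<nu> 1 = 1"
  proof -
    have "measure_state N \<nu> 1 = (\<integral>M. 1 \<partial>\<nu>)"
      unfolding measure_state_def
      by (rule Bochner_Integration.integral_cong) (use st in \<open>auto simp: trace_states_def\<close>)
    then show ?thesis by (simp add: prob_space)
  qed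
  moreover have "measure_state N \<nu> (nc_var i ^ (2 * k)) \<le> complex_of_real (R ^ (2 * k))" for i k
    unfolding measure_state_def
    by (rule integral_complex_mono[OF \<nu>(1) int]) (use st in \<open>auto simp: trace_states_def\<close>)
  ultimately show ?thesis unfolding trace_states_def by blast
qed

lemma microstates_sets:
  assumes "N > 0" "R > 0"
  shows "microstates R \<epsilon> K N (\<tau> :: 'n::finite ncpoly \<Rightarrow> complex) \<in> sets (tuple_lebesgue N R)"
proof -
  let ?L = "tuple_lebesgue N R :: ('n \<Rightarrow> complex mat) measure"
  have "finite {w :: 'n list. length w < K}"
    using finite_lists_length_le[of UNIV K] by (rule finite_subset[rotated]) auto
  moreover have "{M \<in> space ?L. cmod (\<tau> (nc_monom w) - matrix_state N M (nc_monom w)) < \<epsilon>} \<in> sets ?L" for w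
  proof -
    have [measurable]: "(\<lambda>M. matrix_state N M (nc_monom w)) \<in> borel_measurable ?L"
      by (rule matrix_state_measurable)
    show ?thesis by measurable
  qed
  ultimately have "{M \<in> space ?L. \<forall>w\<in>{w. length w < K}.
      cmod (\<tau> (nc_monom w) - matrix_state N M (nc_monom w)) < \<epsilon>} \<in> sets ?L"
    by (intro sets.sets_Collect_countable_All' countable_finite)
  also have "{M \<in> space ?L. \<forall>w\<in>{w. length w < K}.
      cmod (\<tau> (nc_monom w) - matrix_state N M (nc_monom w)) < \<epsilon>} = microstates R \<epsilon> K N \<tau>"
    using matrix_state_trace_state[OF _ assms]
    by (auto simp: microstates_def state_nbhd_def)
  finally show ?thesis .
qed

subsection \<open>Limits along an ultrafilter\<close>

text \<open>If the complement of a point were not in the ultrafilter, the point would be, and the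
  filter would be principal. So complements of finite sets belong to it, and ordinary limits are
  limits along it.\<close>

lemma nontrivial_ultrafilterD:
  assumes "nontrivial_ultrafilter \<omega>"
  shows "\<omega> \<noteq> bot" "eventually P \<omega> \<or> eventually (\<lambda>N. \<not> P N) \<omega>" "\<omega> \<le> sequentially"
proof -
  show bot: "\<omega> \<noteq> bot" and ult: "eventually P \<omega> \<or> eventually (\<lambda>N. \<not> P N) \<omega>" for P
    using assms unfolding nontrivial_ultrafilter_def by blast+
  have "eventually (\<lambda>n. n \<noteq> N) \<omega>" for N
  proof (rule ccontr)
    assume "\<not> eventually (\<lambda>n. n \<noteq> N) \<omega>"
    then have ev: "eventually (\<lambda>n. n = N) \<omega>" using ult[of "\<lambda>n. n \<noteq> N"] by simp
    have "eventually P \<omega> \<longleftrightarrow> P N" for P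
    proof
      assume "eventually P \<omega>"
      then have "eventually (\<lambda>n. P n \<and> n = N) \<omega>" using ev by (rule eventually_conj)
      then show "P N" using bot eventually_happens' by fastforce
    next
      assume "P N"
      then show "eventually P \<omega>" using ev by (auto elim: eventually_mono)
    qed
    then have "\<omega> = principal {N}" by (simp add: filter_eq_iff eventually_principal)
    then show False using assms unfolding nontrivial_ultrafilter_def by blast
  qed
  then have ne: "eventually (\<lambda>n. \<forall>N\<in>{..<M}. n \<noteq> N) \<omega>" for M
    by (intro eventually_ball_finite) auto
  have ge: "eventually (\<lambda>n. M \<le> n) \<omega>" for M
    by (rule eventually_mono[OF ne[of M]]) (use linorder_not_less in blast)
  show "\<omega> \<le> sequentially"
  proof (rule filter_leI)
    fix P :: "nat \<Rightarrow> bool" assume "eventually P sequentially"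
    then obtain M where "\<And>n. n \<ge> M \<Longrightarrow> P n" unfolding eventually_sequentially by blast
    with ge[of M] show "eventually P \<omega>" by (rule eventually_mono)
  qed
qed

text \<open>Compactness gives a cluster point of the image filter, and for an ultrafilter every
  cluster point is a limit.\<close>

lemma ultrafilter_limit_bounded:
  fixes f :: "nat \<Rightarrow> 'a :: heine_borel"
  assumes \<omega>: "nontrivial_ultrafilter \<omega>" and b: "\<And>k. f k \<in> cball c B"
  shows "\<exists>l. (f \<longlongrightarrow> l) \<omega>"
proof -
  have "filtermap f \<omega> \<noteq> bot" "eventually (\<lambda>x. x \<in> cball c B) (filtermap f \<omega>)"
    using nontrivial_ultrafilterD(1)[OF \<omega>] b by (auto simp: filtermap_bot_iff eventually_filtermap)
  then obtain l where l: "inf (nhds l) (filtermap f \<omega>) \<noteq> bot"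
    using compact_cball[of c B] unfolding compact_filter by blast
  have "(f \<longlongrightarrow> l) \<omega>"
  proof (rule topological_tendstoI)
    fix S assume S: "open S" "l \<in> S"
    show "eventually (\<lambda>x. f x \<in> S) \<omega>"
    proof (rule ccontr)
      assume "\<not> ?thesis"
      then have "eventually (\<lambda>y. y \<notin> S) (filtermap f \<omega>)"
        using nontrivial_ultrafilterD(2)[OF \<omega>] by (auto simp: eventually_filtermap)
      moreover have "eventually (\<lambda>y. y \<in> S) (nhds l)" using S eventually_nhds by blast
      ultimately have "eventually (\<lambda>_. False) (inf (nhds l) (filtermap f \<omega>))"
        unfolding eventually_inf by blast
      then show False using l by (simp add: eventually_False)
    qed
  qed
  then show ?thesis by blast
qed

lemma complex_tendsto_le:
  fixes f g :: "'b \<Rightarrow> complex"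
  assumes "F \<noteq> bot" "(f \<longlongrightarrow> l) F" "(g \<longlongrightarrow> m) F" "\<And>k. f k \<le> g k"
  shows "l \<le> m"
proof -
  have "Re l \<le> Re m"
    using assms by (intro tendsto_le[OF assms(1) tendsto_Re tendsto_Re]) (auto simp: less_eq_complex_def)
  moreover have "Im l = Im m"
  proof (rule tendsto_unique[OF assms(1) tendsto_Im[OF assms(2)]])
    have "Im (f k) = Im (g k)" for k using assms(4)[of k] by (simp add: less_eq_complex_def)
    then show "((\<lambda>k. Im (f k)) \<longlongrightarrow> Im m) F" using tendsto_Im[OF assms(3)] by simp
  qed
  ultimately show ?thesis by (simp add: less_eq_complex_def)
qed

text \<open>Every condition is a closed relation among finitely many values, hence passes to
  pointwise limits. Together with \<open>cmod_le\<close> this is the compactness of the set of trace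
  states.\<close>

lemma trace_states_limit:
  assumes F: "F \<noteq> bot" and \<sigma>: "\<And>k. \<sigma> k \<in> trace_states R"
    and lim: "\<And>p. ((\<lambda>k. \<sigma> k p) \<longlongrightarrow> s p) F"
  shows "s \<in> trace_states R"
proof -
  have D: "\<sigma> k (p + q) = \<sigma> k p + \<sigma> k q" "\<sigma> k (nc_const c * p) = c * \<sigma> k p"
      "\<sigma> k (nc_star p) = cnj (\<sigma> k p)" "0 \<le> \<sigma> k (nc_star p * p)" "\<sigma> k (p * q) = \<sigma> k (q * p)"
      "\<sigma> k 1 = 1" "\<sigma> k (nc_var i ^ (2 * m)) \<le> complex_of_real (R ^ (2 * m))" for k p q c i m
    using \<sigma>[of k] unfolding trace_states_def by blast+
  note u = tendsto_unique[OF F lim]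
  have "s (p + q) = s p + s q" for p q
    by (rule u) (unfold D(1), intro tendsto_add lim)
  moreover have "s (nc_const c * p) = c * s p" for c p
    by (rule u) (unfold D(2), intro tendsto_mult_left lim)
  moreover have "s (nc_star p) = cnj (s p)" for p
    by (rule u) (unfold D(3), intro tendsto_cnj lim)
  moreover have "s (p * q) = s (q * p)" for p q
    by (rule u) (subst D(5), rule lim)
  moreover have "s 1 = 1"
    by (rule u) (unfold D(6), rule tendsto_const)
  moreover have "0 \<le> s (nc_star p * p)" for p
    by (rule complex_tendsto_le[OF F tendsto_const lim D(4)])
  moreover have "s (nc_var i ^ (2 * m)) \<le> complex_of_real (R ^ (2 * m))" for i m
    by (rule complex_tendsto_le[OF F lim tendsto_const D(7)])
  ultimately show ?thesis unfolding trace_states_def by blast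
qed

subsection \<open>Concentration at an extreme state\<close>

lemma prob_space_real_density:
  assumes "prob_space \<mu>" "integrable \<mu> h" "\<And>x. h x \<ge> 0" "(\<integral>x. h x \<partial>\<mu>) = 1"
  shows "prob_space (density \<mu> (\<lambda>x. ennreal (h x)))"
proof
  have "(\<integral>\<^sup>+x. ennreal (h x) \<partial>\<mu>) = ennreal (\<integral>x. h x \<partial>\<mu>)"
    by (rule nn_integral_eq_integral) (use assms in auto)
  then show "emeasure (density \<mu> (\<lambda>x. ennreal (h x))) (space (density \<mu> (\<lambda>x. ennreal (h x)))) = 1"
    using assms by (simp add: emeasure_density borel_measurable_integrable cong: nn_integral_cong)
qed

text \<open>The part split off is \<open>\<mu>\<close> conditioned on \<open>A\<close>, with density
  \<open>g\<close>, and the rest has density \<open>h\<close>. The weight is \<open>t\<close> rather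
  than the mass of \<open>A\<close>: as that mass is at least \<open>t\<close>, one has
  \<open>t * g \<le> 1\<close> and \<open>h\<close> is nonnegative. A prescribed weight is what lets
  the decompositions for varying \<open>\<mu>\<close> and \<open>N\<close> converge.\<close>

lemma measure_state_split:
  fixes \<mu> :: "('n::finite \<Rightarrow> complex mat) measure"
  assumes \<mu>: "prob_space \<mu>" "sets \<mu> = sets (tuple_lebesgue N R)" and NR: "N > 0" "R > 0"
    and A: "A \<in> sets \<mu>" "t \<le> measure \<mu> A" and t: "0 < t" "t < 1"
    and far: "cmod \<theta> = 1" "\<And>M. M \<in> A \<Longrightarrow> Re (\<theta> * (matrix_state N M p\<^sub>0 - c)) \<ge> e"
  shows "\<exists>\<sigma>\<in>trace_states R. \<exists>\<rho>\<in>trace_states R.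
    (\<forall>p. measure_state N \<mu> p = of_real t * \<sigma> p + of_real (1 - t) * \<rho> p) \<and> cmod (\<sigma> p\<^sub>0 - c) \<ge> e"
proof -
  interpret prob_space \<mu> by fact
  define a where "a = measure \<mu> A"
  have a: "a > 0" "t \<le> a" using A t by (auto simp: a_def)
  define g where "g x = indicator A x / a" for x :: "'n \<Rightarrow> complex mat"
  define h where "h x = (1 - t * g x) / (1 - t)" for x :: "'n \<Rightarrow> complex mat"
  have int_g: "integrable \<mu> g" and int_h: "integrable \<mu> h"
    unfolding h_def g_def using A by (auto intro!: integrable_real_indicator simp: emeasure_eq_measure)
  have g_nn: "g x \<ge> 0" for x using a by (simp add: g_def)
  have tg: "t * g x \<le> 1" for x using a by (simp add: g_def indicator_def)
  have h_nn: "h x \<ge> 0" for x using tg[of x] t by (simp add: h_def)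
  have Ig: "(\<integral>x. g x \<partial>\<mu>) = 1" using A(1) a by (simp add: g_def a_def)
  have Ih: "(\<integral>x. h x \<partial>\<mu>) = 1" using int_g Ig t by (simp add: h_def prob_space)
  define \<nu>g where "\<nu>g = density \<mu> (\<lambda>x. ennreal (g x))"
  define \<nu>h where "\<nu>h = density \<mu> (\<lambda>x. ennreal (h x))"
  have pg: "prob_space \<nu>g" "sets \<nu>g = sets (tuple_lebesgue N R)"
    and ph: "prob_space \<nu>h" "sets \<nu>h = sets (tuple_lebesgue N R)"
    unfolding \<nu>g_def \<nu>h_def using prob_space_real_density[OF \<mu>(1)] int_g int_h g_nn h_nn Ig Ih \<mu>(2) by auto
  have m: "(\<lambda>M. matrix_state N M p) \<in> borel_measurable \<mu>" for p
    using matrix_state_measurable measurable_cong_sets[OF \<mu>(2) refl] by blast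
  have mg: "g \<in> borel_measurable \<mu>" "h \<in> borel_measurable \<mu>"
    using int_g int_h by (simp_all add: borel_measurable_integrable)
  have sg: "measure_state N \<nu>g p = (\<integral>M. g M *\<^sub>R matrix_state N M p \<partial>\<mu>)" for p
    unfolding measure_state_def \<nu>g_def by (rule integral_density[OF m mg(1)]) (simp add: g_nn)
  have sh: "measure_state N \<nu>h p = (\<integral>M. h M *\<^sub>R matrix_state N M p \<partial>\<mu>)" for p
    unfolding measure_state_def \<nu>h_def by (rule integral_density[OF m mg(2)]) (simp add: h_nn)
  have fin: "finite_measure \<nu>g" "finite_measure \<nu>h"
    using pg(1) ph(1) by (simp_all add: prob_space_def)
  have ig: "integrable \<mu> (\<lambda>M. g M *\<^sub>R matrix_state N M p)" for p
    using matrix_state_integrable[OF fin(1) pg(2) NR, of p] integrable_density[OF m mg(1)]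
    by (simp add: \<nu>g_def g_nn)
  have ih: "integrable \<mu> (\<lambda>M. h M *\<^sub>R matrix_state N M p)" for p
    using matrix_state_integrable[OF fin(2) ph(2) NR, of p] integrable_density[OF m mg(2)]
    by (simp add: \<nu>h_def h_nn)
  have decomp: "measure_state N \<mu> p
      = of_real t * measure_state N \<nu>g p + of_real (1 - t) * measure_state N \<nu>h p" for p
  proof -
    have "measure_state N \<mu> p = (\<integral>M. of_real t * (g M *\<^sub>R matrix_state N M p)
        + of_real (1 - t) * (h M *\<^sub>R matrix_state N M p) \<partial>\<mu>)"
      unfolding measure_state_def
    proof (rule Bochner_Integration.integral_cong[OF refl])
      fix M
      have "t * g M + (1 - t) * h M = 1" using t by (simp add: h_def)
      then have "complex_of_real (t * g M + (1 - t) * h M) = 1" by (simp only: of_real_1)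
      then have "complex_of_real t * of_real (g M) + of_real (1 - t) * of_real (h M) = 1"
        unfolding of_real_add of_real_mult .
      then have "matrix_state N M p
          = (of_real t * of_real (g M) + of_real (1 - t) * of_real (h M)) * matrix_state N M p"
        by simp
      then show "matrix_state N M p = of_real t * (g M *\<^sub>R matrix_state N M p)
          + of_real (1 - t) * (h M *\<^sub>R matrix_state N M p)"
        unfolding scaleR_conv_of_real distrib_right mult.assoc .
    qed
    also have "\<dots> = of_real t * measure_state N \<nu>g p + of_real (1 - t) * measure_state N \<nu>h p"
      unfolding sg sh integral_mult_right_zero[symmetric]
      by (intro Bochner_Integration.integral_add integrable_mult_right ig ih)
    finally show ?thesis .
  qed
  \<comment> \<open>All deviations on \<open>A\<close> have real part at least \<open>e\<close> in
    the one direction \<open>\<theta>\<close>, so averaging over \<open>A\<close> cannot cancel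
    them.\<close>
  have "e \<le> (\<integral>M. g M * e \<partial>\<mu>)" using Ig by simp
  also have "\<dots> \<le> (\<integral>M. Re (\<theta> * (g M *\<^sub>R matrix_state N M p\<^sub>0 - g M *\<^sub>R c)) \<partial>\<mu>)"
  proof (rule integral_mono)
    show "integrable \<mu> (\<lambda>M. g M * e)" using int_g by simp
    show "integrable \<mu> (\<lambda>M. Re (\<theta> * (g M *\<^sub>R matrix_state N M p\<^sub>0 - g M *\<^sub>R c)))"
      using ig[of p\<^sub>0] int_g by (intro integrable_Re integrable_mult_right integrable_diff) auto
    fix M
    have "\<theta> * (g M *\<^sub>R matrix_state N M p\<^sub>0 - g M *\<^sub>R c)
        = g M *\<^sub>R (\<theta> * (matrix_state N M p\<^sub>0 - c))"
      unfolding scaleR_diff_right[symmetric] mult_scaleR_right ..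
    then have "Re (\<theta> * (g M *\<^sub>R matrix_state N M p\<^sub>0 - g M *\<^sub>R c))
        = g M * Re (\<theta> * (matrix_state N M p\<^sub>0 - c))"
      by (simp only: scaleR_complex.sel)
    moreover have "g M * e \<le> g M * Re (\<theta> * (matrix_state N M p\<^sub>0 - c))"
      using far(2)[of M] a by (cases "M \<in> A") (auto simp: g_def divide_right_mono)
    ultimately show "g M * e \<le> Re (\<theta> * (g M *\<^sub>R matrix_state N M p\<^sub>0 - g M *\<^sub>R c))" by simp
  qed
  also have "\<dots> = Re (\<theta> * (measure_state N \<nu>g p\<^sub>0 - c))"
  proof -
    have "(\<integral>M. \<theta> * (g M *\<^sub>R matrix_state N M p\<^sub>0 - g M *\<^sub>R c) \<partial>\<mu>) = \<theta> * (measure_state N \<nu>g p\<^sub>0 - c)"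
      using ig[of p\<^sub>0] int_g Ig by (simp add: sg)
    moreover have "integrable \<mu> (\<lambda>M. \<theta> * (g M *\<^sub>R matrix_state N M p\<^sub>0 - g M *\<^sub>R c))"
      using ig[of p\<^sub>0] int_g by (intro integrable_mult_right integrable_diff) auto
    ultimately show ?thesis by (simp only: integral_Re)
  qed
  also have "\<dots> \<le> cmod (measure_state N \<nu>g p\<^sub>0 - c)"
    using complex_Re_le_cmod[of "\<theta> * (measure_state N \<nu>g p\<^sub>0 - c)"] far(1) by (simp add: norm_mult)
  finally show ?thesis
    using decomp measure_state_trace_state[OF pg NR] measure_state_trace_state[OF ph NR] by blast
qed

text \<open>The threshold \<open>t\<close> depends only on \<open>K'\<close>, \<open>\<delta>\<close> and the number of variables: some word of length
  below \<open>K'\<close> and one of the four directions \<open>\<plusminus>1, \<plusminus>\<i>\<close> see a definite fraction of the mass outside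
  the microstates.\<close>

lemma measure_state_split_far:
  fixes \<tau> :: "'n::finite ncpoly \<Rightarrow> complex"
  assumes "R > 0" "\<epsilon>' > 0" "\<delta> > 0"
  shows "\<exists>t. 0 < t \<and> t < 1 \<and> (\<forall>N \<mu>. N > 0 \<longrightarrow> prob_space \<mu> \<longrightarrow> sets \<mu> = sets (tuple_lebesgue N R) \<longrightarrow>
    measure \<mu> (microstates R \<epsilon>' K' N \<tau>) < 1 - \<delta> \<longrightarrow>
    (\<exists>\<sigma>\<in>trace_states R. \<exists>\<rho>\<in>trace_states R.
      (\<forall>p. measure_state N \<mu> p = of_real t * \<sigma> p + of_real (1 - t) * \<rho> p) \<and>
      (\<exists>w. length w < K' \<and> cmod (\<sigma> (nc_monom w) - \<tau> (nc_monom w)) \<ge> \<epsilon>' / 2)))"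
proof -
  define W where "W = {w :: 'n list. length w < K'} \<times> {1, -1, \<i>, -\<i> :: complex}"
  have "finite {w :: 'n list. length w < K'}"
    using finite_lists_length_le[of UNIV K'] by (rule finite_subset[rotated]) auto
  then have finW: "finite W" by (simp add: W_def)
  \<comment> \<open>Adding 1 to the cardinality avoids division by 0 when \<open>W\<close> is empty,
    which happens for \<open>K' = 0\<close>; the minimum with 1/2 keeps \<open>t\<close> below
    1.\<close>
  define t where "t = min (\<delta> / real (card W + 1)) (1 / 2)"
  have t: "0 < t" "t < 1" using assms by (auto simp: t_def)
  have main: "\<exists>\<sigma>\<in>trace_states R. \<exists>\<rho>\<in>trace_states R.
      (\<forall>p. measure_state N \<mu> p = of_real t * \<sigma> p + of_real (1 - t) * \<rho> p) \<and>
      (\<exists>w. length w < K' \<and> cmod (\<sigma> (nc_monom w) - \<tau> (nc_monom w)) \<ge> \<epsilon>' / 2)"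
    if N: "N > 0" and \<mu>: "prob_space \<mu>" "sets \<mu> = sets (tuple_lebesgue N R)"
      and small: "measure \<mu> (microstates R \<epsilon>' K' N \<tau>) < 1 - \<delta>"
    for N and \<mu> :: "('n \<Rightarrow> complex mat) measure"
  proof -
    interpret prob_space \<mu> by fact
    have sp: "space \<mu> = tuple_ball N R" using sets_eq_imp_space_eq[OF \<mu>(2)] by simp
    define A where "A = (\<lambda>(w, \<theta>). {M \<in> space \<mu>.
      Re (\<theta> * (matrix_state N M (nc_monom w) - \<tau> (nc_monom w))) \<ge> \<epsilon>' / 2})"
    have A_sets: "A x \<in> sets \<mu>" for x
    proof -
      obtain w \<theta> where x: "x = (w, \<theta>)" by fastforce
      have [measurable]: "(\<lambda>M. matrix_state N M (nc_monom w)) \<in> borel_measurable \<mu>"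
        using matrix_state_measurable measurable_cong_sets[OF \<mu>(2) refl] by blast
      show ?thesis unfolding A_def x by simp
    qed
    let ?\<Gamma> = "microstates R \<epsilon>' K' N \<tau>"
    have \<Gamma>: "?\<Gamma> \<in> sets \<mu>" using microstates_sets[OF N assms(1)] \<mu>(2) by blast
    have "space \<mu> - ?\<Gamma> \<subseteq> (\<Union>x\<in>W. A x)"
    proof
      fix M assume M: "M \<in> space \<mu> - ?\<Gamma>"
      then have "M \<in> tuple_ball N R" using sp by simp
      then obtain w where w: "length w < K'"
        "\<epsilon>' \<le> cmod (\<tau> (nc_monom w) - matrix_state N M (nc_monom w))"
        using M matrix_state_trace_state[OF _ N assms(1)]
        by (auto simp: microstates_def state_nbhd_def not_less)
      define z where "z = matrix_state N M (nc_monom w) - \<tau> (nc_monom w)"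
      \<comment> \<open>The modulus is at most the sum of the absolute real and imaginary parts, so
        one of them is at least \<open>\<epsilon>' / 2\<close>: the origin of the halved
        distance.\<close>
      have "\<epsilon>' \<le> \<bar>Re z\<bar> + \<bar>Im z\<bar>"
        using w(2) cmod_le[of z] by (simp add: z_def norm_minus_commute)
      then have "Re (1 * z) \<ge> \<epsilon>' / 2 \<or> Re (-1 * z) \<ge> \<epsilon>' / 2 \<or> Re (\<i> * z) \<ge> \<epsilon>' / 2 \<or> Re (-\<i> * z) \<ge> \<epsilon>' / 2"
        by (auto simp: abs_if split: if_splits)
      then show "M \<in> (\<Union>x\<in>W. A x)"
        using M w(1) unfolding z_def W_def A_def by auto
    qed
    then have "measure \<mu> (space \<mu> - ?\<Gamma>) \<le> measure \<mu> (\<Union>x\<in>W. A x)"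
      using A_sets finW by (intro finite_measure_mono) auto
    also have "\<dots> \<le> (\<Sum>x\<in>W. measure \<mu> (A x))"
      using A_sets finW by (intro measure_UNION_le) auto
    finally have sum: "\<delta> < (\<Sum>x\<in>W. measure \<mu> (A x))"
      using small prob_compl[OF \<Gamma>] by simp
    have "\<exists>x\<in>W. t \<le> measure \<mu> (A x)"
    proof (rule ccontr)
      assume "\<not> ?thesis"
      then have "measure \<mu> (A x) < t" if "x \<in> W" for x using that by (meson not_le)
      moreover have "t \<le> \<delta> / real (card W + 1)" by (simp add: t_def)
      ultimately have "measure \<mu> (A x) \<le> \<delta> / real (card W + 1)" if "x \<in> W" for x
        using that by (meson less_imp_le order_trans)
      then have "(\<Sum>x\<in>W. measure \<mu> (A x)) \<le> (\<Sum>x\<in>W. \<delta> / real (card W + 1))"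
        by (rule sum_mono)
      also have "\<dots> \<le> \<delta>" using assms(3) by (simp add: field_simps)
      finally show False using sum by simp
    qed
    then obtain w \<theta> where w: "(w, \<theta>) \<in> W" "t \<le> measure \<mu> (A (w, \<theta>))" by auto
    then have "cmod \<theta> = 1" by (auto simp: W_def)
    then have "\<exists>\<sigma>\<in>trace_states R. \<exists>\<rho>\<in>trace_states R.
        (\<forall>p. measure_state N \<mu> p = of_real t * \<sigma> p + of_real (1 - t) * \<rho> p) \<and>
        cmod (\<sigma> (nc_monom w) - \<tau> (nc_monom w)) \<ge> \<epsilon>' / 2"
      by (rule measure_state_split[OF \<mu> N assms(1) A_sets w(2) t]) (simp add: A_def)
    moreover have "length w < K'" using w(1) by (simp add: W_def)
    ultimately show ?thesis by blast
  qed
  show ?thesis using t main by blast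
qed

text \<open>Compactness: otherwise splitting off the far part of a sequence of counterexamples and passing
  to the limit along \<open>\<omega>\<close> would write \<open>\<tau>\<close> as a nontrivial convex combination.\<close>

lemma extreme_state_concentration:
  fixes \<tau> :: "'n::finite ncpoly \<Rightarrow> complex"
  assumes \<omega>: "nontrivial_ultrafilter \<omega>" and "R > 0" and ext: "extreme_trace_state R \<tau>"
    and "\<epsilon>' > 0" "\<delta> > 0"
  shows "\<exists>K. \<exists>\<epsilon>>0. \<forall>N \<mu>. N > 0 \<longrightarrow> prob_space \<mu> \<longrightarrow> sets \<mu> = sets (tuple_lebesgue N R) \<longrightarrow>
    measure_state N \<mu> \<in> state_nbhd R \<epsilon> K \<tau> \<longrightarrow> measure \<mu> (microstates R \<epsilon>' K' N \<tau>) \<ge> 1 - \<delta>"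
proof (rule ccontr)
  assume no: "\<not> ?thesis"
  define Q where "Q K \<epsilon> \<longleftrightarrow> (\<forall>N \<mu>. N > 0 \<longrightarrow> prob_space \<mu> \<longrightarrow> sets \<mu> = sets (tuple_lebesgue N R) \<longrightarrow>
    measure_state N \<mu> \<in> state_nbhd R \<epsilon> K \<tau> \<longrightarrow> measure \<mu> (microstates R \<epsilon>' K' N \<tau>) \<ge> 1 - \<delta>)"
    for K \<epsilon>
  have "\<not> (\<exists>K. \<exists>\<epsilon>>0. Q K \<epsilon>)" using no unfolding Q_def .
  then have not_Q: "\<not> Q K \<epsilon>" if "\<epsilon> > 0" for K \<epsilon> using that by blast
  have no': "\<exists>N \<mu>. N > 0 \<and> prob_space \<mu> \<and> sets \<mu> = sets (tuple_lebesgue N R) \<and>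
      measure_state N \<mu> \<in> state_nbhd R \<epsilon> K \<tau> \<and> measure \<mu> (microstates R \<epsilon>' K' N \<tau>) < 1 - \<delta>"
    if "\<epsilon> > 0" for \<epsilon> K
    using not_Q[OF that, of K] unfolding Q_def not_all not_imp not_le .
  obtain t where t: "0 < t" "t < 1" and split: "\<And>N \<mu>. N > 0 \<Longrightarrow> prob_space \<mu> \<Longrightarrow>
    sets \<mu> = sets (tuple_lebesgue N R) \<Longrightarrow> measure \<mu> (microstates R \<epsilon>' K' N \<tau>) < 1 - \<delta> \<Longrightarrow>
    \<exists>\<sigma>\<in>trace_states R. \<exists>\<rho>\<in>trace_states R.
      (\<forall>p. measure_state N \<mu> p = of_real t * \<sigma> p + of_real (1 - t) * \<rho> p) \<and>
      (\<exists>w. length w < K' \<and> cmod (\<sigma> (nc_monom w) - \<tau> (nc_monom w)) \<ge> \<epsilon>' / 2)"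
    using measure_state_split_far[OF assms(2,4,5), of K' \<tau>] by blast
  define P where "P k s \<sigma> \<rho> \<longleftrightarrow> s \<in> state_nbhd R (1 / real (Suc k)) k \<tau> \<and>
      \<sigma> \<in> trace_states R \<and> \<rho> \<in> trace_states R \<and>
      (\<forall>p. s p = of_real t * \<sigma> p + of_real (1 - t) * \<rho> p) \<and>
      (\<exists>w. length w < K' \<and> cmod (\<sigma> (nc_monom w) - \<tau> (nc_monom w)) \<ge> \<epsilon>' / 2)" for k s \<sigma> \<rho>
  \<comment> \<open>The counterexample for \<open>K = k\<close> and
    \<open>\<epsilon> = 1 / real (Suc k)\<close>. From here on \<open>N\<close> and
    \<open>\<mu>\<close> are forgotten and only the three states are kept.\<close>
  have ex: "\<exists>s \<sigma> \<rho>. P k s \<sigma> \<rho>" for k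
  proof -
    have "1 / real (Suc k) > 0" by simp
    then obtain N and \<mu> :: "('n \<Rightarrow> complex mat) measure" where N: "N > 0" and \<mu>: "prob_space \<mu>"
        "sets \<mu> = sets (tuple_lebesgue N R)" "measure_state N \<mu> \<in> state_nbhd R (1 / real (Suc k)) k \<tau>"
        "measure \<mu> (microstates R \<epsilon>' K' N \<tau>) < 1 - \<delta>"
      using no' by blast
    show ?thesis unfolding P_def using split[OF N \<mu>(1,2,4)] \<mu>(3) by blast
  qed
  obtain s \<sigma> \<rho> where "\<And>k. P k (s k) (\<sigma> k) (\<rho> k)"
    using ex by metis
  then have s: "\<And>k. s k \<in> state_nbhd R (1 / real (Suc k)) k \<tau>"
    and \<sigma>: "\<And>k. \<sigma> k \<in> trace_states R" and \<rho>: "\<And>k. \<rho> k \<in> trace_states R"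
    and eq: "\<And>k p. s k p = of_real t * \<sigma> k p + of_real (1 - t) * \<rho> k p"
    and far: "\<And>k. \<exists>w. length w < K' \<and> cmod (\<sigma> k (nc_monom w) - \<tau> (nc_monom w)) \<ge> \<epsilon>' / 2"
    unfolding P_def by blast+
  have bot: "\<omega> \<noteq> bot" and le: "\<omega> \<le> sequentially" using nontrivial_ultrafilterD[OF \<omega>] by auto
  have \<tau>: "\<tau> \<in> trace_states R" using ext by (simp add: extreme_trace_state_def)
  have conv: "\<exists>l. ((\<lambda>k. f k p) \<longlongrightarrow> l) \<omega>" if f: "\<And>k. f k \<in> trace_states R"
    for f :: "nat \<Rightarrow> 'n ncpoly \<Rightarrow> complex" and p
  proof (rule ultrafilter_limit_bounded[OF \<omega>])
    show "f k p \<in> cball 0 (\<Sum>w\<in>Poly_Mapping.keys p. cmod (Poly_Mapping.lookup p w) * R ^ length w)" for k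
    proof -
      interpret trace_state R "f k" by unfold_locales (use f assms(2) in auto)
      show ?thesis using cmod_le[of p] by simp
    qed
  qed
  have "\<forall>p. \<exists>l. ((\<lambda>k. \<sigma> k p) \<longlongrightarrow> l) \<omega>" by (intro allI conv \<sigma>)
  from choice[OF this] obtain \<sigma>' where \<sigma>': "\<And>p. ((\<lambda>k. \<sigma> k p) \<longlongrightarrow> \<sigma>' p) \<omega>" by blast
  have "\<forall>p. \<exists>l. ((\<lambda>k. \<rho> k p) \<longlongrightarrow> l) \<omega>" by (intro allI conv \<rho>)
  from choice[OF this] obtain \<rho>' where \<rho>': "\<And>p. ((\<lambda>k. \<rho> k p) \<longlongrightarrow> \<rho>' p) \<omega>" by blast
  have states: "\<sigma>' \<in> trace_states R" "\<rho>' \<in> trace_states R"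
    using trace_states_limit[OF bot \<sigma> \<sigma>'] trace_states_limit[OF bot \<rho> \<rho>'] by auto
  have s_lim: "((\<lambda>k. s k p) \<longlongrightarrow> of_real t * \<sigma>' p + of_real (1 - t) * \<rho>' p) \<omega>" for p
    unfolding eq by (intro tendsto_add tendsto_mult_left \<sigma>' \<rho>')
  have s_monom: "((\<lambda>k. s k (nc_monom w)) \<longlongrightarrow> \<tau> (nc_monom w)) \<omega>" for w
  proof (rule tendsto_mono[OF le], rule metric_LIMSEQ_I)
    fix e :: real assume "e > 0"
    then obtain k0 where k0: "inverse (real (Suc k0)) < e" using reals_Archimedean by blast
    \<comment> \<open>Neighbourhoods test words of length strictly below \<open>k\<close>, hence the
      threshold \<open>Suc (length w)\<close>.\<close>
    have "dist (s k (nc_monom w)) (\<tau> (nc_monom w)) < e" if "k \<ge> max k0 (Suc (length w))" for k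
    proof -
      have "cmod (\<tau> (nc_monom w) - s k (nc_monom w)) < 1 / real (Suc k)"
        using s[of k] that by (simp add: state_nbhd_def)
      also have "\<dots> \<le> inverse (real (Suc k0))" using that by (simp add: field_simps)
      finally show ?thesis using k0 by (simp add: dist_norm norm_minus_commute)
    qed
    then show "\<exists>k0. \<forall>k\<ge>k0. dist (s k (nc_monom w)) (\<tau> (nc_monom w)) < e" by blast
  qed
  have monom_eq: "of_real t * \<sigma>' (nc_monom w) + of_real (1 - t) * \<rho>' (nc_monom w) = \<tau> (nc_monom w)" for w
    by (rule tendsto_unique[OF bot s_lim s_monom])
  interpret T: trace_state R \<tau> by unfold_locales (use \<tau> assms(2) in auto)
  interpret S: trace_state R \<sigma>' by unfold_locales (use states assms(2) in auto)
  interpret Q: trace_state R \<rho>' by unfold_locales (use states assms(2) in auto)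
  \<comment> \<open>The neighbourhoods control words only; linearity extends the identity to all
    polynomials.\<close>
  have "\<tau> p = of_real t * \<sigma>' p + of_real (1 - t) * \<rho>' p" for p
    unfolding T.eq_lin_ext[of p] S.eq_lin_ext[of p] Q.eq_lin_ext[of p] monom_eq[symmetric] lin_ext_def
    by (simp add: sum_distrib_left sum.distrib distrib_left mult.left_commute)
  then have \<tau>_eq: "\<tau> = (\<lambda>p. of_real t * \<sigma>' p + of_real (1 - t) * \<rho>' p)" by blast
  have "\<sigma>\<^sub>1 = \<sigma>\<^sub>2" if "\<sigma>\<^sub>1 \<in> trace_states R" "\<sigma>\<^sub>2 \<in> trace_states R"
      "\<tau> = (\<lambda>p. of_real t * \<sigma>\<^sub>1 p + of_real (1 - t) * \<sigma>\<^sub>2 p)" for \<sigma>\<^sub>1 \<sigma>\<^sub>2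
    using ext[unfolded extreme_trace_state_def, THEN conjunct2, rule_format, OF that(1,2) _ that(3)] t
    by blast
  from this[OF states \<tau>_eq] have "\<sigma>' = \<rho>'" .
  then have "\<tau> = \<sigma>'" unfolding \<tau>_eq by (simp add: distrib_right[symmetric])
  then have "((\<lambda>k. cmod (\<sigma> k (nc_monom w) - \<tau> (nc_monom w))) \<longlongrightarrow> 0) \<omega>" for w
    using tendsto_norm_zero[OF LIM_zero[OF \<sigma>'[of "nc_monom w"]]] by simp
  then have "eventually (\<lambda>k. cmod (\<sigma> k (nc_monom w) - \<tau> (nc_monom w)) < \<epsilon>' / 2) \<omega>" for w
    using order_tendstoD(2) assms(4) half_gt_zero by blast
  \<comment> \<open>The word at which \<open>\<sigma> k\<close> is far from \<open>\<tau>\<close>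
    may change with \<open>k\<close>. As finitely many words are in question, closeness holds at all
    of them for a common \<open>k\<close>, which is the contradiction.\<close>
  moreover have "finite {w :: 'n list. length w < K'}"
    using finite_lists_length_le[of UNIV K'] by (rule finite_subset[rotated]) auto
  ultimately have "eventually (\<lambda>k. \<forall>w\<in>{w. length w < K'}.
      cmod (\<sigma> k (nc_monom w) - \<tau> (nc_monom w)) < \<epsilon>' / 2) \<omega>"
    by (intro eventually_ball_finite) auto
  from eventually_happens'[OF bot this] show False using far by (auto simp: not_le[symmetric])
qed

subsection \<open>Entropy\<close>

text \<open>The bridge from volume to entropy. \<open>Ent\<close> uses a chosen version of the
  density, which agrees with the normalised indicator of \<open>A\<close> only almost everywhere, so
  all computations are made up to null sets.\<close>

lemma Ent_uniform_measure:
  assumes "finite_measure L" "A \<in> sets L" "measure L A > 0"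
  shows "Ent L (uniform_measure L A) = ereal (ln (measure L A))"
proof -
  interpret finite_measure L by fact
  define a where "a = measure L A"
  define f where "f x = ennreal (indicator A x / a)" for x
  have a: "a > 0" using assms(3) by (simp add: a_def)
  have f: "f \<in> borel_measurable L" unfolding f_def using assms(2) by measurable
  have eq: "density L f = uniform_measure L A"
    unfolding uniform_measure_def
  proof (rule density_cong)
    show "AE x in L. f x = indicator A x / emeasure L A"
      using a by (auto simp: f_def emeasure_eq_measure a_def[symmetric] indicator_def divide_ennreal
          simp flip: ennreal_1)
    show "(\<lambda>x. indicator A x / emeasure L A) \<in> borel_measurable L" using assms(2) by measurable
  qed (rule f)
  define F where "F x = enn2real (RN_deriv L (uniform_measure L A) x)" for x
  have F_meas: "F \<in> borel_measurable L" unfolding F_def by measurable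
  have F: "AE x in L. F x = indicator A x / a"
    using RN_deriv_unique[OF f eq]
  proof eventually_elim
    case (elim x)
    have "F x = enn2real (f x)" by (simp add: F_def elim)
    then show ?case using a by (simp add: f_def)
  qed
  have "prob_space (uniform_measure L A)"
    using assms(3) by (intro prob_space_uniform_measure) (auto simp: emeasure_eq_measure)
  then interpret U: prob_space "uniform_measure L A" .
  have "AE x in uniform_measure L A. ln (F x) = ln (1 / a)"
  proof (rule AE_uniform_measureI[OF assms(2)])
    show "AE x in L. x \<in> A \<longrightarrow> ln (F x) = ln (1 / a)"
      using F by eventually_elim auto
  qed
  moreover have "(\<lambda>x. ln (F x)) \<in> borel_measurable (uniform_measure L A)"
    using F_meas by simp
  ultimately have int: "integrable (uniform_measure L A) (\<lambda>x. ln (F x))"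
    by (subst integrable_cong_AE[where g = "\<lambda>_. ln (1 / a)"]) auto
  have "(\<integral>x. F x * ln (F x) \<partial>L) = (\<integral>x. indicator A x * (ln (1 / a) / a) \<partial>L)"
  proof (rule integral_cong_AE)
    show "AE x in L. F x * ln (F x) = indicator A x * (ln (1 / a) / a)"
      using F by eventually_elim (auto simp: indicator_def)
  qed (use F_meas assms(2) in measurable)
  also have "\<dots> = a * (ln (1 / a) / a)"
    using assms(2) sets.sets_into_space[OF assms(2)] by (simp add: a_def Int_absorb2)
  also have "\<dots> = - ln a" using a by (simp add: ln_div)
  finally have I: "(\<integral>x. F x * ln (F x) \<partial>L) = - ln a" .
  have "\<exists>g\<in>borel_measurable L. uniform_measure L A = density L g"
    using f eq by (intro bexI[of _ f]) auto
  then show ?thesis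
    using int I unfolding Ent_def Let_def F_def[symmetric] a_def by simp
qed

text \<open>Gibbs' inequality against the density that is constant on \<open>A\<close> and on its complement.\<close>

lemma Ent_le:
  assumes "finite_measure L" "prob_space \<mu>" "sets \<mu> = sets L" and A: "A \<in> sets L"
    and ab: "0 < a" "0 < b" "measure L A \<le> a" "measure L (space L) \<le> b"
  shows "Ent L \<mu> \<le> ereal (ln 2 + measure \<mu> A * ln a + (1 - measure \<mu> A) * ln b)"
proof (cases "(\<exists>g \<in> borel_measurable L. \<mu> = density L g) \<and>
    integrable \<mu> (\<lambda>x. ln (enn2real (RN_deriv L \<mu> x)))")
  case False
  then show ?thesis by (auto simp: Ent_def Let_def)
next
  case True
  interpret finite_measure L by fact
  interpret P: prob_space \<mu> by fact
  define f where "f x = enn2real (RN_deriv L \<mu> x)" for x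
  obtain g where g: "g \<in> borel_measurable L" "\<mu> = density L g" using True by blast
  have f_meas: "f \<in> borel_measurable L" unfolding f_def by measurable
  have f_nn: "f x \<ge> 0" for x by (simp add: f_def)
  have dens: "density L (RN_deriv L \<mu>) = \<mu>"
    using density_RN_deriv_density[OF g(1)] g(2) by simp
  have RN_meas: "RN_deriv L \<mu> \<in> borel_measurable L" by measurable
  \<comment> \<open>\<open>enn2real\<close> sends an infinite value to 0 and would lose mass there.
    Since the density has integral 1 it is almost everywhere finite, so \<open>f\<close> still
    represents \<open>\<mu>\<close>.\<close>
  have "(\<integral>\<^sup>+x. RN_deriv L \<mu> x \<partial>L) = (\<integral>\<^sup>+x. RN_deriv L \<mu> x * indicator (space L) x \<partial>L)"
    by (intro nn_integral_cong) simp
  also have "\<dots> = emeasure \<mu> (space \<mu>)"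
    using emeasure_density[OF RN_meas sets.top] unfolding dens sets_eq_imp_space_eq[OF assms(3)] ..
  finally have "(\<integral>\<^sup>+x. RN_deriv L \<mu> x \<partial>L) \<noteq> \<infinity>" by (simp add: P.emeasure_space_1)
  then have fin: "AE x in L. RN_deriv L \<mu> x \<noteq> \<infinity>" by (intro nn_integral_noteq_infinite RN_meas)
  have "density L (\<lambda>x. ennreal (f x)) = density L (RN_deriv L \<mu>)"
  proof (rule density_cong)
    show "AE x in L. ennreal (f x) = RN_deriv L \<mu> x"
      using fin by eventually_elim (simp add: f_def less_top)
  qed (use f_meas RN_meas in measurable)
  then have \<mu>: "\<mu> = density L (\<lambda>x. ennreal (f x))" unfolding dens ..
  have int1: "integrable \<mu> (\<lambda>_. 1 :: real)" by simp
  have int_f: "integrable L f"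
    using int1 integrable_density[of "\<lambda>_. 1 :: real" L f] f_meas f_nn by (simp add: \<mu>)
  have If: "(\<integral>x. f x \<partial>L) = 1"
    using integral_density[of "\<lambda>_. 1 :: real" L f] f_meas f_nn P.prob_space by (simp add: \<mu>[symmetric])
  have ln_meas: "(\<lambda>x. ln (f x)) \<in> borel_measurable L" using f_meas by simp
  have int_fln: "integrable L (\<lambda>x. f x * ln (f x))"
    using True integrable_density[OF ln_meas f_meas] f_nn by (simp add: f_def[symmetric] \<mu>[symmetric])
  have IA: "(\<integral>x. f x * indicator A x \<partial>L) = measure \<mu> A"
    using integral_density[of "indicator A :: _ \<Rightarrow> real" L f] f_meas f_nn A sets.sets_into_space[OF A]
      sets_eq_imp_space_eq[OF assms(3)]
    by (simp add: \<mu>[symmetric] Int_absorb2)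
  have int_fA: "integrable L (\<lambda>x. f x * indicator A x)"
    using integrable_mult_indicator[OF A int_f] by (simp add: mult.commute)
  \<comment> \<open>The two pieces receive mass at most 1/2 each, since \<open>a\<close> bounds the
    volume of \<open>A\<close> and \<open>b\<close> that of the whole space; the factor 2 costs the
    summand \<open>ln 2\<close>. Taking \<open>a\<close> as a bound rather than the volume itself
    leaves room for sets \<open>A\<close> of volume 0.\<close>
  define \<gamma> where "\<gamma> x = (if x \<in> A then 1 / (2 * a) else 1 / (2 * b))" for x
  have \<gamma>_pos: "\<gamma> x > 0" for x using ab by (simp add: \<gamma>_def)
  have \<gamma>_eq: "\<gamma> x = indicator A x / (2 * a) + (1 - indicator A x) / (2 * b)" for x
    by (simp add: \<gamma>_def)
  have ln_\<gamma>: "ln (\<gamma> x) = - ln 2 - indicator A x * ln a - (1 - indicator A x) * ln b" for x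
    using ab by (simp add: \<gamma>_def ln_div ln_mult)
  have int_\<gamma>: "integrable L \<gamma>"
    unfolding \<gamma>_eq using A by (auto intro!: integrable_real_indicator simp: emeasure_eq_measure)
  have I\<gamma>: "(\<integral>x. \<gamma> x \<partial>L) \<le> 1"
  proof -
    have iA: "integrable L (indicator A :: _ \<Rightarrow> real)"
      using A by (auto intro!: integrable_real_indicator simp: emeasure_eq_measure)
    have "(\<integral>x. \<gamma> x \<partial>L) = measure L A / (2 * a) + (measure L (space L) - measure L A) / (2 * b)"
      unfolding \<gamma>_eq using iA sets.sets_into_space[OF A] by (simp add: Int_absorb2)
    also have "\<dots> \<le> a / (2 * a) + b / (2 * b)"
    proof (intro add_mono divide_right_mono)
      show "measure L (space L) - measure L A \<le> b" using ab(4) measure_nonneg[of L A] by linarith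
    qed (use ab in auto)
    also have "\<dots> = 1" using ab by simp
    finally show ?thesis .
  qed
  have eq: "f x * ln (\<gamma> x) = - ln 2 * f x - ln a * (f x * indicator A x)
      - ln b * (f x - f x * indicator A x)" for x
    by (simp add: ln_\<gamma> algebra_simps)
  have int_f\<gamma>: "integrable L (\<lambda>x. f x * ln (\<gamma> x))"
    unfolding eq using int_f int_fA by auto
  have If\<gamma>: "(\<integral>x. f x * ln (\<gamma> x) \<partial>L)
      = - ln 2 - ln a * measure \<mu> A - ln b * (1 - measure \<mu> A)"
    unfolding eq using int_f int_fA by (simp add: If IA)
  \<comment> \<open>This is \<open>ln y \<le> y - 1\<close> at \<open>y = \<gamma> x / f x\<close>,
    multiplied by \<open>f x\<close>; where \<open>f x = 0\<close> the left side vanishes.\<close>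
  have pt: "f x * ln (\<gamma> x) - f x * ln (f x) \<le> \<gamma> x - f x" for x
  proof (cases "f x = 0")
    case True
    then show ?thesis using \<gamma>_pos[of x] by simp
  next
    case False
    then have fx: "f x > 0" using f_nn[of x] by simp
    have "ln (\<gamma> x / f x) \<le> \<gamma> x / f x - 1"
      using fx \<gamma>_pos[of x] by (intro ln_le_minus_one) simp
    then have "f x * ln (\<gamma> x / f x) \<le> f x * (\<gamma> x / f x - 1)"
      using fx by (intro mult_left_mono) auto
    then show ?thesis using fx \<gamma>_pos[of x] by (simp add: ln_div right_diff_distrib)
  qed
  have "(\<integral>x. f x * ln (\<gamma> x) - f x * ln (f x) \<partial>L) \<le> (\<integral>x. \<gamma> x - f x \<partial>L)"
    by (rule integral_mono) (use int_f int_f\<gamma> int_fln int_\<gamma> pt in auto)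
  then have "- (\<integral>x. f x * ln (f x) \<partial>L) \<le> ln 2 + measure \<mu> A * ln a + (1 - measure \<mu> A) * ln b"
    using int_f int_f\<gamma> int_fln int_\<gamma> I\<gamma> If by (simp add: If\<gamma> mult.commute)
  then show ?thesis
    using True unfolding Ent_def Let_def f_def[symmetric] by simp
qed

subsection \<open>Comparison of the two entropies at finite size\<close>

definition chi_term ::
  "real \<Rightarrow> real \<Rightarrow> nat \<Rightarrow> ('n::finite ncpoly \<Rightarrow> complex) \<Rightarrow> nat \<Rightarrow> ereal" where
  "chi_term R \<epsilon> K \<tau> N = ereal (1 / real N ^ 2) *
       ennreal_log (emeasure (tuple_lebesgue N R) (microstates R \<epsilon> K N \<tau>))
     + ereal (real CARD('n) / 2 * ln (real N))"

definition chi_tilde_term ::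
  "real \<Rightarrow> real \<Rightarrow> nat \<Rightarrow> ('n::finite ncpoly \<Rightarrow> complex) \<Rightarrow> nat \<Rightarrow> ereal" where
  "chi_tilde_term R \<epsilon> K \<tau> N = ereal (1 / real N ^ 2) *
       (SUP \<mu>\<in>{\<mu>. sets \<mu> = sets (tuple_lebesgue N R) \<and> prob_space \<mu> \<and>
                   measure_state N \<mu> \<in> state_nbhd R \<epsilon> K \<tau>}. Ent (tuple_lebesgue N R) \<mu>)
     + ereal (real CARD('n) / 2 * ln (real N))"

lemma chi_with_eq: "chi_with lm R \<tau> = (INF K. INF \<epsilon>\<in>{0<..}. lm (chi_term R \<epsilon> K \<tau>))"
  unfolding chi_with_def chi_term_def[abs_def] ..

lemma chi_tilde_with_eq:
  "chi_tilde_with lm R \<tau> = (INF K. INF \<epsilon>\<in>{0<..}. lm (chi_tilde_term R \<epsilon> K \<tau>))"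
  unfolding chi_tilde_with_def chi_tilde_term_def[abs_def] ..

text \<open>The ball has finite volume, so the value \<open>\<infinity>\<close> of
  \<open>ennreal_log\<close> does not occur, and the case of volume 0 is isolated.\<close>

lemma chi_term_measure:
  fixes \<tau> :: "'n::finite ncpoly \<Rightarrow> complex" and \<epsilon> :: real and K N :: nat
  assumes "N > 0" "R > 0"
  defines "V \<equiv> measure (tuple_lebesgue N R) (microstates R \<epsilon> K N \<tau>)"
  shows "chi_term R \<epsilon> K \<tau> N =
    (if V = 0 then -\<infinity> else ereal (ln V / real N ^ 2 + real CARD('n) / 2 * ln (real N)))"
proof -
  interpret finite_measure "tuple_lebesgue N R :: ('n \<Rightarrow> complex mat) measure"
    by (rule finite_measure_tuple_lebesgue) (use assms in simp)
  have em: "emeasure (tuple_lebesgue N R) (microstates R \<epsilon> K N \<tau>) = ennreal V"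
    by (simp add: V_def emeasure_eq_measure)
  have V: "V \<ge> 0" by (simp add: V_def)
  show ?thesis
  proof (cases "V = 0")
    case True
    then show ?thesis using assms(1) by (simp add: chi_term_def em ennreal_log_def)
  next
    case False
    then have "ennreal_log (ennreal V) = ereal (ln V)"
      using V by (simp add: ennreal_log_def ennreal_eq_0_iff)
    then show ?thesis using False by (simp add: chi_term_def em)
  qed
qed

text \<open>Normalised Lebesgue measure on the microstates is admissible.\<close>

lemma chi_term_le_chi_tilde_term:
  fixes \<tau> :: "'n::finite ncpoly \<Rightarrow> complex"
  assumes NR: "N > 0" "R > 0"
  shows "chi_term R \<epsilon> K \<tau> N \<le> chi_tilde_term R \<epsilon> K \<tau> N"
proof -
  let ?L = "tuple_lebesgue N R :: ('n \<Rightarrow> complex mat) measure"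
  let ?\<Gamma> = "microstates R \<epsilon> K N \<tau>"
  define V where "V = measure ?L ?\<Gamma>"
  have fin: "finite_measure ?L"
    by (rule finite_measure_tuple_lebesgue) (use assms in simp)
  then interpret finite_measure ?L .
  show ?thesis
  proof (cases "V = 0")
    case True
    then show ?thesis using chi_term_measure[OF NR, of \<epsilon> K \<tau>] by (simp add: V_def)
  next
    case False
    then have V: "V > 0" unfolding V_def using measure_nonneg[of ?L ?\<Gamma>] by linarith
    have \<Gamma>: "?\<Gamma> \<in> sets ?L" by (rule microstates_sets[OF NR])
    define \<nu> where "\<nu> = uniform_measure ?L ?\<Gamma>"
    have \<nu>: "prob_space \<nu>" "sets \<nu> = sets ?L"
      unfolding \<nu>_def using V by (auto intro!: prob_space_uniform_measure simp: emeasure_eq_measure V_def)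
    interpret P: prob_space \<nu> by fact
    have "measure_state N \<nu> \<in> state_nbhd R \<epsilon> K \<tau>"
      unfolding state_nbhd_def
    proof (intro CollectI conjI allI impI)
      show "measure_state N \<nu> \<in> trace_states R" by (rule measure_state_trace_state[OF \<nu> NR])
      fix w :: "'n list" assume w: "length w < K"
      have int: "integrable \<nu> (\<lambda>M. matrix_state N M (nc_monom w))"
        by (rule matrix_state_integrable[OF P.finite_measure_axioms \<nu>(2) NR])
      then have intd: "integrable \<nu> (\<lambda>M. \<tau> (nc_monom w) - matrix_state N M (nc_monom w))" by simp
      have "\<tau> (nc_monom w) - measure_state N \<nu> (nc_monom w)
          = (\<integral>M. \<tau> (nc_monom w) - matrix_state N M (nc_monom w) \<partial>\<nu>)"
        unfolding measure_state_def using int by (simp add: P.prob_space)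
      also have "cmod \<dots> \<le> (\<integral>M. cmod (\<tau> (nc_monom w) - matrix_state N M (nc_monom w)) \<partial>\<nu>)"
        by (rule integral_norm_bound)
      also have "\<dots> < \<epsilon>"
      \<comment> \<open>The strict bound survives averaging: the deviation is almost everywhere
        below \<open>\<epsilon>\<close> for a probability measure.\<close>
      proof (rule P.expectation_less)
        show "AE M in \<nu>. cmod (\<tau> (nc_monom w) - matrix_state N M (nc_monom w)) < \<epsilon>"
          unfolding \<nu>_def
          by (rule AE_uniform_measureI[OF \<Gamma>], rule AE_I2)
            (use w in \<open>simp add: microstates_def state_nbhd_def\<close>)
      qed (use intd in simp)
      finally show "cmod (\<tau> (nc_monom w) - measure_state N \<nu> (nc_monom w)) < \<epsilon>" .
    qed
    then have "Ent ?L \<nu> \<le> (SUP \<mu>\<in>{\<mu>. sets \<mu> = sets ?L \<and> prob_space \<mu> \<and>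
        measure_state N \<mu> \<in> state_nbhd R \<epsilon> K \<tau>}. Ent ?L \<mu>)"
      using \<nu> by (intro SUP_upper) auto
    then have le: "ereal (ln V) \<le> (SUP \<mu>\<in>{\<mu>. sets \<mu> = sets ?L \<and> prob_space \<mu> \<and>
        measure_state N \<mu> \<in> state_nbhd R \<epsilon> K \<tau>}. Ent ?L \<mu>)"
      using Ent_uniform_measure[OF fin \<Gamma>] V by (simp add: \<nu>_def V_def)
    have "chi_term R \<epsilon> K \<tau> N
        = ereal (1 / real N ^ 2) * ereal (ln V) + ereal (real CARD('n) / 2 * ln (real N))"
      using chi_term_measure[OF NR, of \<epsilon> K \<tau>] False by (simp add: V_def)
    also have "\<dots> \<le> chi_tilde_term R \<epsilon> K \<tau> N"
      unfolding chi_tilde_term_def by (intro add_right_mono ereal_mult_left_mono le) simp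
    finally show ?thesis .
  qed
qed

text \<open>\<open>Ent_le\<close> is applied to the microstates, which carry mass at least
  \<open>1 - \<delta>\<close>. The weights \<open>1 - \<delta>\<close> and \<open>\<delta>\<close>
  also split the term in \<open>ln (real N)\<close>: one share completes \<open>chi_term\<close>,
  the other turns \<open>ln b\<close> into the constant \<open>C\<close>.\<close>

lemma chi_tilde_term_le:
  fixes \<tau> :: "'n::finite ncpoly \<Rightarrow> complex"
  assumes NR: "N > 0" "R > 0" and \<delta>: "0 < \<delta>" "\<delta> < 1"
    and conc: "\<And>\<mu>. prob_space \<mu> \<Longrightarrow> sets \<mu> = sets (tuple_lebesgue N R) \<Longrightarrow>
      measure_state N \<mu> \<in> state_nbhd R \<epsilon> K \<tau> \<Longrightarrow> measure \<mu> (microstates R \<epsilon>' K' N \<tau>) \<ge> 1 - \<delta>"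
  defines "C \<equiv> real CARD('n) * (R\<^sup>2 / 2 + ln (2 * pi) / 2)"
  shows "chi_tilde_term R \<epsilon> K \<tau> N
    \<le> ereal (1 - \<delta>) * chi_term R \<epsilon>' K' \<tau> N + ereal (\<delta> * C + ln 2 / real N ^ 2)"
proof -
  let ?L = "tuple_lebesgue N R :: ('n \<Rightarrow> complex mat) measure"
  let ?\<Gamma> = "microstates R \<epsilon>' K' N \<tau>"
  let ?S = "{\<mu>. sets \<mu> = sets ?L \<and> prob_space \<mu> \<and> measure_state N \<mu> \<in> state_nbhd R \<epsilon> K \<tau>}"
  define V where "V = measure ?L ?\<Gamma>"
  \<comment> \<open>The Gaussian bound with \<open>s = N / 2\<close>. Per variable and per N^2, its
    logarithm is \<open>R\<^sup>2 / 2 + ln (2 * pi) / 2 - ln (real N) / 2\<close>; the last term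
    cancels the normalisation and leaves \<open>C\<close>.\<close>
  define b where "b = (exp (real N / 2 * (real N * R\<^sup>2)) * sqrt (pi / (real N / 2)) ^ (N * N)) ^ CARD('n)"
  have fin: "finite_measure ?L"
    by (rule finite_measure_tuple_lebesgue) (use assms in simp)
  then interpret finite_measure ?L .
  have \<Gamma>: "?\<Gamma> \<in> sets ?L" by (rule microstates_sets[OF NR])
  have b: "b > 0" using NR by (simp add: b_def)
  have Lb: "measure ?L (space ?L) \<le> b"
  proof -
    have "emeasure ?L (tuple_ball N R) \<le> ennreal b"
      unfolding b_def by (rule tuple_lebesgue_volume) (use NR in auto)
    then show ?thesis using b by (simp add: emeasure_eq_measure)
  qed
  have "V \<le> measure ?L (space ?L)"
    unfolding V_def by (rule bounded_measure)
  then have Vb: "V \<le> b" using Lb by simp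
  have ln_b: "ln b / real N ^ 2 + real CARD('n) / 2 * ln (real N) = C"
  proof -
    have "ln b = real CARD('n) * (real N / 2 * (real N * R\<^sup>2) + real (N * N) * (ln (2 * pi / real N) / 2))"
      using NR unfolding b_def by (simp add: ln_realpow ln_mult ln_sqrt mult.commute)
    also have "ln (2 * pi / real N) = ln (2 * pi) - ln (real N)"
      using NR by (simp add: ln_div)
    finally show ?thesis
      using NR by (simp add: C_def field_simps power2_eq_square)
  qed
  \<comment> \<open>\<open>a\<close> is any positive bound for \<open>V\<close>, so that
    \<open>V = 0\<close> is covered. Since \<open>ln a \<le> ln b\<close>, the bound decreases in
    the mass \<open>p\<close> of the microstates, and \<open>p\<close> may be replaced by
    \<open>1 - \<delta>\<close>.\<close>
  have SUP_le: "(SUP \<mu>\<in>?S. Ent ?L \<mu>) \<le> ereal (ln 2 + (1 - \<delta>) * ln a + \<delta> * ln b)"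
    if a: "0 < a" "V \<le> a" "a \<le> b" for a
  proof (rule SUP_least)
    fix \<mu> assume "\<mu> \<in> ?S"
    then have \<mu>: "prob_space \<mu>" "sets \<mu> = sets ?L" "measure_state N \<mu> \<in> state_nbhd R \<epsilon> K \<tau>" by auto
    define p where "p = measure \<mu> ?\<Gamma>"
    have p: "1 - \<delta> \<le> p" unfolding p_def by (rule conc[OF \<mu>])
    have "Ent ?L \<mu> \<le> ereal (ln 2 + p * ln a + (1 - p) * ln b)"
      unfolding p_def using a b Lb by (intro Ent_le[OF fin \<mu>(1,2) \<Gamma>]) (auto simp: V_def)
    also have "ln 2 + p * ln a + (1 - p) * ln b \<le> ln 2 + (1 - \<delta>) * ln a + \<delta> * ln b"
    proof -
      have "ln a \<le> ln b" using a by simp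
      then have "0 \<le> (p - (1 - \<delta>)) * (ln b - ln a)" using p by (intro mult_nonneg_nonneg) auto
      then show ?thesis by (simp add: algebra_simps)
    qed
    finally show "Ent ?L \<mu> \<le> ereal (ln 2 + (1 - \<delta>) * ln a + \<delta> * ln b)" by simp
  qed
  show ?thesis
  proof (cases "V = 0")
    case True
    have "(SUP \<mu>\<in>?S. Ent ?L \<mu>) = -\<infinity>"
    proof (rule ereal_bot)
      fix r :: real
      \<comment> \<open>Solves \<open>ln 2 + (1 - \<delta>) * ln a + \<delta> * ln b = r\<close> for
        \<open>a\<close>, cut off at \<open>b\<close>. As \<open>r\<close> is arbitrary, microstates
        of volume 0 force the supremum to be \<open>-\<infinity>\<close>.\<close>
      define a where "a = min b (exp ((r - ln 2 - \<delta> * ln b) / (1 - \<delta>)))"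
      have a: "0 < a" "V \<le> a" "a \<le> b" using True b by (auto simp: a_def)
      have "ln a \<le> ln (exp ((r - ln 2 - \<delta> * ln b) / (1 - \<delta>)))"
        using a(1) by (subst ln_le_cancel_iff) (auto simp: a_def)
      then have "(1 - \<delta>) * ln a \<le> r - ln 2 - \<delta> * ln b"
        using \<delta> by (simp add: field_simps)
      then have "ln 2 + (1 - \<delta>) * ln a + \<delta> * ln b \<le> r" by simp
      then show "(SUP \<mu>\<in>?S. Ent ?L \<mu>) \<le> ereal r"
        using order_trans[OF SUP_le[OF a]] by simp
    qed
    then have "chi_tilde_term R \<epsilon> K \<tau> N = -\<infinity>"
      using NR by (simp add: chi_tilde_term_def)
    then show ?thesis by simp
  next
    case False
    then have V: "V > 0" unfolding V_def using measure_nonneg[of ?L ?\<Gamma>] by linarith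
    have "chi_tilde_term R \<epsilon> K \<tau> N \<le> ereal (1 / real N ^ 2) *
        ereal (ln 2 + (1 - \<delta>) * ln V + \<delta> * ln b) + ereal (real CARD('n) / 2 * ln (real N))"
      unfolding chi_tilde_term_def
      by (intro add_right_mono ereal_mult_left_mono SUP_le) (use V Vb in auto)
    also have "\<dots> = ereal ((1 - \<delta>) * (ln V / real N ^ 2 + real CARD('n) / 2 * ln (real N))
        + (\<delta> * C + ln 2 / real N ^ 2))"
      unfolding ln_b[symmetric] using NR by (simp add: field_simps)
    also have "\<dots> = ereal (1 - \<delta>) * chi_term R \<epsilon>' K' \<tau> N + ereal (\<delta> * C + ln 2 / real N ^ 2)"
      using chi_term_measure[OF NR, of \<epsilon>' K' \<tau>] False by (simp add: V_def)
    finally show ?thesis .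
  qed
qed

subsection \<open>Passing to the limit\<close>

lemma Limsup_affine_ereal:
  fixes f :: "'a \<Rightarrow> ereal"
  assumes "F \<noteq> bot" "c \<ge> 0"
  shows "Limsup F (\<lambda>x. ereal c * f x + ereal d) = ereal c * Limsup F f + ereal d"
  using assms by (simp add: Limsup_add_ereal_right Limsup_ereal_mult_left)

lemma Liminf_affine_ereal:
  fixes f :: "'a \<Rightarrow> ereal"
  assumes "F \<noteq> bot" "c \<ge> 0"
  shows "Liminf F (\<lambda>x. ereal c * f x + ereal d) = ereal c * Liminf F f + ereal d"
  using assms by (simp add: Liminf_add_ereal_right Liminf_ereal_mult_left)

text \<open>For real \<open>X\<close> let \<open>\<delta>\<close> tend to 0 with \<open>C\<close>
  fixed. For \<open>X = -\<infinity>\<close> a single \<open>\<delta>\<close> is enough, since a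
  positive multiple of \<open>X\<close> absorbs the constant.\<close>

lemma ereal_le_of_convex_perturbation:
  fixes T X :: ereal
  assumes "\<And>\<delta>. 0 < \<delta> \<Longrightarrow> \<delta> < 1 \<Longrightarrow> T \<le> ereal (1 - \<delta>) * X + ereal (\<delta> * C)"
  shows "T \<le> X"
proof (cases X)
  case (real r)
  have "(\<lambda>n. ereal (r + inverse (real (Suc (Suc n))) * (C - r))) \<longlonglongrightarrow> ereal (r + 0 * (C - r))"
    by (intro tendsto_intros LIMSEQ_Suc[OF LIMSEQ_inverse_real_of_nat])
  moreover have "T \<le> ereal (r + inverse (real (Suc (Suc n))) * (C - r))" for n
  proof -
    define d where "d = inverse (real (Suc (Suc n)))"
    \<comment> \<open>The double successor keeps \<open>d\<close> strictly below 1 already at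
      \<open>n = 0\<close>.\<close>
    have "0 < d" "d < 1" by (simp_all add: d_def inverse_less_1_iff)
    then have "T \<le> ereal ((1 - d) * r + d * C)" using assms[of d] by (simp add: real)
    also have "(1 - d) * r + d * C = r + d * (C - r)" by (simp add: algebra_simps)
    finally show ?thesis unfolding d_def .
  qed
  ultimately show ?thesis using LIMSEQ_le_const real by fastforce
next
  case MInf
  then show ?thesis using assms[of "1 / 2"] by simp
qed simp

text \<open>Only monotonicity along \<open>F\<close> and compatibility with affine maps are asked of
  \<open>lm\<close>, so the three modes of taking the limit are treated together. \<open>F\<close>
  governs the limit in \<open>N\<close>, while \<open>\<omega>\<close> enters through the
  compactness argument.\<close>

lemma chi_tilde_with_eq_chi_with:
  fixes \<tau> :: "'n::finite ncpoly \<Rightarrow> complex"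
  assumes F: "F \<noteq> bot" "F \<le> sequentially" and lm: "lm = Limsup F \<or> lm = Liminf F"
    and "nontrivial_ultrafilter \<omega>" "R > 0" "extreme_trace_state R \<tau>"
  shows "chi_tilde_with lm R \<tau> = chi_with lm R \<tau>"
proof (rule antisym)
  have mono: "lm f \<le> lm g" if "eventually (\<lambda>N. f N \<le> g N) F" for f g
    using lm that Limsup_mono Liminf_mono by metis
  have affine: "lm (\<lambda>N. ereal c * f N + ereal d) = ereal c * lm f + ereal d" if "c \<ge> 0" for c d f
    using lm Limsup_affine_ereal[OF F(1) that] Liminf_affine_ereal[OF F(1) that] by metis
  have ev: "eventually P F" if "eventually P sequentially" for P
    using F(2) that by (rule filter_leD)
  have ev_pos: "eventually (\<lambda>N. N > 0) F" by (rule ev) (rule eventually_gt_at_top)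
  show "chi_with lm R \<tau> \<le> chi_tilde_with lm R \<tau>"
    unfolding chi_with_eq chi_tilde_with_eq
  proof (intro INF_mono bexI)
    show "lm (chi_term R \<epsilon> K \<tau>) \<le> lm (chi_tilde_term R \<epsilon> K \<tau>)" for \<epsilon> K
      using ev_pos by (intro mono, elim eventually_mono) (use assms(5) chi_term_le_chi_tilde_term in blast)
  qed auto
  define C where "C = real CARD('n) * (R\<^sup>2 / 2 + ln (2 * pi) / 2)"
  show "chi_tilde_with lm R \<tau> \<le> chi_with lm R \<tau>"
    unfolding chi_with_eq
  proof (intro INF_greatest)
    fix K' and \<epsilon>' :: real assume "\<epsilon>' \<in> {0<..}"
    then have \<epsilon>': "\<epsilon>' > 0" by simp
    show "chi_tilde_with lm R \<tau> \<le> lm (chi_term R \<epsilon>' K' \<tau>)"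
    proof (rule ereal_le_of_convex_perturbation)
      fix \<delta> :: real assume \<delta>: "0 < \<delta>" "\<delta> < 1"
      obtain K \<epsilon> where \<epsilon>: "\<epsilon> > 0" and conc: "\<And>N \<mu>. N > 0 \<Longrightarrow> prob_space \<mu> \<Longrightarrow>
          sets \<mu> = sets (tuple_lebesgue N R) \<Longrightarrow> measure_state N \<mu> \<in> state_nbhd R \<epsilon> K \<tau> \<Longrightarrow>
          measure \<mu> (microstates R \<epsilon>' K' N \<tau>) \<ge> 1 - \<delta>"
        using extreme_state_concentration[OF assms(4,5,6) \<epsilon>' \<delta>(1), of K'] by blast
      \<comment> \<open>The affine rule wants a constant independent of \<open>N\<close>; the
        summand \<open>ln 2 / real N ^ 2\<close> is eventually below \<open>\<delta>\<close>, which
        turns \<open>C\<close> into \<open>C + 1\<close>.\<close>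
      have "(\<lambda>N. ln 2 / real N ^ 2) \<longlonglongrightarrow> 0" by real_asymp
      then have "eventually (\<lambda>N. ln 2 / real N ^ 2 < \<delta>) F"
        using \<delta>(1) by (intro ev order_tendstoD(2))
      with ev_pos have "eventually (\<lambda>N. chi_tilde_term R \<epsilon> K \<tau> N
          \<le> ereal (1 - \<delta>) * chi_term R \<epsilon>' K' \<tau> N + ereal (\<delta> * (C + 1))) F"
      proof eventually_elim
        case (elim N)
        have "chi_tilde_term R \<epsilon> K \<tau> N
            \<le> ereal (1 - \<delta>) * chi_term R \<epsilon>' K' \<tau> N + ereal (\<delta> * C + ln 2 / real N ^ 2)"
          unfolding C_def by (rule chi_tilde_term_le[OF elim(1) assms(5) \<delta> conc[OF elim(1)]])
        also have "\<dots> \<le> ereal (1 - \<delta>) * chi_term R \<epsilon>' K' \<tau> N + ereal (\<delta> * (C + 1))"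
          using elim(2) by (intro add_left_mono) (simp add: distrib_left)
        finally show ?case .
      qed
      then have "lm (chi_tilde_term R \<epsilon> K \<tau>) \<le> ereal (1 - \<delta>) * lm (chi_term R \<epsilon>' K' \<tau>) + ereal (\<delta> * (C + 1))"
        using mono affine[of "1 - \<delta>"] \<delta>(2) by fastforce
      moreover have "chi_tilde_with lm R \<tau> \<le> lm (chi_tilde_term R \<epsilon> K \<tau>)"
        unfolding chi_tilde_with_eq using \<epsilon> by (intro INF_lower2[of K] INF_lower2[of \<epsilon>]) auto
      ultimately show "chi_tilde_with lm R \<tau> \<le> ereal (1 - \<delta>) * lm (chi_term R \<epsilon>' K' \<tau>) + ereal (\<delta> * (C + 1))"
        by (rule order_trans[rotated])
    qed
  qed
qed

text \<open>If the lower and upper limits differed, a value strictly between them would split the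
  index set, and the ultrafilter contains one of the two halves. So \<open>f\<close> converges along
  \<open>\<omega>\<close>, which gives \<open>Lim\<close> its meaning.\<close>

lemma Lim_ultrafilter_eq_Limsup:
  fixes f :: "nat \<Rightarrow> ereal"
  assumes \<omega>: "nontrivial_ultrafilter \<omega>"
  shows "Lim \<omega> f = Limsup \<omega> f"
proof -
  have bot: "\<omega> \<noteq> bot" by (rule nontrivial_ultrafilterD(1)[OF \<omega>])
  have "Limsup \<omega> f \<le> Liminf \<omega> f"
  proof (rule ccontr)
    assume "\<not> ?thesis"
    then obtain c where c: "Liminf \<omega> f < c" "c < Limsup \<omega> f" using dense not_le by metis
    from nontrivial_ultrafilterD(2)[OF \<omega>, of "\<lambda>N. f N \<le> c"] show False
    proof
      assume "eventually (\<lambda>N. f N \<le> c) \<omega>"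
      then have "Limsup \<omega> f \<le> c" by (rule Limsup_bounded)
      then show False using c by simp
    next
      assume "eventually (\<lambda>N. \<not> f N \<le> c) \<omega>"
      then have "c \<le> Liminf \<omega> f" by (intro Liminf_bounded) (auto elim: eventually_mono)
      then show False using c by simp
    qed
  qed
  then have "Liminf \<omega> f = Limsup \<omega> f" using Liminf_le_Limsup[OF bot] antisym by blast
  then have "(f \<longlongrightarrow> Limsup \<omega> f) \<omega>" using tendsto_iff_Liminf_eq_Limsup[OF bot] by blast
  then show ?thesis by (rule tendsto_Lim[OF bot])
qed

theorem proposition6p2:
  fixes R :: real
    and \<omega> :: "nat filter"
    and \<tau> :: "'n::finite ncpoly \<Rightarrow> complex"
  assumes "CARD('n) > 1"
    and "R > 0"
    and "nontrivial_ultrafilter \<omega>"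
    and "\<tau> \<in> trace_states R"
    and "factor_state \<tau> \<or> extreme_trace_state R \<tau>"
  shows "chi_tilde_lower R \<tau> = chi_lower R \<tau>
    \<and> chi_tilde_ultra \<omega> R \<tau> = chi_ultra \<omega> R \<tau>
    \<and> chi_tilde R \<tau> = chi R \<tau>"
proof -
  have ext: "extreme_trace_state R \<tau>"
    using assms(5) factor_state_imp_extreme[OF assms(2,4)] by blast
  note eq = chi_tilde_with_eq_chi_with[OF _ _ _ assms(3,2) ext]
  have "Lim \<omega> = (Limsup \<omega> :: (nat \<Rightarrow> ereal) \<Rightarrow> ereal)"
    by (rule HOL.ext) (rule Lim_ultrafilter_eq_Limsup[OF assms(3)])
  then show ?thesis
    unfolding chi_tilde_lower_def chi_lower_def chi_tilde_ultra_def chi_ultra_def chi_tilde_def chi_def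
    using eq[of sequentially liminf] eq[of sequentially limsup] eq[of \<omega> "Limsup \<omega>"]
      nontrivial_ultrafilterD(1,3)[OF assms(3)] by simp
qed

end
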